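(* Let $T,\Omega>0$ and let $\Lambda=\{\lambda_k\}_{k\in\mathbb{Z}}\subseteq\mathbb{R}$, $\lambda_{k+1}>\lambda_k$ for all $k\in\mathbb{Z}$, be uniformly discrete. Then: (i) (necessary condition) if $\Lambda$ is a set of sampling for $OPW([0,T]\times[-\frac{\Omega}{2},\frac{\Omega}{2}])$, then $D^-(\Lambda)\geq\Omega$; (ii) (sufficient condition) if $D^-(\Lambda)>\Omega$ and $\lambda_{k+1}-\lambda_k\geq T$ for all $k\in\mathbb{Z}$, then $\Lambda$ is a set of sampling for $OPW([0,T]\times[-\frac{\Omega}{2},\frac{\Omega}{2}])$.
   Context: Hilbert-Schmidt operators: $HS(L^2(\mathbb{R}))$ is the space of operators $Hf(x)=\int\kappa_H(x,t)f(t)\,dt$ with kernel $\kappa_H\in L^2(\mathbb{R}^2)$, and $\|H\|_{HS}=\|\kappa_H\|_{L^2}$. The time-varying impulse response is $h_H(t,x)=\kappa_H(x,x-t)$, so that $Hf(x)=\int h_H(t,x)f(x-t)\,dt$, and the spreading function is $\eta_H(t,\nu)=\int h_H(t,x)e^{-2\pi i x\nu}\,dx$ (in the $L^2$ sense); it is the symplectic Fourier transform of the Kohn-Nirenberg symbol of $H$. For $S\subseteq\mathbb{R}^2$, $OPW(S)=\{H\in HS(L^2(\mathbb{R})): \operatorname{supp}\eta_H\subseteq S\}$. $S_0(\mathbb{R})$ is the Feichtinger algebra of $f\in L^2(\mathbb{R})$ with $V_gf(t,\nu)=\int f(x)\overline{e^{2\pi i\nu x}g(x-t)}\,dx\in L^1(\mathbb{R}^2)$,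 $g(x)=e^{-\pi x^2}$, normed by $\|V_gf\|_{L^1}$; $S_0'(\mathbb{R})$ is its dual. For $S$ compact, every $H\in OPW(S)$ extends to a bounded operator $S_0'(\mathbb{R})\to L^2(\mathbb{R})$; on $f=\sum_k c_k\delta_{\lambda_k}$ it acts by $(Hf)(x)=\sum_k c_k\kappa_H(x,\lambda_k)=\sum_k c_kh_H(x-\lambda_k,x)$, where for a.e. $t$ the function $h_H(t,\cdot)$ is taken to be its continuous representative $x\mapsto\int\eta_H(t,\nu)e^{2\pi i x\nu}\,d\nu$. An element $f\in S_0'(\mathbb{R})$ identifies an operator class $\mathcal{H}$ if there are constants $c,C>0$ with $c\|H\|_{HS}\leq\|Hf\|_{L^2}\leq C\|H\|_{HS}$ for all $H\in\mathcal{H}$. A sequence $\Lambda=\{\lambda_k\}_{k\in\mathbb{Z}}$ is a set of sampling for $\mathcal{H}$ if for some $\{c_k\}\in\ell^\infty(\mathbb{Z})$ we have $\sum_k c_k\delta_{\lambda_k}\in S_0'(\mathbb{R})$ and $\sum_k c_k\delta_{\lambda_k}$ identifies $\mathcal{H}$. $\Lambda$ is uniformly discrete if there is $\delta>0$ with $\lambda_{k+1}-\lambda_k\geq\delta$ for all $k$. The lower Beurling density is $D^-(\Lambda)=\liminf_{h\to\infty}n^-(h)/h$, where $n^-(h)$ is the smallest number of points of $\Lambda$ in an interval $[x-\frac{h}{2},x+\frac{h}{2})$, $x\in\mathbb{R}$. *)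

theory Defs
  imports "HOL-Analysis.Analysis"
begin

text \<open>
  Elements of \<open>L\<^sup>2\<close> are handled through Borel measurable representatives; the
  notions below do not depend on the representative, up to null sets.
\<close>

definition square_integrable :: "'a measure \<Rightarrow> ('a \<Rightarrow> complex) \<Rightarrow> bool" where
  "square_integrable M f \<longleftrightarrow>
     f \<in> borel_measurable M \<and> integrable M (\<lambda>x. (cmod (f x))\<^sup>2)"

definition L2_norm :: "'a measure \<Rightarrow> ('a \<Rightarrow> complex) \<Rightarrow> real" where
  "L2_norm M f = sqrt (LINT x|M. (cmod (f x))\<^sup>2)"

text \<open>
  The \<open>L\<^sup>2\<close> Fourier transform on the real line: \<open>F\<close> is the limit in \<open>L\<^sup>2\<close> of the
  truncated Fourier integrals of \<open>f\<close>. These lie in \<open>L\<^sup>2\<close> because \<open>f\<close> restricted to a bounded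
  interval is in \<open>L\<^sup>1\<close> and \<open>L\<^sup>2\<close>.
\<close>

definition has_L2_fourier :: "(real \<Rightarrow> complex) \<Rightarrow> (real \<Rightarrow> complex) \<Rightarrow> bool" where
  "has_L2_fourier f F \<longleftrightarrow>
     square_integrable lborel f \<and> square_integrable lborel F \<and>
     (\<lambda>N::nat. L2_norm lborel (\<lambda>\<nu>. F \<nu> -
        (LINT x:{- real N..real N}|lborel. f x * exp (- 2 * pi * \<i> * x * \<nu>)))) \<longlonglongrightarrow> 0"

text \<open>
  The support of an almost-everywhere class: the complement of the largest open set on which
  the function vanishes almost everywhere.
\<close>

definition ess_support :: "(real \<times> real \<Rightarrow> complex) \<Rightarrow> (real \<times> real) set" where
  "ess_support F = - \<Union>{U. open U \<and> (AE z in lborel. z \<in> U \<longrightarrow> F z = 0)}"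


subsection \<open>Hilbert-Schmidt operators and operator Paley-Wiener spaces\<close>

text \<open>
  An operator on \<open>L\<^sup>2\<close> is a map on representatives; only its values on square-integrable
  functions, up to null sets, matter.
\<close>

type_synonym L2_operator = "(real \<Rightarrow> complex) \<Rightarrow> (real \<Rightarrow> complex)"

definition has_kernel :: "L2_operator \<Rightarrow> (real \<times> real \<Rightarrow> complex) \<Rightarrow> bool" where
  "has_kernel H \<kappa> \<longleftrightarrow>
     square_integrable lborel \<kappa> \<and>
     (\<forall>f. square_integrable lborel f \<longrightarrow>
        (AE x in lborel. H f x = (LINT t|lborel. \<kappa> (x, t) * f t)))"

definition HS_operators :: "L2_operator set" where
  "HS_operators = {H. \<exists>\<kappa>. has_kernel H \<kappa>}"

text \<open>The kernel is unique up to a null set of the plane.\<close>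

definition hs_kernel :: "L2_operator \<Rightarrow> real \<times> real \<Rightarrow> complex" where
  "hs_kernel H = (SOME \<kappa>. has_kernel H \<kappa>)"

definition HS_norm :: "L2_operator \<Rightarrow> real" where
  "HS_norm H = L2_norm lborel (hs_kernel H)"

definition impulse_response :: "L2_operator \<Rightarrow> real \<Rightarrow> real \<Rightarrow> complex" where
  "impulse_response H t x = hs_kernel H (x, x - t)"

text \<open>
  By Plancherel's theorem every Hilbert-Schmidt operator has a spreading function, and it is
  unique up to a null set of the plane.
\<close>

definition has_spreading_function :: "L2_operator \<Rightarrow> (real \<times> real \<Rightarrow> complex) \<Rightarrow> bool" where
  "has_spreading_function H \<eta> \<longleftrightarrow>
     square_integrable lborel \<eta> \<and>
     (AE t in lborel. has_L2_fourier (impulse_response H t) (\<lambda>\<nu>. \<eta> (t, \<nu>)))"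

definition spreading_function :: "L2_operator \<Rightarrow> real \<times> real \<Rightarrow> complex" where
  "spreading_function H = (SOME \<eta>. has_spreading_function H \<eta>)"

definition OPW :: "(real \<times> real) set \<Rightarrow> L2_operator set" where
  "OPW S = {H \<in> HS_operators. \<exists>\<eta>. has_spreading_function H \<eta> \<and> ess_support \<eta> \<subseteq> S}"

text \<open>
  For operators whose spreading function has compact support, and almost every \<open>t\<close>, this is
  the continuous representative of \<open>impulse_response H t\<close>.
\<close>

definition impulse_response_cont :: "L2_operator \<Rightarrow> real \<Rightarrow> real \<Rightarrow> complex" where
  "impulse_response_cont H t x =
     (LINT \<nu>|lborel. spreading_function H (t, \<nu>) * exp (2 * pi * \<i> * x * \<nu>))"


subsection \<open>The Feichtinger algebra and its dual\<close>

definition STFT :: "(real \<Rightarrow> complex) \<Rightarrow> (real \<Rightarrow> complex) \<Rightarrow> real \<times> real \<Rightarrow> complex" where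
  "STFT g f = (\<lambda>(t, \<nu>). LINT x|lborel. f x * cnj (exp (2 * pi * \<i> * \<nu> * x) * g (x - t)))"

definition gauss_window :: "real \<Rightarrow> complex" where
  "gauss_window x = exp (- of_real (pi * x\<^sup>2))"

text \<open>
  Every class in the Feichtinger algebra has a unique continuous representative. It is the one
  taken here, so that point evaluations make sense.
\<close>

definition S0 :: "(real \<Rightarrow> complex) set" where
  "S0 = {f. continuous_on UNIV f \<and> square_integrable lborel f \<and>
            integrable lborel (STFT gauss_window f)}"

definition S0_norm :: "(real \<Rightarrow> complex) \<Rightarrow> real" where
  "S0_norm f = (LINT z|lborel. cmod (STFT gauss_window f z))"

definition S0_dual :: "((real \<Rightarrow> complex) \<Rightarrow> complex) set" where
  "S0_dual = {\<phi>.
     (\<forall>f\<in>S0. \<forall>g\<in>S0. \<phi> (\<lambda>x. f x + g x) = \<phi> f + \<phi> g) \<and>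
     (\<forall>a. \<forall>f\<in>S0. \<phi> (\<lambda>x. a * f x) = a * \<phi> f) \<and>
     (\<exists>B. \<forall>f\<in>S0. cmod (\<phi> f) \<le> B * S0_norm f)}"

definition delta_train :: "(int \<Rightarrow> complex) \<Rightarrow> (int \<Rightarrow> real) \<Rightarrow> (real \<Rightarrow> complex) \<Rightarrow> complex" where
  "delta_train c \<Lambda> f = (\<Sum>\<^sub>\<infinity>k. c k * f (\<Lambda> k))"

text \<open>
  Convergence of the series is required separately, since \<open>infsum\<close> is \<open>0\<close> for series that do
  not converge.
\<close>

definition delta_train_in_S0_dual :: "(int \<Rightarrow> complex) \<Rightarrow> (int \<Rightarrow> real) \<Rightarrow> bool" where
  "delta_train_in_S0_dual c \<Lambda> \<longleftrightarrow>
     (\<forall>f\<in>S0. (\<lambda>k. c k * f (\<Lambda> k)) summable_on UNIV) \<and> delta_train c \<Lambda> \<in> S0_dual"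


subsection \<open>Identification and sampling\<close>

text \<open>
  The action on a weighted delta train of (the extension of) an operator whose spreading
  function has compact support.
\<close>

definition apply_delta_train ::
    "L2_operator \<Rightarrow> (int \<Rightarrow> complex) \<Rightarrow> (int \<Rightarrow> real) \<Rightarrow> real \<Rightarrow> complex" where
  "apply_delta_train H c \<Lambda> x = (\<Sum>\<^sub>\<infinity>k. c k * impulse_response_cont H (x - \<Lambda> k) x)"

text \<open>
  Square integrability of the output is stated explicitly, because \<open>L2_norm\<close> is
  \<open>0\<close> for functions that are not square integrable.
\<close>

definition delta_train_identifies ::
    "(int \<Rightarrow> complex) \<Rightarrow> (int \<Rightarrow> real) \<Rightarrow> L2_operator set \<Rightarrow> bool" where
  "delta_train_identifies c \<Lambda> \<H> \<longleftrightarrow>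
     (\<exists>A>0. \<exists>B>0. \<forall>H\<in>\<H>.
        square_integrable lborel (apply_delta_train H c \<Lambda>) \<and>
        A * HS_norm H \<le> L2_norm lborel (apply_delta_train H c \<Lambda>) \<and>
        L2_norm lborel (apply_delta_train H c \<Lambda>) \<le> B * HS_norm H)"

definition set_of_sampling :: "(int \<Rightarrow> real) \<Rightarrow> L2_operator set \<Rightarrow> bool" where
  "set_of_sampling \<Lambda> \<H> \<longleftrightarrow>
     (\<exists>c. bounded (range c) \<and> delta_train_in_S0_dual c \<Lambda> \<and> delta_train_identifies c \<Lambda> \<H>)"


subsection \<open>Discreteness and density\<close>

definition uniformly_discrete :: "(int \<Rightarrow> real) \<Rightarrow> bool" where
  "uniformly_discrete \<Lambda> \<longleftrightarrow> (\<exists>\<delta>>0. \<forall>k. \<Lambda> (k + 1) - \<Lambda> k \<ge> \<delta>)"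

text \<open>
  Meant for sequences with finitely many points in each bounded interval, such as the uniformly
  discrete ones: \<open>card\<close> is \<open>0\<close> on infinite sets. The infimum of a nonempty set of
  natural numbers is its minimum.
\<close>

definition min_points :: "(int \<Rightarrow> real) \<Rightarrow> real \<Rightarrow> nat" where
  "min_points \<Lambda> h = (INF x::real. card (range \<Lambda> \<inter> {x - h / 2..<x + h / 2}))"

definition lower_beurling_density :: "(int \<Rightarrow> real) \<Rightarrow> ereal" where
  "lower_beurling_density \<Lambda> = Liminf at_top (\<lambda>h::real. ereal (real (min_points \<Lambda> h) / h))"

end

theory Submission
  imports
    Defs
    "HOL-Probability.Probability"
    "HOL-Complex_Analysis.Complex_Analysis"
    "HOL-Real_Asymp.Real_Asymp"
begin

text \<open>
  If the gaps of \<open>\<Lambda>\<close> are at least \<open>T\<close>, the summands of the response to a delta train have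
  disjoint supports, and by Plancherel's theorem identification of the operator class is the same
  as a sampling inequality \<open>\<parallel>F\<parallel>\<^sup>2 \<le> C \<Sum>\<^sub>k |f (\<lambda>\<^sub>k)|\<^sup>2\<close> for the functions \<open>f\<close> whose Fourier transform
  \<open>F\<close> lives on \<open>[-\<Omega>/2, \<Omega>/2]\<close>, applied for almost every \<open>t\<close> to the section of the spreading
  function at \<open>t\<close>. For the necessary condition this can be assumed after shrinking \<open>T\<close>.

  Density above \<open>\<Omega>\<close> suffices for sampling by a finite, quantitative form of Jensen's formula.
  Subtract from \<open>f\<close> its Lagrange interpolant at the points of \<open>\<Lambda>\<close> within distance \<open>R\<close> of \<open>x\<close>,
  divide by the Blaschke product of these points and multiply by a nonvanishing function of
  modulus \<open>exp (- \<pi> \<Omega> |Im z|)\<close> on the circle of radius \<open>R\<close>. The mean value property bounds \<open>|f x|\<close>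
  by the samples plus a multiple of the mean of \<open>|f| exp (- \<pi> \<Omega> |Im z|)\<close> over the circle, and the
  factor tends to \<open>0\<close> as \<open>R\<close> grows because of the density. Squaring and integrating over \<open>x\<close>
  absorbs this mean into \<open>\<parallel>F\<parallel>\<^sup>2\<close>. Conversely, if the density is below \<open>\<Omega>\<close>, a dimension count
  yields combinations of translates of a well localized window that vanish at all nearby sampling
  points, so that the sampling inequality fails.
\<close>

subsection \<open>Plancherel's theorem\<close>

text \<open>The value \<open>\<Omega>\<close> is critical because two exponentials balance. Over a
  circle of radius \<open>R\<close> the mean of \<open>pi * \<Omega> * R * \<bar>sin t\<bar>\<close>
  is \<open>2 * \<Omega> * R\<close>, while about \<open>2 * D * R\<close> evenly spread points give
  a Blaschke product of size about \<open>exp (- (2 * D * R))\<close> at the centre; the quotient is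
  small for large \<open>R\<close> as soon as \<open>D > \<Omega>\<close>. One fixed
  \<open>R\<close> then serves all functions, so no compactness is involved. The weight must be
  exactly \<open>exp (- (pi * \<Omega> * \<bar>Im z\<bar>))\<close> on the circle, since this
  offsets the possible growth of the L2 norm along horizontal lines, and the circle term integrates
  to at most the norm that has to absorb it. Shrinking \<open>T\<close> is harmless for necessity: a
  narrower strip gives a subclass of operators, and identification passes to subclasses. In the
  dimension count the translates have spacing \<open>1 / L\<close> with \<open>L < \<Omega>\<close>:
  this room lets the window taper to 0 at the band edges, hence decay fast enough, and still stay
  bounded below on the band of length \<open>L\<close>, which keeps its translates linearly
  stable.\<close>

lemma square_integrableD:
  assumes "square_integrable M f"
  shows "f \<in> borel_measurable M" "integrable M (\<lambda>x. (cmod (f x))\<^sup>2)"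
  using assms by (auto simp: square_integrable_def)

lemma square_integrable_bound:
  assumes "integrable M g" "f \<in> borel_measurable M" "AE x in M. (cmod (f x))\<^sup>2 \<le> g x"
  shows "square_integrable M f"
  unfolding square_integrable_def
proof
  show "integrable M (\<lambda>x. (cmod (f x))\<^sup>2)"
    by (rule Bochner_Integration.integrable_bound[OF assms(1)])
       (use assms in \<open>auto elim!: eventually_mono\<close>)
qed fact

text \<open>Values in \<open>ennreal\<close> allow Tonelli and the sampling inequalities to be used
  before finiteness is known; \<open>L2_norm\<close> is 0 on functions that are not square
  integrable and would hide divergence.\<close>

abbreviation energy :: "'a measure \<Rightarrow> ('a \<Rightarrow> complex) \<Rightarrow> ennreal" where
  "energy M f \<equiv> (\<integral>\<^sup>+x. ennreal ((cmod (f x))\<^sup>2) \<partial>M)"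

lemma square_integrable_iff_nn_integral:
  assumes "f \<in> borel_measurable M"
  shows "square_integrable M f \<longleftrightarrow> energy M f < \<infinity>"
  using assms by (auto simp: square_integrable_def integrable_iff_bounded)

lemma nn_integral_eq_L2_norm:
  assumes "square_integrable M f"
  shows "energy M f = ennreal ((L2_norm M f)\<^sup>2)"
  using assms by (simp add: nn_integral_eq_integral square_integrable_def L2_norm_def)

lemma L2_norm_nonneg [simp]: "0 \<le> L2_norm M f"
  by (simp add: L2_norm_def)

lemma L2_norm_sq: "(L2_norm M f)\<^sup>2 = (LINT x|M. (cmod (f x))\<^sup>2)"
  by (simp add: L2_norm_def)

lemma L2_norm_le_if_nn_integral_le:
  assumes "square_integrable M f" "square_integrable N g"
    and "energy M f \<le> energy N g"
  shows "L2_norm M f \<le> L2_norm N g"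
  using assms(3) by (simp add: nn_integral_eq_L2_norm assms(1,2) abs_le_square_iff[symmetric])

lemma L2_norm_cong_AE:
  assumes "f \<in> borel_measurable M" "g \<in> borel_measurable M" "AE x in M. f x = g x"
  shows "L2_norm M f = L2_norm M g"
proof -
  have "(LINT x|M. (cmod (f x))\<^sup>2) = (LINT x|M. (cmod (g x))\<^sup>2)"
    by (rule integral_cong_AE) (use assms in auto)
  then show ?thesis by (simp add: L2_norm_def)
qed

lemma square_integrable_cong_AE:
  assumes "square_integrable M f" "g \<in> borel_measurable M" "AE x in M. f x = g x"
  shows "square_integrable M g"
  by (rule square_integrable_bound[of M "\<lambda>x. (cmod (f x))\<^sup>2"])
     (use assms in \<open>auto simp: square_integrable_def elim!: eventually_mono\<close>)

text \<open>Young's inequality with a free parameter: \<open>s = 1\<close> gives the crude bound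
  with factors 2, and the optimal \<open>s\<close> gives Minkowski's inequality.\<close>

lemma weighted_square_add:
  fixes a b s :: real
  assumes "s > 0"
  shows "(a + b)\<^sup>2 \<le> (1 + s) * a\<^sup>2 + (1 + 1 / s) * b\<^sup>2"
proof -
  have "0 \<le> (s * a - b)\<^sup>2 / s" using assms by simp
  also have "\<dots> = s * a\<^sup>2 - 2 * a * b + b\<^sup>2 / s"
    using assms by (simp add: power2_diff power_mult_distrib field_simps power2_eq_square)
  finally show ?thesis by (simp add: power2_sum algebra_simps)
qed

lemma square_integrable_add:
  assumes "square_integrable M f" "square_integrable M g"
  shows "square_integrable M (\<lambda>x. f x + g x)"
proof (rule square_integrable_bound[of M "\<lambda>x. 2 * (cmod (f x))\<^sup>2 + 2 * (cmod (g x))\<^sup>2"])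
  show "AE x in M. (cmod (f x + g x))\<^sup>2 \<le> 2 * (cmod (f x))\<^sup>2 + 2 * (cmod (g x))\<^sup>2"
  proof (rule AE_I2)
    fix x
    have "(cmod (f x + g x))\<^sup>2 \<le> (cmod (f x) + cmod (g x))\<^sup>2"
      by (intro power_mono norm_triangle_ineq) auto
    also have "\<dots> \<le> 2 * (cmod (f x))\<^sup>2 + 2 * (cmod (g x))\<^sup>2"
      using weighted_square_add[of 1 "cmod (f x)" "cmod (g x)"] by simp
    finally show "(cmod (f x + g x))\<^sup>2 \<le> 2 * (cmod (f x))\<^sup>2 + 2 * (cmod (g x))\<^sup>2" .
  qed
qed (use assms in \<open>auto simp: square_integrable_def\<close>)

lemma square_integrable_cmult:
  assumes "square_integrable M f"
  shows "square_integrable M (\<lambda>x. c * f x)"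
  using assms by (auto simp: square_integrable_def norm_mult power_mult_distrib)

lemma square_integrable_diff:
  assumes "square_integrable M f" "square_integrable M g"
  shows "square_integrable M (\<lambda>x. f x - g x)"
  using square_integrable_add[OF assms(1) square_integrable_cmult[OF assms(2), of "-1"]] by simp

text \<open>With \<open>s = b / a\<close> the right side of \<open>weighted_square_add\<close>
  collapses to \<open>(a + b)\<^sup>2\<close>, so integrating that inequality proves Minkowski's
  inequality directly.\<close>

lemma L2_norm_triangle:
  assumes f: "square_integrable M f" and g: "square_integrable M g"
  shows "L2_norm M (\<lambda>x. f x + g x) \<le> L2_norm M f + L2_norm M g"
proof -
  define a b where "a = L2_norm M f" and "b = L2_norm M g"
  have weighted: "(L2_norm M (\<lambda>x. f x + g x))\<^sup>2 \<le> (1 + s) * a\<^sup>2 + (1 + 1 / s) * b\<^sup>2" if "s > 0" for s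
  proof -
    have "(LINT x|M. (cmod (f x + g x))\<^sup>2)
        \<le> (LINT x|M. (1 + s) * (cmod (f x))\<^sup>2 + (1 + 1 / s) * (cmod (g x))\<^sup>2)"
    proof (rule integral_mono)
      show "(cmod (f x + g x))\<^sup>2 \<le> (1 + s) * (cmod (f x))\<^sup>2 + (1 + 1 / s) * (cmod (g x))\<^sup>2" for x
        by (rule order_trans[OF power_mono[OF norm_triangle_ineq] weighted_square_add[OF that]]) auto
      show "integrable M (\<lambda>x. (cmod (f x + g x))\<^sup>2)"
        using square_integrable_add[OF f g] by (simp add: square_integrable_def)
    qed (use f g in \<open>auto simp: square_integrable_def\<close>)
    also have "\<dots> = (1 + s) * a\<^sup>2 + (1 + 1 / s) * b\<^sup>2"
      using f g by (simp add: square_integrable_def a_def b_def L2_norm_sq)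
    finally show ?thesis by (simp add: L2_norm_sq)
  qed
  have nonneg: "a \<ge> 0" "b \<ge> 0" by (auto simp: a_def b_def)
  \<comment> \<open>Adding \<open>\<epsilon>\<close> to both norms keeps the quotient
    \<open>B / A\<close> defined and positive when a norm is 0.\<close>
  have "(L2_norm M (\<lambda>x. f x + g x)) \<le> (a + \<epsilon>) + (b + \<epsilon>)" if \<epsilon>: "\<epsilon> > 0" for \<epsilon>
  proof -
    define A B where "A = a + \<epsilon>" and "B = b + \<epsilon>"
    have pos: "A > 0" "B > 0" using nonneg \<epsilon> by (auto simp: A_def B_def)
    have "(L2_norm M (\<lambda>x. f x + g x))\<^sup>2 \<le> (1 + B / A) * a\<^sup>2 + (1 + 1 / (B / A)) * b\<^sup>2"
      using pos by (intro weighted) auto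
    also have "\<dots> \<le> (1 + B / A) * A\<^sup>2 + (1 + 1 / (B / A)) * B\<^sup>2"
      using pos nonneg \<epsilon> by (intro add_mono mult_left_mono power_mono) (auto simp: A_def B_def)
    also have "\<dots> = (A + B)\<^sup>2"
      using pos by (simp add: field_simps power2_eq_square)
    finally show ?thesis
      using pos by (auto simp: A_def B_def intro: power2_le_imp_le)
  qed
  note le = this
  have "L2_norm M (\<lambda>x. f x + g x) \<le> a + b + e" if "e > 0" for e
    using le[of "e / 2"] that by simp
  then show ?thesis
    unfolding a_def b_def by (rule field_le_epsilon)
qed

lemma L2_norm_minus_commute: "L2_norm M (\<lambda>x. f x - g x) = L2_norm M (\<lambda>x. g x - f x)"
  by (simp add: L2_norm_def norm_minus_commute)

lemma L2_norm_diff_bound: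
  assumes f: "square_integrable M f" and g: "square_integrable M g"
  shows "\<bar>L2_norm M f - L2_norm M g\<bar> \<le> L2_norm M (\<lambda>x. f x - g x)"
  using L2_norm_triangle[OF square_integrable_diff[OF f g] g]
    L2_norm_triangle[OF square_integrable_diff[OF g f] f]
  by (simp add: L2_norm_minus_commute[of M g f])

lemma AE_eq_0_if_L2_norm_0:
  assumes "square_integrable M f" "L2_norm M f = 0"
  shows "AE x in M. f x = 0"
proof -
  have "(LINT x|M. (cmod (f x))\<^sup>2) = 0"
    using assms(2) L2_norm_sq[of M f] by simp
  then show ?thesis
    using assms(1) by (subst (asm) integral_nonneg_eq_0_iff_AE) (auto simp: square_integrable_def)
qed

lemma L2_norm_dominated_limit:
  assumes w: "integrable M w" and "f \<in> borel_measurable M" "\<And>n. s n \<in> borel_measurable M"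
    and lim: "AE x in M. (\<lambda>n. s n x) \<longlonglongrightarrow> f x"
    and dom: "\<And>n. AE x in M. (cmod (s n x - f x))\<^sup>2 \<le> w x"
  shows "(\<lambda>n. L2_norm M (\<lambda>x. s n x - f x)) \<longlonglongrightarrow> 0"
proof -
  have "(\<lambda>n. LINT x|M. (cmod (s n x - f x))\<^sup>2) \<longlonglongrightarrow> (LINT x|M. 0)"
  proof (rule integral_dominated_convergence[OF _ _ w])
    show "AE x in M. (\<lambda>n. (cmod (s n x - f x))\<^sup>2) \<longlonglongrightarrow> 0"
      using lim
    proof eventually_elim
      case (elim x)
      then have "(\<lambda>n. (cmod (s n x - f x))\<^sup>2) \<longlonglongrightarrow> (cmod (f x - f x))\<^sup>2"
        by (intro tendsto_intros)
      then show ?case by simp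
    qed
  qed (use assms in auto)
  then have "(\<lambda>n. sqrt (LINT x|M. (cmod (s n x - f x))\<^sup>2)) \<longlonglongrightarrow> sqrt 0"
    by (intro tendsto_real_sqrt) simp
  then show ?thesis by (simp add: L2_norm_def)
qed

lemma integrable_mult_square_integrable:
  assumes "square_integrable M f" "square_integrable M g"
  shows "integrable M (\<lambda>x. f x * g x)"
proof (rule Bochner_Integration.integrable_bound[of _ "\<lambda>x. (cmod (f x))\<^sup>2 + (cmod (g x))\<^sup>2"])
  show "AE x in M. norm (f x * g x) \<le> norm ((cmod (f x))\<^sup>2 + (cmod (g x))\<^sup>2)"
  proof (rule AE_I2)
    fix x
    have "2 * (cmod (f x) * cmod (g x)) \<le> (cmod (f x))\<^sup>2 + (cmod (g x))\<^sup>2"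
      using sum_squares_bound[of "cmod (f x)" "cmod (g x)"] by simp
    moreover have "0 \<le> cmod (f x) * cmod (g x)" by simp
    ultimately show "norm (f x * g x) \<le> norm ((cmod (f x))\<^sup>2 + (cmod (g x))\<^sup>2)"
      unfolding norm_mult real_norm_def by linarith
  qed
qed (use assms in \<open>auto simp: square_integrable_def\<close>)

lemma integrable_if_square_integrable_bounded_support:
  assumes f: "square_integrable lborel f" and supp: "AE x in lborel. x \<notin> {a..b::real} \<longrightarrow> f x = 0"
  shows "integrable lborel f"
proof -
  have "square_integrable lborel (\<lambda>x. indicator {a..b} x :: complex)"
    by (rule square_integrable_bound[of _ "indicator {a..b}"])
       (auto simp: indicator_def intro!: integrable_real_indicator emeasure_bounded_finite)
  from integrable_mult_square_integrable[OF f this]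
  have "integrable lborel (\<lambda>x. f x * indicator {a..b} x)" .
  then show ?thesis
    by (rule integrable_cong_AE_imp)
       (use f supp in \<open>auto simp: square_integrable_def indicator_def elim!: eventually_mono\<close>)
qed


section \<open>Fourier integrals and Gaussian summation\<close>

definition fourier :: "(real \<Rightarrow> complex) \<Rightarrow> real \<Rightarrow> complex" where
  "fourier f \<nu> = (LINT x|lborel. f x * cis (- (2 * pi * x * \<nu>)))"

lemma borel_measurable_cis [measurable (raw)]:
  "f \<in> borel_measurable M \<Longrightarrow> (\<lambda>x. cis (f x)) \<in> borel_measurable M"
  by (rule measurable_compose[of f M borel cis])
     (auto intro!: borel_measurable_continuous_onI continuous_intros)

lemma borel_measurable_fourier [measurable]:
  assumes [measurable]: "f \<in> borel_measurable lborel"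
  shows "fourier f \<in> borel_measurable lborel"
  unfolding fourier_def by measurable

lemma integrable_mult_cis:
  assumes "integrable M f" "\<theta> \<in> borel_measurable M"
  shows "integrable M (\<lambda>x. f x * cis (\<theta> x))"
  by (rule Bochner_Integration.integrable_bound[OF assms(1)])
     (use assms in \<open>auto simp: norm_mult\<close>)

lemma norm_fourier_le: "cmod (fourier f \<nu>) \<le> (LINT x|lborel. cmod (f x))"
  unfolding fourier_def by (rule order_trans[OF integral_norm_bound]) (simp add: norm_mult)

text \<open>A centred normal density with standard deviation
  \<open>\<epsilon> / sqrt (2 * pi)\<close>, so scaled that it is the Fourier transform of
  \<open>gauss_weight \<epsilon>\<close>. Its means stand in for the inversion integral, which need
  not converge absolutely.\<close>

definition gauss_kernel :: "real \<Rightarrow> real \<Rightarrow> real" where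
  "gauss_kernel \<epsilon> y = exp (- (pi * (y / \<epsilon>)\<^sup>2)) / \<epsilon>"

abbreviation gauss_mean :: "real \<Rightarrow> (real \<Rightarrow> complex) \<Rightarrow> real \<Rightarrow> complex" where
  "gauss_mean \<epsilon> p x \<equiv> (LINT y|lborel. p y * complex_of_real (gauss_kernel \<epsilon> (x - y)))"

abbreviation gauss_weight :: "real \<Rightarrow> real \<Rightarrow> real" where
  "gauss_weight \<epsilon> \<nu> \<equiv> exp (- (pi * (\<epsilon> * \<nu>)\<^sup>2))"

lemma gauss_kernel_normal_density:
  assumes "\<epsilon> > 0"
  shows "gauss_kernel \<epsilon> y = normal_density 0 (\<epsilon> / sqrt (2 * pi)) y"
  using assms by (simp add: gauss_kernel_def normal_density_def real_sqrt_divide real_sqrt_mult power_divide field_simps)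

lemma integrable_gauss_kernel: "\<epsilon> > 0 \<Longrightarrow> integrable lborel (gauss_kernel \<epsilon>)"
  using integrable_normal_density[of "\<epsilon> / sqrt (2 * pi)" 0]
  by (subst ext[OF gauss_kernel_normal_density]) auto

lemma integral_gauss_kernel: "\<epsilon> > 0 \<Longrightarrow> (LINT y|lborel. gauss_kernel \<epsilon> y) = 1"
  using integral_normal_density[of "\<epsilon> / sqrt (2 * pi)" 0]
  by (simp add: gauss_kernel_normal_density cong: Bochner_Integration.integral_cong)

lemma gauss_kernel_nonneg [simp]: "\<epsilon> > 0 \<Longrightarrow> 0 \<le> gauss_kernel \<epsilon> y"
  by (simp add: gauss_kernel_def)

lemma borel_measurable_gauss_kernel [measurable]: "gauss_kernel \<epsilon> \<in> borel_measurable borel"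
  unfolding gauss_kernel_def by measurable

lemma gauss_kernel_minus: "gauss_kernel \<epsilon> (x - y) = gauss_kernel \<epsilon> (y - x)"
  by (simp add: gauss_kernel_def power_divide power2_commute)

lemma nn_integral_gauss_kernel_shift:
  assumes "\<epsilon> > 0"
  shows "(\<integral>\<^sup>+x. ennreal (gauss_kernel \<epsilon> (x - y)) \<partial>lborel) = 1"
proof -
  have "(\<integral>\<^sup>+x. ennreal (gauss_kernel \<epsilon> x) \<partial>lborel) = 1"
    using assms by (subst nn_integral_eq_integral) (auto simp: integrable_gauss_kernel integral_gauss_kernel)
  then show ?thesis
    using nn_integral_real_affine[of "\<lambda>x. ennreal (gauss_kernel \<epsilon> x)" 1 "- y"] by simp
qed

lemma integrable_gauss: 
  assumes "\<epsilon> > 0" shows "integrable lborel (\<lambda>\<nu>::real. gauss_weight \<epsilon> \<nu>)"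
proof -
  have eq: "gauss_kernel (1 / \<epsilon>) = (\<lambda>\<nu>. \<epsilon> * gauss_weight \<epsilon> \<nu>)"
    using assms by (auto simp: gauss_kernel_def mult_ac)
  have "integrable lborel (\<lambda>\<nu>. \<epsilon> * gauss_weight \<epsilon> \<nu>)"
    using integrable_gauss_kernel[of "1 / \<epsilon>"] assms
    unfolding eq by simp
  with assms show ?thesis by simp
qed

text \<open>This is the characteristic function of the standard normal law after the substitution
  \<open>x = c * \<nu>\<close>; the factor \<open>c = \<epsilon> * sqrt (2 * pi)\<close> is the one
  with \<open>(c * \<nu>)\<^sup>2 / 2 = pi * (\<epsilon> * \<nu>)\<^sup>2\<close>.\<close>

lemma fourier_gauss:
  assumes "\<epsilon> > 0"
  shows "(LINT \<nu>|lborel. complex_of_real (gauss_weight \<epsilon> \<nu>) * cis (2 * pi * y * \<nu>))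
       = complex_of_real (gauss_kernel \<epsilon> y)"
proof -
  define c where "c = \<epsilon> * sqrt (2 * pi)"
  define t where "t = 2 * pi * y / c"
  have c: "c > 0" using assms by (simp add: c_def)
  have c2: "c\<^sup>2 = \<epsilon>\<^sup>2 * (2 * pi)" by (simp add: c_def power_mult_distrib)
  have "complex_of_real (exp (- (t\<^sup>2) / 2)) = char std_normal_distribution t"
    by (simp add: char_std_normal_distribution)
  also have "\<dots> = (LINT x|lborel. std_normal_density x *\<^sub>R iexp (t * x))"
    unfolding char_def by (subst integral_density) (auto simp: normal_density_nonneg)
  also have "\<dots> = \<bar>c\<bar> *\<^sub>R (LINT \<nu>|lborel. std_normal_density (0 + c * \<nu>) *\<^sub>R iexp (t * (0 + c * \<nu>)))"
    using c by (intro lborel_integral_real_affine) auto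
  also have "(\<lambda>\<nu>. std_normal_density (0 + c * \<nu>) *\<^sub>R iexp (t * (0 + c * \<nu>))) =
      (\<lambda>\<nu>. complex_of_real (1 / sqrt (2 * pi)) * (complex_of_real (gauss_weight \<epsilon> \<nu>) * cis (2 * pi * y * \<nu>)))"
  proof
    fix \<nu>
    have 1: "t * (c * \<nu>) = 2 * pi * y * \<nu>" using c by (simp add: t_def)
    have 2: "(c * \<nu>)\<^sup>2 / 2 = pi * (\<epsilon> * \<nu>)\<^sup>2" by (simp add: c2 power_mult_distrib)
    show "std_normal_density (0 + c * \<nu>) *\<^sub>R iexp (t * (0 + c * \<nu>)) =
      complex_of_real (1 / sqrt (2 * pi)) * (complex_of_real (gauss_weight \<epsilon> \<nu>) * cis (2 * pi * y * \<nu>))"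
      unfolding add_0 1 using 2
      by (simp add: normal_density_def scaleR_conv_of_real cis_conv_exp flip: exp_of_real)
  qed
  finally have "exp (- (t\<^sup>2) / 2) = c * (complex_of_real (1 / sqrt (2 * pi)) *
      (LINT \<nu>|lborel. complex_of_real (gauss_weight \<epsilon> \<nu>) * cis (2 * pi * y * \<nu>)))"
    using c by (simp add: scaleR_conv_of_real)
  also have "\<dots> = \<epsilon> * (LINT \<nu>|lborel. complex_of_real (gauss_weight \<epsilon> \<nu>) * cis (2 * pi * y * \<nu>))"
    by (simp add: c_def)
  finally have "(LINT \<nu>|lborel. complex_of_real (gauss_weight \<epsilon> \<nu>) * cis (2 * pi * y * \<nu>))
      = complex_of_real (exp (- (t\<^sup>2) / 2) / \<epsilon>)"
    using assms by simp
  moreover have "t\<^sup>2 / 2 = pi * (y / \<epsilon>)\<^sup>2"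
    unfolding t_def power_divide c2 power_mult_distrib using assms
    by (simp add: field_simps power2_eq_square)
  ultimately show ?thesis
    by (simp add: gauss_kernel_def)
qed

text \<open>Justifies exchanges of Bochner integrals: two integrable factors in separate variables
  and a bounded coupling factor, in the applications a character.\<close>

lemma integrable_pair_mult:
  fixes f g :: "real \<Rightarrow> complex" and h :: "real \<times> real \<Rightarrow> complex"
  assumes [measurable]: "integrable lborel f" "integrable lborel g" 
    and [measurable]: "h \<in> borel_measurable (lborel \<Otimes>\<^sub>M lborel)" and bound: "\<And>z. cmod (h z) \<le> C"
  shows "integrable (lborel \<Otimes>\<^sub>M lborel) (\<lambda>(x, y). f x * g y * h (x, y))"
proof (rule Bochner_Integration.integrable_bound)
  show "integrable (lborel \<Otimes>\<^sub>M lborel) (\<lambda>(x, y). C * (cmod (f x) * cmod (g y)))"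
  proof (rule lborel_pair.Fubini_integrable)
    show "integrable lborel (\<lambda>x. LINT y|lborel. norm (case (x, y) of (x, y) \<Rightarrow> C * (cmod (f x) * cmod (g y))))"
      using assms(1) by (simp add: norm_mult abs_mult)
    show "AE x in lborel. integrable lborel (\<lambda>y. case (x, y) of (x, y) \<Rightarrow> C * (cmod (f x) * cmod (g y)))"
      using assms(2) by auto
  qed measurable
  have "cmod (f x * g y * h (x, y)) \<le> \<bar>C * (cmod (f x) * cmod (g y))\<bar>" for x y
    using mult_left_mono[OF bound[of "(x, y)"], of "cmod (f x) * cmod (g y)"]
    by (intro order_trans[OF _ abs_ge_self]) (simp add: norm_mult mult_ac)
  then show "AE z in lborel \<Otimes>\<^sub>M lborel. norm (case z of (x, y) \<Rightarrow> f x * g y * h (x, y))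
      \<le> norm (case z of (x, y) \<Rightarrow> C * (cmod (f x) * cmod (g y)))"
    by (auto simp: norm_mult abs_mult)
qed measurable

text \<open>The Gaussian factor makes the inversion integral absolutely convergent, so Fubini
  applies and the inner integral over the frequencies is \<open>fourier_gauss\<close>.\<close>

lemma gauss_summation:
  assumes p: "integrable lborel p" and \<epsilon>: "\<epsilon> > 0"
  shows "(LINT \<nu>|lborel. complex_of_real (gauss_weight \<epsilon> \<nu>) * (fourier p \<nu> * cis (2 * pi * x * \<nu>)))
       = gauss_mean \<epsilon> p x"
proof -
  let ?g = "\<lambda>\<nu>. complex_of_real (gauss_weight \<epsilon> \<nu>)"
  let ?F = "\<lambda>(\<nu>, y). ?g \<nu> * p y * cis (2 * pi * (x - y) * \<nu>)"
  have [measurable]: "p \<in> borel_measurable lborel" using p by simp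
  have "integrable (lborel \<Otimes>\<^sub>M lborel) (\<lambda>(\<nu>, y). ?g \<nu> * p y * (\<lambda>(\<nu>, y). cis (2 * pi * (x - y) * \<nu>)) (\<nu>, y))"
    by (rule integrable_pair_mult[where C=1])
       (use p \<epsilon> integrable_gauss[OF \<epsilon>] in \<open>auto simp del: of_real_exp\<close>)
  then have int: "integrable (lborel \<Otimes>\<^sub>M lborel) ?F" by simp
  have "(LINT \<nu>|lborel. ?g \<nu> * (fourier p \<nu> * cis (2 * pi * x * \<nu>))) = 
      (LINT \<nu>|lborel. LINT y|lborel. ?F (\<nu>, y))"
  proof (rule Bochner_Integration.integral_cong)
    fix \<nu>
    have "?g \<nu> * (fourier p \<nu> * cis (2 * pi * x * \<nu>)) = (?g \<nu> * cis (2 * pi * x * \<nu>)) * fourier p \<nu>"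
      by (simp only: mult_ac)
    also have "\<dots> = (LINT y|lborel. (?g \<nu> * cis (2 * pi * x * \<nu>)) * (p y * cis (- (2 * pi * y * \<nu>))))"
      unfolding fourier_def by simp
    also have "\<dots> = (LINT y|lborel. ?F (\<nu>, y))"
    proof (rule Bochner_Integration.integral_cong)
      fix y
      have "cis (2 * pi * x * \<nu>) * cis (- (2 * pi * y * \<nu>)) = cis (2 * pi * (x - y) * \<nu>)"
        by (simp add: cis_mult algebra_simps)
      then show "(?g \<nu> * cis (2 * pi * x * \<nu>)) * (p y * cis (- (2 * pi * y * \<nu>))) = ?F (\<nu>, y)"
        by (simp add: mult_ac)
    qed simp
    finally show "?g \<nu> * (fourier p \<nu> * cis (2 * pi * x * \<nu>)) = (LINT y|lborel. ?F (\<nu>, y))" .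
  qed simp
  also have "\<dots> = (LINT y|lborel. LINT \<nu>|lborel. ?F (\<nu>, y))"
    using lborel_pair.Fubini_integral[of "\<lambda>\<nu> y. ?F (\<nu>, y)"] int by simp
  also have "\<dots> = gauss_mean \<epsilon> p x"
  proof (rule Bochner_Integration.integral_cong)
    fix y
    have "(LINT \<nu>|lborel. ?F (\<nu>, y)) = (LINT \<nu>|lborel. p y * (?g \<nu> * cis (2 * pi * (x - y) * \<nu>)))"
      by (intro Bochner_Integration.integral_cong) (auto simp: mult_ac)
    also have "\<dots> = p y * gauss_kernel \<epsilon> (x - y)"
      using fourier_gauss[OF \<epsilon>, of "x - y"] by simp
    finally show "(LINT \<nu>|lborel. ?F (\<nu>, y)) = p y * gauss_kernel \<epsilon> (x - y)" .
  qed simp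
  finally show ?thesis .
qed

text \<open>From \<open>exp u \<ge> u\<close> alone: the gain
  \<open>(\<epsilon> / d)\<^sup>2\<close> outweighs the normalising factor
  \<open>1 / \<epsilon>\<close>, so away from 0 the kernel is uniformly of order
  \<open>\<epsilon>\<close>.\<close>

lemma gauss_kernel_far:
  assumes "0 < \<epsilon>" "\<epsilon> \<le> 1" "d > 0" "d \<le> \<bar>y\<bar>"
  shows "gauss_kernel \<epsilon> y \<le> \<epsilon> / (pi * d\<^sup>2)"
proof -
  have "pi * (d / \<epsilon>)\<^sup>2 \<le> pi * (y / \<epsilon>)\<^sup>2"
    using assms by (intro mult_left_mono power_mono_even) (auto simp: divide_right_mono)
  also have "\<dots> \<le> exp (pi * (y / \<epsilon>)\<^sup>2)"
    using exp_ge_add_one_self[of "pi * (y / \<epsilon>)\<^sup>2"] by linarith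
  finally have "inverse (exp (pi * (y / \<epsilon>)\<^sup>2)) \<le> inverse (pi * (d / \<epsilon>)\<^sup>2)"
    using assms by (intro le_imp_inverse_le) auto
  then have "gauss_kernel \<epsilon> y \<le> inverse (pi * (d / \<epsilon>)\<^sup>2) / \<epsilon>"
    unfolding gauss_kernel_def using assms by (intro divide_right_mono) (auto simp: exp_minus)
  also have "\<dots> = \<epsilon> / (pi * d\<^sup>2)"
    using assms by (simp add: field_simps power2_eq_square)
  finally show ?thesis .
qed

lemma gauss_kernel_approx_identity_bounded:
  fixes p :: "real \<Rightarrow> complex"
  assumes [measurable]: "p \<in> borel_measurable borel" and bounded: "\<And>y. cmod (p y) \<le> M" and cont: "isCont p x"
    and \<epsilon>: "\<And>n::nat. \<epsilon> n > 0" "\<epsilon> \<longlonglongrightarrow> 0"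
  shows "(\<lambda>n. LINT y|lborel. p y * complex_of_real (gauss_kernel (\<epsilon> n) (x - y))) \<longlonglongrightarrow> p x"
proof -
  have eq: "gauss_mean (\<epsilon> n) p x
      = (LINT u|lborel. p (x + \<epsilon> n * u) * complex_of_real (gauss_kernel 1 u))" for n
  proof -
    have "gauss_kernel (\<epsilon> n) (x - (x + \<epsilon> n * u)) = gauss_kernel 1 u / \<epsilon> n" for u
      using \<epsilon>(1)[of n] by (simp add: gauss_kernel_def)
    note scaled = this
    have "gauss_mean (\<epsilon> n) p x
      = \<bar>\<epsilon> n\<bar> *\<^sub>R (LINT u|lborel. p (x + \<epsilon> n * u) * complex_of_real (gauss_kernel (\<epsilon> n) (x - (x + \<epsilon> n * u))))"
      using less_imp_neq[OF \<epsilon>(1)[of n]] by (intro lborel_integral_real_affine) auto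
    also have "\<dots> = (LINT u|lborel. \<bar>\<epsilon> n\<bar> *\<^sub>R (p (x + \<epsilon> n * u) * complex_of_real (gauss_kernel (\<epsilon> n) (x - (x + \<epsilon> n * u)))))"
      by (rule integral_scaleR_right[symmetric])
    also have "\<dots> = (LINT u|lborel. p (x + \<epsilon> n * u) * complex_of_real (gauss_kernel 1 u))"
      unfolding scaled using less_imp_neq[OF \<epsilon>(1)[of n]] \<epsilon>(1)[of n]
      by (intro Bochner_Integration.integral_cong) (auto simp: scaleR_conv_of_real)
    finally show ?thesis .
  qed
  have "(\<lambda>n. LINT u|lborel. p (x + \<epsilon> n * u) * complex_of_real (gauss_kernel 1 u))
      \<longlonglongrightarrow> (LINT u|lborel. p x * complex_of_real (gauss_kernel 1 u))"
  proof (rule integral_dominated_convergence[where w="\<lambda>u. M * gauss_kernel 1 u"])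
    show "AE u in lborel. (\<lambda>n. p (x + \<epsilon> n * u) * complex_of_real (gauss_kernel 1 u))
        \<longlonglongrightarrow> p x * complex_of_real (gauss_kernel 1 u)"
    proof (rule AE_I2)
      fix u
      have "(\<lambda>n. x + \<epsilon> n * u) \<longlonglongrightarrow> x + 0 * u" by (intro tendsto_intros \<epsilon>)
      then have "(\<lambda>n. p (x + \<epsilon> n * u)) \<longlonglongrightarrow> p x"
        using isCont_tendsto_compose[OF cont] by simp
      then show "(\<lambda>n. p (x + \<epsilon> n * u) * complex_of_real (gauss_kernel 1 u))
        \<longlonglongrightarrow> p x * complex_of_real (gauss_kernel 1 u)" by (intro tendsto_intros)
    qed
    show "integrable lborel (\<lambda>u. M * gauss_kernel 1 u)" using integrable_gauss_kernel[of 1] by simp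
    show "AE u in lborel. norm (p (x + \<epsilon> n * u) * complex_of_real (gauss_kernel 1 u)) \<le> M * gauss_kernel 1 u" for n
      using bounded by (auto simp: norm_mult intro!: mult_right_mono)
  qed measurable
  also have "(LINT u|lborel. p x * complex_of_real (gauss_kernel 1 u)) = p x"
    using integral_gauss_kernel[of 1] by simp
  finally show ?thesis unfolding eq .
qed

text \<open>Continuity at \<open>x\<close> bounds \<open>p\<close> only near \<open>x\<close>, so
  \<open>p\<close> is cut at distance \<open>d\<close>. The near part is bounded and falls under the
  previous lemma; the far part is merely integrable, but there the kernel is small
  uniformly.\<close>

lemma gauss_kernel_approx_identity:
  assumes p: "integrable lborel p" and cont: "isCont p x"
    and \<epsilon>: "\<And>n::nat. \<epsilon> n > 0" "\<And>n. \<epsilon> n \<le> 1" "\<epsilon> \<longlonglongrightarrow> 0"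
  shows "(\<lambda>n. LINT y|lborel. p y * complex_of_real (gauss_kernel (\<epsilon> n) (x - y))) \<longlonglongrightarrow> p x"
proof -
  have [measurable]: "p \<in> borel_measurable borel" using p by auto
  obtain d where d: "d > 0" "\<And>y. \<bar>x - y\<bar> < d \<Longrightarrow> cmod (p x - p y) < 1"
    using cont unfolding continuous_at_eps_delta by (auto simp: dist_norm norm_minus_commute)
      (metis zero_less_one abs_minus_commute norm_minus_commute)
  define p1 where "p1 = (\<lambda>y. indicator {y. \<bar>x - y\<bar> < d} y * p y)"
  define p2 where "p2 = (\<lambda>y. indicator {y. d \<le> \<bar>x - y\<bar>} y * p y)"
  have [measurable]: "p1 \<in> borel_measurable borel" "p2 \<in> borel_measurable borel" 
    unfolding p1_def p2_def by measurable
  have sum: "p y = p1 y + p2 y" for y by (auto simp: p1_def p2_def indicator_def)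
  have le: "cmod (p1 y) \<le> cmod (p y)" "cmod (p2 y) \<le> cmod (p y)" for y
    by (auto simp: p1_def p2_def indicator_def)
  have int: "integrable lborel p1" "integrable lborel p2"
    by (rule Bochner_Integration.integrable_bound[OF p]; use le in simp)+
  have bdd: "cmod (p1 y) \<le> cmod (p x) + 1" for y
    using d(2)[of y] norm_triangle_ineq2[of "p y" "p x"]
    by (auto simp: p1_def indicator_def norm_minus_commute)
  have "eventually (\<lambda>y. y \<in> ball x d) (nhds x)"
    using d(1) by (intro eventually_nhds_in_open) auto
  then have "eventually (\<lambda>y. p1 y = p y) (nhds x)"
    by eventually_elim (auto simp: p1_def dist_norm)
  then have "isCont p1 x" using isCont_cong[of p1 p x] cont by simp
  then have lim1: "(\<lambda>n. LINT y|lborel. p1 y * complex_of_real (gauss_kernel (\<epsilon> n) (x - y))) \<longlonglongrightarrow> p1 x"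
    by (intro gauss_kernel_approx_identity_bounded[OF _ bdd] \<epsilon>) auto
  have far: "cmod (p2 y * complex_of_real (gauss_kernel (\<epsilon> n) (x - y))) \<le> \<epsilon> n * (cmod (p y) / (pi * d\<^sup>2))" for n y
  proof (cases "d \<le> \<bar>x - y\<bar>")
    case True
    then have "cmod (p y) * gauss_kernel (\<epsilon> n) (x - y) \<le> cmod (p y) * (\<epsilon> n / (pi * d\<^sup>2))"
      using d \<epsilon> by (intro mult_left_mono gauss_kernel_far) auto
    then show ?thesis using True \<epsilon>(1)[of n] by (simp add: p2_def norm_mult mult_ac)
  qed (use \<epsilon>(1)[of n] in \<open>auto simp: p2_def\<close>)
  have "integrable lborel (\<lambda>y. q y * complex_of_real (gauss_kernel (\<epsilon> n) (x - y)))" 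
    if q: "integrable lborel q" for q n
  proof (rule Bochner_Integration.integrable_bound[of lborel "\<lambda>y. q y / \<epsilon> n"])
    have pos: "\<epsilon> n > 0" by (rule \<epsilon>)
    have "norm (q y * complex_of_real (gauss_kernel (\<epsilon> n) (x - y))) \<le> norm (q y / \<epsilon> n)" for y
    proof -
      have "cmod (q y) * gauss_kernel (\<epsilon> n) (x - y) \<le> cmod (q y) * (1 / \<epsilon> n)"
        using pos by (intro mult_left_mono) (auto simp: gauss_kernel_def intro!: divide_right_mono)
      then show ?thesis using pos by (simp add: norm_mult norm_divide)
    qed
    then show "AE y in lborel. norm (q y * complex_of_real (gauss_kernel (\<epsilon> n) (x - y))) \<le> norm (q y / \<epsilon> n)"
      by (rule AE_I2)
    show "integrable lborel (\<lambda>y. q y / \<epsilon> n)" using q by simp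
    have [measurable]: "q \<in> borel_measurable lborel" using q by simp
    show "(\<lambda>y. q y * complex_of_real (gauss_kernel (\<epsilon> n) (x - y))) \<in> borel_measurable lborel"
      by measurable
  qed
  note int' = this[OF int(1)] this[OF int(2)]
  have lim2: "(\<lambda>n. LINT y|lborel. p2 y * complex_of_real (gauss_kernel (\<epsilon> n) (x - y))) \<longlonglongrightarrow> 0"
  proof (rule Lim_null_comparison)
    show "eventually (\<lambda>n. norm (gauss_mean (\<epsilon> n) p2 x)
      \<le> \<epsilon> n * (LINT y|lborel. cmod (p y) / (pi * d\<^sup>2))) sequentially"
    proof (intro always_eventually allI)
      fix n
      have "norm (gauss_mean (\<epsilon> n) p2 x)
        \<le> (LINT y|lborel. \<epsilon> n * (cmod (p y) / (pi * d\<^sup>2)))"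
        using int'(2) p far by (intro order_trans[OF integral_norm_bound] integral_mono) auto
      then show "norm (gauss_mean (\<epsilon> n) p2 x)
        \<le> \<epsilon> n * (LINT y|lborel. cmod (p y) / (pi * d\<^sup>2))" by simp
    qed
    show "(\<lambda>n. \<epsilon> n * (LINT y|lborel. cmod (p y) / (pi * d\<^sup>2))) \<longlonglongrightarrow> 0"
      using tendsto_mult_left_zero[OF \<epsilon>(3)] .
  qed
  have px: "p1 x = p x" using d(1) by (simp add: p1_def)
  have "gauss_mean (\<epsilon> n) p1 x
      + (gauss_mean (\<epsilon> n) p2 x)
      = gauss_mean (\<epsilon> n) p x" for n
    unfolding sum distrib_right
    by (rule Bochner_Integration.integral_add[OF int'(1)[of n] int'(2)[of n], symmetric])
  then show ?thesis using tendsto_add[OF lim1 lim2] unfolding px by (simp only: add_0_right)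
qed

lemma borel_measurable_cnj [measurable (raw)]:
  "f \<in> borel_measurable M \<Longrightarrow> (\<lambda>x. cnj (f x)) \<in> borel_measurable M"
  by (rule measurable_compose[of f M borel cnj])
     (auto intro!: borel_measurable_continuous_onI continuous_intros)

lemma fourier_diff:
  assumes "integrable lborel f" "integrable lborel g"
  shows "fourier (\<lambda>x. f x - g x) \<nu> = fourier f \<nu> - fourier g \<nu>"
  unfolding fourier_def
  using assms by (simp add: left_diff_distrib integrable_mult_cis)

text \<open>\<open>gauss_summation\<close> is multiplied by \<open>cnj (g x)\<close> and integrated
  over \<open>x\<close>; Fubini then produces \<open>fourier g\<close> a second time,
  conjugated.\<close>

lemma gauss_plancherel:
  assumes g: "integrable lborel g" and \<epsilon>: "\<epsilon> > 0"
  shows "complex_of_real (LINT \<nu>|lborel. gauss_weight \<epsilon> \<nu> * (cmod (fourier g \<nu>))\<^sup>2)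
       = (LINT x|lborel. cnj (g x) * (gauss_mean \<epsilon> g x))"
proof -
  let ?\<gamma> = "\<lambda>\<nu>. complex_of_real (gauss_weight \<epsilon> \<nu>)"
  have [measurable]: "g \<in> borel_measurable lborel" using g by simp
  have \<gamma>: "integrable lborel (\<lambda>\<nu>. ?\<gamma> \<nu> * fourier g \<nu>)"
  proof (rule Bochner_Integration.integrable_bound)
    show "integrable lborel (\<lambda>\<nu>. gauss_weight \<epsilon> \<nu> * (LINT x|lborel. cmod (g x)))"
      using integrable_gauss[OF \<epsilon>] by simp
    show "AE \<nu> in lborel. norm (?\<gamma> \<nu> * fourier g \<nu>) \<le> norm (gauss_weight \<epsilon> \<nu> * (LINT x|lborel. cmod (g x)))"
      using norm_fourier_le[of g] by (auto simp: norm_mult intro!: mult_left_mono)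
  qed measurable
  let ?F = "\<lambda>x \<nu>. cnj (g x) * (?\<gamma> \<nu> * fourier g \<nu>) * cis (2 * pi * x * \<nu>)"
  have "integrable (lborel \<Otimes>\<^sub>M lborel) (\<lambda>(x, \<nu>). cnj (g x) * (?\<gamma> \<nu> * fourier g \<nu>) * (\<lambda>(x, \<nu>). cis (2 * pi * x * \<nu>)) (x, \<nu>))"
    by (rule integrable_pair_mult[where C=1]) (use g \<gamma> in \<open>auto simp del: of_real_exp\<close>)
  then have int: "integrable (lborel \<Otimes>\<^sub>M lborel) (\<lambda>(x, \<nu>). ?F x \<nu>)" by simp
  have "(LINT x|lborel. cnj (g x) * (gauss_mean \<epsilon> g x))
      = (LINT x|lborel. LINT \<nu>|lborel. ?F x \<nu>)"
  proof (rule Bochner_Integration.integral_cong)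
    fix x
    have "cnj (g x) * (gauss_mean \<epsilon> g x)
        = (LINT \<nu>|lborel. cnj (g x) * (?\<gamma> \<nu> * (fourier g \<nu> * cis (2 * pi * x * \<nu>))))"
      unfolding gauss_summation[OF g \<epsilon>, symmetric] by (rule integral_mult_right_zero[symmetric])
    then show "cnj (g x) * (gauss_mean \<epsilon> g x) = (LINT \<nu>|lborel. ?F x \<nu>)"
      by (simp add: mult.assoc)
  qed simp
  also have "\<dots> = (LINT \<nu>|lborel. LINT x|lborel. ?F x \<nu>)"
    using lborel_pair.Fubini_integral[OF int] by simp
  also have "\<dots> = (LINT \<nu>|lborel. complex_of_real (gauss_weight \<epsilon> \<nu> * (cmod (fourier g \<nu>))\<^sup>2))"
  proof (rule Bochner_Integration.integral_cong)
    fix \<nu>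
    have "(LINT x|lborel. ?F x \<nu>) = (LINT x|lborel. (?\<gamma> \<nu> * fourier g \<nu>) * cnj (g x * cis (- (2 * pi * x * \<nu>))))"
      by (intro Bochner_Integration.integral_cong) (auto simp: cis_cnj mult_ac)
    also have "\<dots> = (?\<gamma> \<nu> * fourier g \<nu>) * (LINT x|lborel. cnj (g x * cis (- (2 * pi * x * \<nu>))))"
      by (rule integral_mult_right_zero)
    also have "\<dots> = (?\<gamma> \<nu> * fourier g \<nu>) * cnj (fourier g \<nu>)"
      unfolding fourier_def
      by (simp only: Bochner_Integration.integral_cnj)
    also have "\<dots> = ?\<gamma> \<nu> * complex_of_real ((cmod (fourier g \<nu>))\<^sup>2)"
      using complex_norm_square[of "fourier g \<nu>"] by (simp add: mult.assoc)
    finally show "(LINT x|lborel. ?F x \<nu>) = complex_of_real (gauss_weight \<epsilon> \<nu> * (cmod (fourier g \<nu>))\<^sup>2)"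
      by simp
  qed simp
  finally show ?thesis by (simp only: integral_complex_of_real)
qed

lemma integrable_gauss_fourier_sq:
  assumes g: "integrable lborel g" and \<epsilon>: "\<epsilon> > 0"
  shows "integrable lborel (\<lambda>\<nu>. gauss_weight \<epsilon> \<nu> * (cmod (fourier g \<nu>))\<^sup>2)"
proof (rule Bochner_Integration.integrable_bound)
  have [measurable]: "g \<in> borel_measurable lborel" using g by simp
  show "integrable lborel (\<lambda>\<nu>. gauss_weight \<epsilon> \<nu> * (LINT x|lborel. cmod (g x))\<^sup>2)"
    using integrable_gauss[OF \<epsilon>] by simp
  show "(\<lambda>\<nu>. gauss_weight \<epsilon> \<nu> * (cmod (fourier g \<nu>))\<^sup>2) \<in> borel_measurable lborel" by measurable
  show "AE \<nu> in lborel. norm (gauss_weight \<epsilon> \<nu> * (cmod (fourier g \<nu>))\<^sup>2)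
      \<le> norm (gauss_weight \<epsilon> \<nu> * (LINT x|lborel. cmod (g x))\<^sup>2)"
    by (auto simp: abs_mult intro!: mult_left_mono power_mono norm_fourier_le)
qed

lemma norm_integral_le_nn_integral:
  fixes f :: "'a \<Rightarrow> 'b::{banach, second_countable_topology}"
  shows "ennreal (norm (LINT x|M. f x)) \<le> (\<integral>\<^sup>+x. ennreal (norm (f x)) \<partial>M)"
  by (cases "integrable M f") (auto simp: integral_norm_bound_ennreal not_integrable_integral_eq)

text \<open>Schur's test: the product \<open>cmod (g x) * cmod (g y)\<close> is split by the
  arithmetic-geometric mean inequality, and the kernel has mass 1 in either variable. The right side
  may be infinite.\<close>

lemma gauss_bessel:
  assumes g: "integrable lborel g" and \<epsilon>: "\<epsilon> > 0"
  shows "(\<integral>\<^sup>+\<nu>. ennreal (gauss_weight \<epsilon> \<nu> * (cmod (fourier g \<nu>))\<^sup>2) \<partial>lborel)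
     \<le> energy lborel g"
proof -
  have [measurable]: "g \<in> borel_measurable borel" using g by auto
  let ?S = "\<integral>\<^sup>+x. ennreal ((cmod (g x))\<^sup>2) \<partial>lborel"
  let ?I = "LINT \<nu>|lborel. gauss_weight \<epsilon> \<nu> * (cmod (fourier g \<nu>))\<^sup>2"
  have "?I \<ge> 0" by simp
  have "(\<integral>\<^sup>+\<nu>. ennreal (gauss_weight \<epsilon> \<nu> * (cmod (fourier g \<nu>))\<^sup>2) \<partial>lborel) = ennreal ?I"
    by (rule nn_integral_eq_integral[OF integrable_gauss_fourier_sq[OF g \<epsilon>]]) auto
  also have "\<dots> = ennreal (cmod (complex_of_real ?I))" using \<open>?I \<ge> 0\<close> by simp
  also have "\<dots> \<le> (\<integral>\<^sup>+x. ennreal (cmod (cnj (g x) * (gauss_mean \<epsilon> g x))) \<partial>lborel)"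
    unfolding gauss_plancherel[OF g \<epsilon>] by (rule norm_integral_le_nn_integral)
  also have "\<dots> \<le> (\<integral>\<^sup>+x. \<integral>\<^sup>+y. (ennreal ((cmod (g x))\<^sup>2 / 2) + ennreal ((cmod (g y))\<^sup>2 / 2)) * ennreal (gauss_kernel \<epsilon> (x - y)) \<partial>lborel \<partial>lborel)"
  proof (rule nn_integral_mono)
    fix x
    have "ennreal (cmod (cnj (g x) * (gauss_mean \<epsilon> g x)))
      = ennreal (cmod (LINT y|lborel. cnj (g x) * (g y * complex_of_real (gauss_kernel \<epsilon> (x - y)))))"
      by simp
    also have "\<dots> \<le> (\<integral>\<^sup>+y. ennreal (cmod (cnj (g x) * (g y * complex_of_real (gauss_kernel \<epsilon> (x - y))))) \<partial>lborel)"
      by (rule norm_integral_le_nn_integral)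
    also have "\<dots> \<le> (\<integral>\<^sup>+y. (ennreal ((cmod (g x))\<^sup>2 / 2) + ennreal ((cmod (g y))\<^sup>2 / 2)) * ennreal (gauss_kernel \<epsilon> (x - y)) \<partial>lborel)"
    proof (rule nn_integral_mono)
      fix y
      have "cmod (g x) * cmod (g y) \<le> (cmod (g x))\<^sup>2 / 2 + (cmod (g y))\<^sup>2 / 2"
        using sum_squares_bound[of "cmod (g x)" "cmod (g y)"] by simp
      then have "(cmod (g x) * cmod (g y)) * gauss_kernel \<epsilon> (x - y) 
        \<le> ((cmod (g x))\<^sup>2 / 2 + (cmod (g y))\<^sup>2 / 2) * gauss_kernel \<epsilon> (x - y)"
        using \<epsilon> by (intro mult_right_mono) auto
      then show "ennreal (cmod (cnj (g x) * (g y * complex_of_real (gauss_kernel \<epsilon> (x - y)))))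
        \<le> (ennreal ((cmod (g x))\<^sup>2 / 2) + ennreal ((cmod (g y))\<^sup>2 / 2)) * ennreal (gauss_kernel \<epsilon> (x - y))"
        using \<epsilon> by (simp add: norm_mult ennreal_mult[symmetric] ennreal_plus[symmetric] mult.assoc del: ennreal_plus)
    qed
    finally show "ennreal (cmod (cnj (g x) * (gauss_mean \<epsilon> g x)))
      \<le> (\<integral>\<^sup>+y. (ennreal ((cmod (g x))\<^sup>2 / 2) + ennreal ((cmod (g y))\<^sup>2 / 2)) * ennreal (gauss_kernel \<epsilon> (x - y)) \<partial>lborel)" .
  qed
  also have "\<dots> = (\<integral>\<^sup>+x. \<integral>\<^sup>+y. ennreal ((cmod (g x))\<^sup>2 / 2) * ennreal (gauss_kernel \<epsilon> (x - y)) \<partial>lborel \<partial>lborel)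
     + (\<integral>\<^sup>+x. \<integral>\<^sup>+y. ennreal ((cmod (g y))\<^sup>2 / 2) * ennreal (gauss_kernel \<epsilon> (x - y)) \<partial>lborel \<partial>lborel)"
    by (simp add: distrib_right nn_integral_add)
  also have "(\<integral>\<^sup>+x. \<integral>\<^sup>+y. ennreal ((cmod (g y))\<^sup>2 / 2) * ennreal (gauss_kernel \<epsilon> (x - y)) \<partial>lborel \<partial>lborel)
    = (\<integral>\<^sup>+y. \<integral>\<^sup>+x. ennreal ((cmod (g y))\<^sup>2 / 2) * ennreal (gauss_kernel \<epsilon> (x - y)) \<partial>lborel \<partial>lborel)"
    by (rule lborel_pair.Fubini'[symmetric]) measurable
  also have "\<dots> = (\<integral>\<^sup>+y. ennreal ((cmod (g y))\<^sup>2 / 2) \<partial>lborel)"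
    by (simp add: nn_integral_cmult nn_integral_gauss_kernel_shift[OF \<epsilon>])
  also have "(\<integral>\<^sup>+x. \<integral>\<^sup>+y. ennreal ((cmod (g x))\<^sup>2 / 2) * ennreal (gauss_kernel \<epsilon> (x - y)) \<partial>lborel \<partial>lborel)
    = (\<integral>\<^sup>+y. ennreal ((cmod (g y))\<^sup>2 / 2) \<partial>lborel)"
    by (subst gauss_kernel_minus) (simp add: nn_integral_cmult nn_integral_gauss_kernel_shift[OF \<epsilon>])
  also have "(\<integral>\<^sup>+y. ennreal ((cmod (g y))\<^sup>2 / 2) \<partial>lborel) + (\<integral>\<^sup>+y. ennreal ((cmod (g y))\<^sup>2 / 2) \<partial>lborel) = ?S"
    by (subst nn_integral_add[symmetric]) (auto simp: ennreal_plus[symmetric] simp del: ennreal_plus)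
  finally show ?thesis .
qed

definition gauss_scale :: "nat \<Rightarrow> real" where "gauss_scale n = 1 / real (Suc n)"

lemma gauss_scale: "gauss_scale n > 0" "gauss_scale n \<le> 1" "gauss_scale \<longlonglongrightarrow> 0"
  using LIMSEQ_inverse_real_of_nat by (auto simp: gauss_scale_def[abs_def] inverse_eq_divide)

lemma gauss_scale_tendsto_1: "(\<lambda>n. gauss_weight (gauss_scale n) \<nu>) \<longlonglongrightarrow> 1"
proof -
  have "(\<lambda>n. gauss_weight (gauss_scale n) \<nu>) \<longlonglongrightarrow> exp (- (pi * (0 * \<nu>)\<^sup>2))"
    by (intro tendsto_intros gauss_scale)
  then show ?thesis by simp
qed

text \<open>Fatou's lemma removes the Gaussian weight, which tends to 1 pointwise. This is one half
  of Plancherel's identity.\<close>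

lemma bessel:
  assumes g: "integrable lborel g"
  shows "energy lborel (fourier g) \<le> energy lborel g"
proof -
  have [measurable]: "g \<in> borel_measurable borel" "fourier g \<in> borel_measurable borel" using g by auto
  have "ennreal ((cmod (fourier g \<nu>))\<^sup>2) = liminf (\<lambda>n. ennreal (gauss_weight (gauss_scale n) \<nu> * (cmod (fourier g \<nu>))\<^sup>2))" for \<nu>
  proof (rule lim_imp_Liminf[symmetric])
    have "(\<lambda>n. gauss_weight (gauss_scale n) \<nu> * (cmod (fourier g \<nu>))\<^sup>2) \<longlonglongrightarrow> 1 * (cmod (fourier g \<nu>))\<^sup>2"
      by (intro tendsto_intros gauss_scale_tendsto_1)
    then show "(\<lambda>n. ennreal (gauss_weight (gauss_scale n) \<nu> * (cmod (fourier g \<nu>))\<^sup>2)) \<longlonglongrightarrow> ennreal ((cmod (fourier g \<nu>))\<^sup>2)"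
      by (intro tendsto_ennrealI) simp
  qed simp
  then have "energy lborel (fourier g) \<le>
      liminf (\<lambda>n. \<integral>\<^sup>+\<nu>. ennreal (gauss_weight (gauss_scale n) \<nu> * (cmod (fourier g \<nu>))\<^sup>2) \<partial>lborel)"
    by (simp only:) (rule nn_integral_liminf, measurable)
  also have "\<dots> \<le> energy lborel g"
    by (rule order_trans[OF Liminf_le_Limsup Limsup_bounded])
       (auto intro!: always_eventually gauss_bessel[OF g] gauss_scale simp del: ennreal_mult)
  finally show ?thesis .
qed

lemma fourier_square_integrable:
  assumes g: "integrable lborel g" "square_integrable lborel g"
  shows "square_integrable lborel (fourier g)" "L2_norm lborel (fourier g) \<le> L2_norm lborel g"
proof -
  have [measurable]: "g \<in> borel_measurable borel" "fourier g \<in> borel_measurable borel" using g by auto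
  show *: "square_integrable lborel (fourier g)"
    using bessel[OF g(1)] g(2) by (simp add: square_integrable_iff_nn_integral)
  show "L2_norm lborel (fourier g) \<le> L2_norm lborel g"
    by (rule L2_norm_le_if_nn_integral_le[OF * g(2) bessel[OF g(1)]])
qed

text \<open>The half missing from \<open>bessel\<close>. Continuity gives pointwise convergence of
  the Gaussian means to \<open>g\<close>, and boundedness provides the dominating function
  \<open>cmod (g x) * M\<close>; the Gaussian-weighted norm of \<open>fourier g\<close> never
  exceeds the full one.\<close>

lemma plancherel_continuous:
  assumes g: "integrable lborel g" "square_integrable lborel g" 
    and cont: "continuous_on UNIV g" and bounded: "\<And>x. cmod (g x) \<le> M"
  shows "L2_norm lborel (fourier g) = L2_norm lborel g"
proof (rule antisym[OF fourier_square_integrable(2)[OF g]])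
  have [measurable]: "g \<in> borel_measurable borel" "fourier g \<in> borel_measurable borel" using g by auto
  let ?I = "\<lambda>n. LINT \<nu>|lborel. gauss_weight (gauss_scale n) \<nu> * (cmod (fourier g \<nu>))\<^sup>2"
  let ?K = "\<lambda>n x. LINT y|lborel. g y * complex_of_real (gauss_kernel (gauss_scale n) (x - y))"
  have K: "cmod (?K n x) \<le> M" for n x
  proof -
    have pos: "gauss_scale n > 0" by (rule gauss_scale)
    have "ennreal (cmod (?K n x)) \<le> (\<integral>\<^sup>+y. ennreal (cmod (g y * complex_of_real (gauss_kernel (gauss_scale n) (x - y)))) \<partial>lborel)"
      by (rule norm_integral_le_nn_integral)
    also have "\<dots> \<le> (\<integral>\<^sup>+y. ennreal M * ennreal (gauss_kernel (gauss_scale n) (y - x)) \<partial>lborel)"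
      using pos order_trans[OF norm_ge_zero bounded] bounded
      by (intro nn_integral_mono) (auto simp: norm_mult ennreal_mult[symmetric] gauss_kernel_minus[of _ x] intro!: mult_right_mono)
    also have "\<dots> = ennreal M" using pos by (simp add: nn_integral_cmult nn_integral_gauss_kernel_shift)
    finally show ?thesis using order_trans[OF norm_ge_zero bounded] by simp
  qed
  have "(\<lambda>n. LINT x|lborel. cnj (g x) * ?K n x) \<longlonglongrightarrow> (LINT x|lborel. cnj (g x) * g x)"
  proof (rule integral_dominated_convergence[where w="\<lambda>x. cmod (g x) * M"])
    show "AE x in lborel. (\<lambda>n. cnj (g x) * ?K n x) \<longlonglongrightarrow> cnj (g x) * g x"
      using cont by (intro AE_I2 tendsto_intros gauss_kernel_approx_identity g gauss_scale) 
        (auto simp: continuous_on_eq_continuous_at)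
    show "AE x in lborel. norm (cnj (g x) * ?K n x) \<le> cmod (g x) * M" for n
      using K by (auto simp: norm_mult intro!: mult_left_mono)
    show "integrable lborel (\<lambda>x. cmod (g x) * M)" using g by simp
    show "(\<lambda>x. cnj (g x) * ?K n x) \<in> borel_measurable lborel" for n by measurable
    show "(\<lambda>x. cnj (g x) * g x) \<in> borel_measurable lborel" by measurable
  qed
  then have "(\<lambda>n. complex_of_real (?I n)) \<longlonglongrightarrow> (LINT x|lborel. cnj (g x) * g x)"
    using gauss_plancherel[OF g(1) gauss_scale(1)] by simp
  also have "(LINT x|lborel. cnj (g x) * g x) = (LINT x|lborel. complex_of_real ((cmod (g x))\<^sup>2))"
    by (intro Bochner_Integration.integral_cong refl) (simp only: complex_norm_square mult.commute)
  also have "\<dots> = complex_of_real ((L2_norm lborel g)\<^sup>2)"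
    by (simp only: integral_complex_of_real L2_norm_sq)
  finally have "?I \<longlonglongrightarrow> (L2_norm lborel g)\<^sup>2" by (rule tendsto_of_real_iff[THEN iffD1])
  moreover have "?I n \<le> (L2_norm lborel (fourier g))\<^sup>2" for n
    unfolding L2_norm_sq
  proof (rule integral_mono[OF integrable_gauss_fourier_sq[OF g(1) gauss_scale(1)]])
    show "integrable lborel (\<lambda>\<nu>. (cmod (fourier g \<nu>))\<^sup>2)"
      using fourier_square_integrable(1)[OF g] by (simp add: square_integrable_def)
  qed (auto intro!: mult_left_le_one_le)
  ultimately have "(L2_norm lborel g)\<^sup>2 \<le> (L2_norm lborel (fourier g))\<^sup>2"
    by (blast intro: LIMSEQ_le_const2)
  then show "L2_norm lborel g \<le> L2_norm lborel (fourier g)"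
    by (rule power2_le_imp_le) simp
qed

text \<open>By Bessel's inequality both norms are Lipschitz in the L2 distance of integrable
  functions, so their equality passes to L2 limits.\<close>

lemma plancherel_limit:
  assumes g: "integrable lborel g" "square_integrable lborel g"
    and s: "\<And>n. integrable lborel (s n)" "\<And>n. square_integrable lborel (s n)"
    and eq: "\<And>n::nat. L2_norm lborel (fourier (s n)) = L2_norm lborel (s n)"
    and lim: "(\<lambda>n. L2_norm lborel (\<lambda>x. s n x - g x)) \<longlonglongrightarrow> 0"
  shows "L2_norm lborel (fourier g) = L2_norm lborel g"
proof -
  have "\<bar>L2_norm lborel (fourier g) - L2_norm lborel g\<bar> \<le> 2 * L2_norm lborel (\<lambda>x. s n x - g x)" for n
  proof -
    have "\<bar>L2_norm lborel (fourier (s n)) - L2_norm lborel (fourier g)\<bar> \<le> L2_norm lborel (\<lambda>\<nu>. fourier (s n) \<nu> - fourier g \<nu>)"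
      by (intro L2_norm_diff_bound fourier_square_integrable g s)
    also have "\<dots> = L2_norm lborel (fourier (\<lambda>x. s n x - g x))"
      by (subst fourier_diff[OF s(1) g(1), symmetric]) (rule refl)
    also have "\<dots> \<le> L2_norm lborel (\<lambda>x. s n x - g x)"
      by (intro fourier_square_integrable square_integrable_diff Bochner_Integration.integrable_diff g s)
    finally have "\<bar>L2_norm lborel (s n) - L2_norm lborel (fourier g)\<bar> \<le> L2_norm lborel (\<lambda>x. s n x - g x)"
      unfolding eq .
    moreover have "\<bar>L2_norm lborel (s n) - L2_norm lborel g\<bar> \<le> L2_norm lborel (\<lambda>x. s n x - g x)"
      by (intro L2_norm_diff_bound g s)
    ultimately show ?thesis by linarith
  qed
  note bound = this
  have "(\<lambda>n. 2 * L2_norm lborel (\<lambda>x. s n x - g x)) \<longlonglongrightarrow> 0"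
    using tendsto_mult_right_zero[OF lim] .
  then have "\<bar>L2_norm lborel (fourier g) - L2_norm lborel g\<bar> \<le> 0"
    by (rule LIMSEQ_le_const) (use bound in auto)
  then show ?thesis by simp
qed


lemma plancherel_bounded:
  fixes g :: "real \<Rightarrow> complex"
  assumes [measurable]: "g \<in> borel_measurable borel" and bounded: "\<And>x. cmod (g x) \<le> M"
    and supp: "\<And>x. N < \<bar>x\<bar> \<Longrightarrow> g x = 0"
  shows "L2_norm lborel (fourier g) = L2_norm lborel g"
proof -
  have M: "0 \<le> M" using order_trans[OF norm_ge_zero bounded] .
  \<comment> \<open>Measurability in this sense supplies continuous functions that converge to
    \<open>g\<close> off a negligible set, but without control of size or support.\<close>
  have "g measurable_on UNIV"
    by (simp add: measurable_on_iff_borel_measurable lebesgue_on_UNIV_eq measurable_completion)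
  then obtain Z s where Z: "negligible Z" and s: "\<And>n. continuous_on UNIV (s n)"
    and lim: "\<And>x. x \<notin> Z \<Longrightarrow> (\<lambda>n::nat. s n x) \<longlonglongrightarrow> g x"
    unfolding measurable_on_def by auto
  \<comment> \<open>\<open>r\<close> retracts the plane onto a disc and \<open>cut\<close> is a
    continuous cutoff; together they make the approximants uniformly bounded with a common compact
    support, so L2 convergence follows by domination. The radius \<open>M + 1\<close> keeps the
    denominator positive when \<open>M = 0\<close>.\<close>
  define r where "r z = z * complex_of_real ((M + 1) / max (M + 1) (cmod z))" for z
  define cut where "cut x = max 0 (min 1 (N + 1 - \<bar>x\<bar>))" for x
  define t where "t n x = complex_of_real (cut x) * r (s n x)" for n x
  have r_bound: "cmod (r z) \<le> M + 1" for z
  proof (cases "cmod z \<le> M + 1")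
    case False
    then have "max (M + 1) (cmod z) = cmod z" by simp
    then show ?thesis using M by (simp add: r_def norm_mult norm_divide)
  qed (use M in \<open>auto simp: r_def max_def norm_mult norm_divide\<close>)
  have r_id: "r z = z" if "cmod z \<le> M" for z
    using that M by (simp add: r_def max_def)
  have r_cont: "continuous_on UNIV r"
    unfolding r_def using M by (intro continuous_intros) auto
  have cut: "0 \<le> cut x" "cut x \<le> 1" "\<bar>x\<bar> \<le> N \<Longrightarrow> cut x = 1" "N + 1 < \<bar>x\<bar> \<Longrightarrow> cut x = 0" for x
    by (auto simp: cut_def)
  have t_cont: "continuous_on UNIV (t n)" for n
    unfolding t_def cut_def by (intro continuous_intros continuous_on_compose2[OF r_cont] s) auto
  then have [measurable]: "t n \<in> borel_measurable borel" for n
    by (rule borel_measurable_continuous_onI)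
  have t_bound: "cmod (t n x) \<le> M + 1" "N + 1 < \<bar>x\<bar> \<Longrightarrow> t n x = 0" for n x
  proof -
    show "cmod (t n x) \<le> M + 1"
      using mult_mono[OF cut(2)[of x] r_bound[of "s n x"]] cut(1)[of x]
      by (simp add: t_def norm_mult)
    show "t n x = 0" if "N + 1 < \<bar>x\<bar>" using that cut(4) by (simp add: t_def)
  qed
  have int: "integrable lborel h" "square_integrable lborel h" 
    if [measurable]: "h \<in> borel_measurable borel" and h: "\<And>x. cmod (h x) \<le> M + 1" "\<And>x. N + 1 < \<bar>x\<bar> \<Longrightarrow> h x = 0" for h
  proof -
    have ind: "integrable lborel (\<lambda>x. c * indicator {- (N + 1)..N + 1} x :: real)" for c
      by (intro integrable_mult_right integrable_real_indicator) 
         (auto simp: emeasure_lborel_Icc_eq)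
    show "integrable lborel h"
      by (rule Bochner_Integration.integrable_bound[OF ind[of "M + 1"]])
         (use h M in \<open>auto simp: indicator_def\<close>)
    show "square_integrable lborel h"
      by (rule square_integrable_bound[OF ind[of "(M + 1)\<^sup>2"]])
         (use h M in \<open>auto simp: indicator_def intro!: power_mono\<close>)
  qed
  have g_int: "integrable lborel g" "square_integrable lborel g"
    by (rule int; use supp bounded order_trans[OF bounded, of "M + 1"] in force)+
  have conv: "(\<lambda>n. t n x) \<longlonglongrightarrow> g x" if "x \<notin> Z" for x
  proof -
    have "isCont r (g x)" using r_cont by (auto simp: continuous_on_eq_continuous_at)
    then have "(\<lambda>n. r (s n x)) \<longlonglongrightarrow> r (g x)"
      using isCont_tendsto_compose lim[OF that] by blast
    then have "(\<lambda>n. t n x) \<longlonglongrightarrow> complex_of_real (cut x) * r (g x)"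
      unfolding t_def by (intro tendsto_intros)
    moreover have "complex_of_real (cut x) * r (g x) = g x"
      using r_id[OF bounded, of x] cut(3)[of x] supp[of x] by (cases "\<bar>x\<bar> \<le> N") auto
    ultimately show ?thesis by simp
  qed
  have "AE x in lebesgue. x \<notin> Z"
    using Z by (simp add: AE_not_in negligible_iff_null_sets)
  then have AE_Z: "AE x in lborel. x \<notin> Z" by (simp add: AE_completion_iff)
  show ?thesis
  proof (rule plancherel_limit[OF g_int])
    show "L2_norm lborel (fourier (t n)) = L2_norm lborel (t n)" for n
      by (rule plancherel_continuous[OF int[OF _ t_bound] t_cont t_bound(1)]) auto
    show "integrable lborel (t n)" "square_integrable lborel (t n)" for n
      by (rule int[OF _ t_bound]; simp)+
    have "integrable lborel (\<lambda>x. (2 * (M + 1))\<^sup>2 * indicator {- (N + 1)..N + 1} x :: real)"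
      by (intro integrable_mult_right integrable_real_indicator) (auto simp: emeasure_lborel_Icc_eq)
    then show "(\<lambda>n. L2_norm lborel (\<lambda>x. t n x - g x)) \<longlonglongrightarrow> 0"
    proof (rule L2_norm_dominated_limit)
      show "AE x in lborel. (\<lambda>n. t n x) \<longlonglongrightarrow> g x"
        using AE_Z by eventually_elim (rule conv)
      show "AE x in lborel. (cmod (t n x - g x))\<^sup>2 \<le> (2 * (M + 1))\<^sup>2 * indicator {- (N + 1)..N + 1} x" for n
      proof (rule AE_I2)
        fix x
        show "(cmod (t n x - g x))\<^sup>2 \<le> (2 * (M + 1))\<^sup>2 * indicator {- (N + 1)..N + 1} x"
        proof (cases "N + 1 < \<bar>x\<bar>")
          case True
          then show ?thesis using t_bound(2)[of x n] supp[of x] by (auto simp: indicator_def)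
        next
          case False
          have "cmod (t n x - g x) \<le> 2 * (M + 1)"
            using order_trans[OF norm_triangle_ineq4[of "t n x" "g x"] add_mono[OF t_bound(1)[of n x] bounded[of x]]] M
            by simp
          then show ?thesis using False by (auto simp: indicator_def intro!: power_mono)
        qed
      qed
    qed auto
  qed
qed

theorem plancherel:
  assumes g: "integrable lborel g" "square_integrable lborel g"
  shows "L2_norm lborel (fourier g) = L2_norm lborel g"
proof -
  have [measurable]: "g \<in> borel_measurable borel" using g by auto
  define s where "s n x = (if \<bar>x\<bar> \<le> real n \<and> cmod (g x) \<le> real n then g x else 0)" for n x
  have [measurable]: "s n \<in> borel_measurable borel" for n unfolding s_def by measurable
  show ?thesis
  proof (rule plancherel_limit[OF g, of s])
    show "L2_norm lborel (fourier (s n)) = L2_norm lborel (s n)" for n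
      by (rule plancherel_bounded[of _ "real n" "real n"]) (auto simp: s_def)
    show "integrable lborel (s n)" for n
      by (rule Bochner_Integration.integrable_bound[OF g(1)]) (auto simp: s_def)
    show "square_integrable lborel (s n)" for n
      by (rule square_integrable_bound[OF square_integrableD(2)[OF g(2)]]) (auto simp: s_def)
    show "(\<lambda>n. L2_norm lborel (\<lambda>x. s n x - g x)) \<longlonglongrightarrow> 0"
    proof (rule L2_norm_dominated_limit[OF square_integrableD(2)[OF g(2)]])
      show "AE x in lborel. (\<lambda>n. s n x) \<longlonglongrightarrow> g x"
      proof (rule AE_I2)
        fix x
        obtain m where "max \<bar>x\<bar> (cmod (g x)) \<le> real m" using real_arch_simple by blast
        then have "eventually (\<lambda>n. s n x = g x) sequentially"
          by (intro eventually_sequentiallyI[of m]) (auto simp: s_def)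
        then show "(\<lambda>n. s n x) \<longlonglongrightarrow> g x" by (rule tendsto_eventually)
      qed
    qed (auto simp: s_def)
  qed
qed


section \<open>The L2 Fourier transform and its inverse\<close>

lemma fourier_truncated:
  "(LINT x:{- real N..real N}|lborel. f x * exp (- 2 * pi * \<i> * x * \<nu>))
   = fourier (\<lambda>x. indicator {- real N..real N} x *\<^sub>R f x) \<nu>"
proof -
  have "exp (- 2 * pi * \<i> * x * \<nu>) = cis (- (2 * pi * x * \<nu>))" for x :: real
    by (simp add: cis_conv_exp mult_ac)
  then show ?thesis
    unfolding fourier_def set_lebesgue_integral_def by simp
qed

lemma truncation:
  assumes f: "square_integrable lborel f"
  shows "integrable lborel (\<lambda>x. indicator {- real N..real N} x *\<^sub>R f x)"
    and "square_integrable lborel (\<lambda>x. indicator {- real N..real N} x *\<^sub>R f x)"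
    and "(\<lambda>N. L2_norm lborel (\<lambda>x. indicator {- real N..real N} x *\<^sub>R f x - f x)) \<longlonglongrightarrow> 0"
proof -
  have [measurable]: "f \<in> borel_measurable borel" using f by (auto simp: square_integrable_def)
  show *: "square_integrable lborel (\<lambda>x. indicator {- real N..real N} x *\<^sub>R f x)" for N
    by (rule square_integrable_bound[OF square_integrableD(2)[OF f]]) (auto simp: indicator_def)
  show "integrable lborel (\<lambda>x. indicator {- real N..real N} x *\<^sub>R f x)"
    by (rule integrable_if_square_integrable_bounded_support[OF *, of "- real N" "real N"]) auto
  show "(\<lambda>N. L2_norm lborel (\<lambda>x. indicator {- real N..real N} x *\<^sub>R f x - f x)) \<longlonglongrightarrow> 0"
  proof (rule L2_norm_dominated_limit[OF square_integrableD(2)[OF f]])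
    show "AE x in lborel. (\<lambda>N. indicator {- real N..real N} x *\<^sub>R f x) \<longlonglongrightarrow> f x"
    proof (rule AE_I2)
      fix x :: real
      obtain m where "\<bar>x\<bar> \<le> real m" using real_arch_simple by blast
      then have "eventually (\<lambda>N. indicator {- real N..real N} x *\<^sub>R f x = f x) sequentially"
        by (intro eventually_sequentiallyI[of m]) (auto simp: indicator_def)
      then show "(\<lambda>N. indicator {- real N..real N} x *\<^sub>R f x) \<longlonglongrightarrow> f x" by (rule tendsto_eventually)
    qed
  qed (auto simp: indicator_def)
qed

lemma has_L2_fourier_iff:
  "has_L2_fourier f F \<longleftrightarrow> square_integrable lborel f \<and> square_integrable lborel F \<and>
     (\<lambda>N. L2_norm lborel (\<lambda>\<nu>. F \<nu> - fourier (\<lambda>x. indicator {- real N..real N} x *\<^sub>R f x) \<nu>)) \<longlonglongrightarrow> 0"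
  unfolding has_L2_fourier_def fourier_truncated ..

lemma L2_norm_tendsto:
  assumes "\<And>n. square_integrable M (s n)" "square_integrable M f"
    and "(\<lambda>n. L2_norm M (\<lambda>x. s n x - f x)) \<longlonglongrightarrow> 0"
  shows "(\<lambda>n. L2_norm M (s n)) \<longlonglongrightarrow> L2_norm M f"
proof (rule Lim_transform2[OF tendsto_const], rule Lim_null_comparison[OF _ assms(3)])
  show "eventually (\<lambda>n. norm (L2_norm M f - L2_norm M (s n)) \<le> L2_norm M (\<lambda>x. s n x - f x)) sequentially"
    using L2_norm_diff_bound[OF assms(1,2)] by (auto simp: abs_minus_commute)
qed

lemma has_L2_fourier_norm:
  assumes "has_L2_fourier f F"
  shows "L2_norm lborel F = L2_norm lborel f"
proof -
  let ?f = "\<lambda>N x. indicator {- real N..real N} x *\<^sub>R f x"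
  have f: "square_integrable lborel f" and F: "square_integrable lborel F"
    and lim: "(\<lambda>N. L2_norm lborel (\<lambda>\<nu>. fourier (?f N) \<nu> - F \<nu>)) \<longlonglongrightarrow> 0"
    using assms by (auto simp: has_L2_fourier_iff L2_norm_minus_commute[of _ F])
  have "(\<lambda>N. L2_norm lborel (fourier (?f N))) \<longlonglongrightarrow> L2_norm lborel F"
    by (intro L2_norm_tendsto fourier_square_integrable truncation f F lim)
  moreover have "(\<lambda>N. L2_norm lborel (?f N)) \<longlonglongrightarrow> L2_norm lborel f"
    by (intro L2_norm_tendsto truncation f)
  ultimately show ?thesis
    using LIMSEQ_unique plancherel[OF truncation(1,2)[OF f]] by auto
qed

lemma has_L2_fourier_unique:
  assumes "has_L2_fourier f F" "has_L2_fourier f' F'" "AE x in lborel. f x = f' x"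
  shows "AE \<nu> in lborel. F \<nu> = F' \<nu>"
proof -
  let ?f = "\<lambda>f N x. indicator {- real N..real N} x *\<^sub>R f x :: complex"
  have f: "square_integrable lborel f" "square_integrable lborel f'" 
    and F: "square_integrable lborel F" "square_integrable lborel F'"
    and lim: "(\<lambda>N. L2_norm lborel (\<lambda>\<nu>. F \<nu> - fourier (?f f N) \<nu>)) \<longlonglongrightarrow> 0"
    "(\<lambda>N. L2_norm lborel (\<lambda>\<nu>. F' \<nu> - fourier (?f f' N) \<nu>)) \<longlonglongrightarrow> 0"
    using assms by (auto simp: has_L2_fourier_iff)
  have [measurable]: "f \<in> borel_measurable borel" "f' \<in> borel_measurable borel"
    using f by (auto simp: square_integrable_def)
  have eq: "fourier (?f f N) = fourier (?f f' N)" for N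
    unfolding fourier_def
    by (intro ext integral_cong_AE) (use assms(3) in \<open>auto elim!: eventually_mono\<close>)
  have "L2_norm lborel (\<lambda>\<nu>. F \<nu> - F' \<nu>) \<le> L2_norm lborel (\<lambda>\<nu>. F \<nu> - fourier (?f f N) \<nu>)
      + L2_norm lborel (\<lambda>\<nu>. F' \<nu> - fourier (?f f' N) \<nu>)" for N
  proof -
    have "L2_norm lborel (\<lambda>\<nu>. (F \<nu> - fourier (?f f N) \<nu>) + (fourier (?f f N) \<nu> - F' \<nu>))
      \<le> L2_norm lborel (\<lambda>\<nu>. F \<nu> - fourier (?f f N) \<nu>) + L2_norm lborel (\<lambda>\<nu>. fourier (?f f N) \<nu> - F' \<nu>)"
      by (intro L2_norm_triangle square_integrable_diff F fourier_square_integrable truncation f)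
    then show ?thesis
      by (simp add: eq L2_norm_minus_commute[of _ F'])
  qed
  then have "L2_norm lborel (\<lambda>\<nu>. F \<nu> - F' \<nu>) \<le> 0 + 0"
    by (intro LIMSEQ_le_const[OF tendsto_add[OF lim]]) auto
  then have "L2_norm lborel (\<lambda>\<nu>. F \<nu> - F' \<nu>) = 0" by (simp add: antisym)
  from AE_eq_0_if_L2_norm_0[OF square_integrable_diff[OF F] this] show ?thesis by simp
qed

lemma has_L2_fourier_cong_AE:
  assumes F: "has_L2_fourier f F" and g: "g \<in> borel_measurable borel" and eq: "AE x in lborel. f x = g x"
  shows "has_L2_fourier g F"
proof -
  let ?f = "\<lambda>f N x. indicator {- real N..real N} x *\<^sub>R f x :: complex"
  have f: "square_integrable lborel f" using F by (simp add: has_L2_fourier_iff)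
  have [measurable]: "f \<in> borel_measurable borel" "g \<in> borel_measurable borel"
    using f g by (auto simp: square_integrable_def)
  have "fourier (?f f N) = fourier (?f g N)" for N
    unfolding fourier_def
    by (intro ext integral_cong_AE) (use eq in \<open>auto elim!: eventually_mono\<close>)
  with F square_integrable_cong_AE[OF f _ eq] g show ?thesis
    by (simp add: has_L2_fourier_iff)
qed

definition inv_fourier :: "(real \<Rightarrow> complex) \<Rightarrow> real \<Rightarrow> complex" where
  "inv_fourier F x = (LINT \<nu>|lborel. F \<nu> * cis (2 * pi * x * \<nu>))"

lemma inv_fourier_eq_fourier: "inv_fourier F x = fourier F (- x)"
  by (simp add: inv_fourier_def fourier_def mult_ac)

lemma borel_measurable_inv_fourier [measurable]:
  assumes [measurable]: "f \<in> borel_measurable lborel"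
  shows "inv_fourier f \<in> borel_measurable lborel"
  unfolding inv_fourier_def by measurable

lemma inv_fourier_plancherel:
  assumes F: "integrable lborel F" "square_integrable lborel F"
  shows "square_integrable lborel (inv_fourier F)" "L2_norm lborel (inv_fourier F) = L2_norm lborel F"
proof -
  have [measurable]: "F \<in> borel_measurable lborel" using F by simp
  have eq: "energy lborel (fourier F) = energy lborel (inv_fourier F)"
    using nn_integral_real_affine[of "\<lambda>x. ennreal ((cmod (fourier F x))\<^sup>2)" "-1" 0]
    by (simp add: inv_fourier_eq_fourier)
  show *: "square_integrable lborel (inv_fourier F)"
    using fourier_square_integrable(1)[OF F] eq by (simp add: square_integrable_iff_nn_integral)
  have "(L2_norm lborel (fourier F))\<^sup>2 = (L2_norm lborel (inv_fourier F))\<^sup>2"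
    using eq unfolding nn_integral_eq_L2_norm[OF *] nn_integral_eq_L2_norm[OF fourier_square_integrable(1)[OF F]]
    by simp
  then show "L2_norm lborel (inv_fourier F) = L2_norm lborel F"
    using plancherel[OF F] by simp
qed

lemma L2_norm_diff_sq:
  assumes F: "square_integrable M F" and G: "square_integrable M G"
  shows "(L2_norm M (\<lambda>x. F x - G x))\<^sup>2 = (L2_norm M F)\<^sup>2 - 2 * Re (LINT x|M. G x * cnj (F x)) + (L2_norm M G)\<^sup>2"
proof -
  have cnj: "square_integrable M (\<lambda>x. cnj (F x))"
    using F by (auto simp: square_integrable_def)
  define k where "k x = G x * cnj (F x)" for x
  have int: "integrable M k"
    unfolding k_def by (rule integrable_mult_square_integrable[OF G cnj])
  have "(cmod (F x - G x))\<^sup>2 = (cmod (F x))\<^sup>2 - 2 * Re (k x) + (cmod (G x))\<^sup>2" for x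
    unfolding k_def by (simp only: cmod_power2) (simp add: power2_eq_square algebra_simps)
  then have "(L2_norm M (\<lambda>x. F x - G x))\<^sup>2 = (L2_norm M F)\<^sup>2 - 2 * Re (LINT x|M. k x) + (L2_norm M G)\<^sup>2"
    using F G int by (simp add: L2_norm_sq square_integrable_def)
  then show ?thesis by (simp add: k_def)
qed

text \<open>By Fubini, pairing \<open>F\<close> with the transform of the truncation
  \<open>?f N\<close> gives the squared norm of \<open>?f N\<close>. Hence the squared distance is
  \<open>(L2_norm lborel F)\<^sup>2 - (L2_norm lborel (?f N))\<^sup>2\<close>, which tends to 0
  because \<open>inv_fourier F\<close> has the norm of \<open>F\<close>.\<close>

lemma has_L2_fourier_inv_fourier:
  assumes F: "integrable lborel F" "square_integrable lborel F"
  shows "has_L2_fourier (inv_fourier F) F"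
proof -
  define f where "f = inv_fourier F"
  let ?f = "\<lambda>N x. indicator {- real N..real N} x *\<^sub>R f x"
  have f: "square_integrable lborel f" "L2_norm lborel f = L2_norm lborel F"
    unfolding f_def by (rule inv_fourier_plancherel[OF F])+
  have [measurable]: "F \<in> borel_measurable lborel" using F by simp
  have inner: "(LINT \<nu>|lborel. fourier (?f N) \<nu> * cnj (F \<nu>)) = complex_of_real ((L2_norm lborel (?f N))\<^sup>2)" for N
  proof -
    let ?H = "\<lambda>x \<nu>. ?f N x * cnj (F \<nu>) * cis (- (2 * pi * x * \<nu>))"
    have "integrable (lborel \<Otimes>\<^sub>M lborel) (\<lambda>(x, \<nu>). ?f N x * cnj (F \<nu>) * (\<lambda>(x, \<nu>). cis (- (2 * pi * x * \<nu>))) (x, \<nu>))"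
      by (rule integrable_pair_mult[where C=1]) (use F truncation(1)[OF f(1)] in auto)
    then have int: "integrable (lborel \<Otimes>\<^sub>M lborel) (\<lambda>(x, \<nu>). ?H x \<nu>)" by simp
    have "(LINT \<nu>|lborel. fourier (?f N) \<nu> * cnj (F \<nu>)) = (LINT \<nu>|lborel. LINT x|lborel. ?H x \<nu>)"
      unfolding fourier_def
      by (subst integral_mult_left_zero[symmetric]) (simp only: mult_ac)
    also have "\<dots> = (LINT x|lborel. LINT \<nu>|lborel. ?H x \<nu>)"
      using lborel_pair.Fubini_integral[OF int] .
    also have "\<dots> = (LINT x|lborel. complex_of_real ((cmod (?f N x))\<^sup>2))"
    proof (rule Bochner_Integration.integral_cong)
      fix x
      have "(LINT \<nu>|lborel. ?H x \<nu>) = (LINT \<nu>|lborel. ?f N x * cnj (F \<nu> * cis (2 * pi * x * \<nu>)))"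
        by (intro Bochner_Integration.integral_cong) (auto simp: cis_cnj mult_ac)
      also have "\<dots> = ?f N x * (LINT \<nu>|lborel. cnj (F \<nu> * cis (2 * pi * x * \<nu>)))"
        by (rule integral_mult_right_zero)
      also have "\<dots> = ?f N x * cnj (f x)"
        unfolding f_def inv_fourier_def by (simp only: Bochner_Integration.integral_cnj)
      also have "\<dots> = complex_of_real ((cmod (?f N x))\<^sup>2)"
        by (simp add: indicator_def complex_norm_square del: of_real_power)
      finally show "(LINT \<nu>|lborel. ?H x \<nu>) = complex_of_real ((cmod (?f N x))\<^sup>2)" .
    qed simp
    also have "\<dots> = complex_of_real ((L2_norm lborel (?f N))\<^sup>2)"
      by (simp only: integral_complex_of_real L2_norm_sq)
    finally show ?thesis .
  qed
  have eq: "(L2_norm lborel (\<lambda>\<nu>. F \<nu> - fourier (?f N) \<nu>))\<^sup>2 = (L2_norm lborel F)\<^sup>2 - (L2_norm lborel (?f N))\<^sup>2" for N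
    using L2_norm_diff_sq[OF F(2) fourier_square_integrable(1)[OF truncation(1,2)[OF f(1)], of N]]
    by (simp add: inner plancherel[OF truncation(1,2)[OF f(1)]] del: of_real_power)
  have "(\<lambda>N. sqrt ((L2_norm lborel F)\<^sup>2 - (L2_norm lborel (?f N))\<^sup>2)) \<longlonglongrightarrow>
      sqrt ((L2_norm lborel F)\<^sup>2 - (L2_norm lborel f)\<^sup>2)"
    by (intro tendsto_intros L2_norm_tendsto truncation f)
  then have "(\<lambda>N. L2_norm lborel (\<lambda>\<nu>. F \<nu> - fourier (?f N) \<nu>)) \<longlonglongrightarrow> 0"
    by (simp add: eq[symmetric] f(2))
  then show ?thesis
    using f F(2) by (simp add: has_L2_fourier_iff f_def)
qed

subsection \<open>Sampling of band-limited functions\<close>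

text \<open>A band-limited function is carried by its Fourier side \<open>F\<close>, the form in
  which sections of a spreading function arrive; \<open>pw F\<close> below is its entire
  extension.\<close>

definition bandlimited :: "real \<Rightarrow> (real \<Rightarrow> complex) \<Rightarrow> bool" where
  "bandlimited W F \<longleftrightarrow> square_integrable lborel F \<and> (AE \<nu> in lborel. W / 2 < \<bar>\<nu>\<bar> \<longrightarrow> F \<nu> = 0)"

definition pw :: "(real \<Rightarrow> complex) \<Rightarrow> complex \<Rightarrow> complex" where
  "pw F z = (LINT \<nu>|lborel. F \<nu> * exp (2 * pi * \<i> * z * \<nu>))"

abbreviation sample_energy :: "('i \<Rightarrow> real) \<Rightarrow> (real \<Rightarrow> complex) \<Rightarrow> ennreal" where
  "sample_energy \<Lambda> F \<equiv> energy (count_space UNIV) (\<lambda>k. pw F (complex_of_real (\<Lambda> k)))"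

lemma bandlimitedD:
  assumes "bandlimited W F"
  shows "square_integrable lborel F" "F \<in> borel_measurable lborel" "integrable lborel F"
    "AE \<nu> in lborel. W / 2 < \<bar>\<nu>\<bar> \<longrightarrow> F \<nu> = 0"
proof -
  show F: "square_integrable lborel F" "AE \<nu> in lborel. W / 2 < \<bar>\<nu>\<bar> \<longrightarrow> F \<nu> = 0"
    using assms by (auto simp: bandlimited_def)
  then show "F \<in> borel_measurable lborel" by (simp add: square_integrable_def)
  have "AE \<nu> in lborel. \<nu> \<notin> {- (W / 2)..W / 2} \<longrightarrow> F \<nu> = 0"
    using F(2) by eventually_elim (auto simp: not_le)
  with F(1) show "integrable lborel F"
    by (rule integrable_if_square_integrable_bounded_support)
qed

lemma pw_of_real: "pw F (complex_of_real x) = inv_fourier F x"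
proof -
  have "exp (2 * pi * \<i> * complex_of_real x * complex_of_real \<nu>) = cis (2 * pi * x * \<nu>)" for \<nu>
    by (simp add: cis_conv_exp mult_ac)
  then show ?thesis by (simp add: pw_def inv_fourier_def)
qed

lemma pw_shift: "pw F (z + w) = pw (\<lambda>\<nu>. F \<nu> * exp (2 * pi * \<i> * w * \<nu>)) z"
  unfolding pw_def by (simp add: exp_add[symmetric] algebra_simps)

lemma norm_exp_character:
  fixes \<nu> W :: real
  assumes "\<bar>\<nu>\<bar> \<le> W / 2"
  shows "cmod (exp (2 * pi * \<i> * w * \<nu>)) \<le> exp (pi * W * \<bar>Im w\<bar>)"
proof -
  have "- (2 * pi * (Im w * \<nu>)) \<le> \<bar>2 * pi * (Im w * \<nu>)\<bar>" by (rule abs_ge_minus_self)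
  also have "\<dots> = 2 * pi * \<bar>Im w\<bar> * \<bar>\<nu>\<bar>" by (simp add: abs_mult)
  also have "\<dots> \<le> 2 * pi * \<bar>Im w\<bar> * (W / 2)"
    using assms by (intro mult_left_mono) auto
  finally show ?thesis by (simp add: mult_ac)
qed

text \<open>Modulation by \<open>w\<close> is translation of \<open>pw F\<close> by
  \<open>w\<close>, also for complex \<open>w\<close>. An imaginary part costs at most the maximum
  of the character over the band.\<close>

lemma bandlimited_modulate:
  assumes F: "bandlimited W F"
  shows "bandlimited W (\<lambda>\<nu>. F \<nu> * exp (2 * pi * \<i> * w * \<nu>))"
    and "L2_norm lborel (\<lambda>\<nu>. F \<nu> * exp (2 * pi * \<i> * w * \<nu>)) \<le> exp (pi * W * \<bar>Im w\<bar>) * L2_norm lborel F"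
proof -
  let ?G = "\<lambda>\<nu>. F \<nu> * exp (2 * pi * \<i> * w * \<nu>)"
  note bandlimitedD(2)[OF F, measurable]
  have [measurable]: "?G \<in> borel_measurable lborel"
    by measurable
  have bound: "AE \<nu> in lborel. (cmod (?G \<nu>))\<^sup>2 \<le> (exp (pi * W * \<bar>Im w\<bar>))\<^sup>2 * (cmod (F \<nu>))\<^sup>2"
    using bandlimitedD(4)[OF F]
  proof eventually_elim
    case (elim \<nu>)
    show ?case
    proof (cases "W / 2 < \<bar>\<nu>\<bar>")
      case False
      then have "cmod (?G \<nu>) \<le> exp (pi * W * \<bar>Im w\<bar>) * cmod (F \<nu>)"
        using mult_left_mono[OF norm_exp_character[of \<nu> W w], of "cmod (F \<nu>)"]
        by (simp only: norm_mult mult.commute[of "exp (pi * W * \<bar>Im w\<bar>)"] norm_ge_zero not_less)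
      then show ?thesis
        unfolding power_mult_distrib[symmetric] by (intro power_mono) auto
    qed (use elim in simp)
  qed
  have int: "integrable lborel (\<lambda>\<nu>. (exp (pi * W * \<bar>Im w\<bar>))\<^sup>2 * (cmod (F \<nu>))\<^sup>2)"
    using bandlimitedD(1)[OF F] by (simp add: square_integrable_def)
  have G: "square_integrable lborel ?G"
    by (rule square_integrable_bound[OF int _ bound]) measurable
  show "bandlimited W ?G"
    unfolding bandlimited_def using G bandlimitedD(4)[OF F] by (auto elim!: eventually_mono)
  have "(L2_norm lborel ?G)\<^sup>2 \<le> (LINT \<nu>|lborel. (exp (pi * W * \<bar>Im w\<bar>))\<^sup>2 * (cmod (F \<nu>))\<^sup>2)"
    unfolding L2_norm_sq using G int bound by (intro integral_mono_AE) (auto simp: square_integrable_def)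
  also have "\<dots> = (exp (pi * W * \<bar>Im w\<bar>) * L2_norm lborel F)\<^sup>2"
    by (simp add: L2_norm_sq power_mult_distrib)
  finally show "L2_norm lborel ?G \<le> exp (pi * W * \<bar>Im w\<bar>) * L2_norm lborel F"
    by (rule power2_le_imp_le) auto
qed

text \<open>Plancherel on the horizontal line through \<open>w\<close>, after moving
  \<open>w\<close> into \<open>F\<close> as a modulation. The factor on the right is the growth that
  the weight in Jensen's inequality is designed to cancel.\<close>

lemma nn_integral_pw_horizontal:
  assumes F: "bandlimited W F"
  shows "energy lborel (\<lambda>x. pw F (complex_of_real x + w))
    \<le> ennreal (exp (2 * pi * W * \<bar>Im w\<bar>) * (L2_norm lborel F)\<^sup>2)"
proof -
  let ?G = "\<lambda>\<nu>. F \<nu> * exp (2 * pi * \<i> * w * \<nu>)"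
  have G: "bandlimited W ?G" by (rule bandlimited_modulate[OF F])
  note P = inv_fourier_plancherel[OF bandlimitedD(3,1)[OF G]]
  have "energy lborel (\<lambda>x. pw F (complex_of_real x + w)) = ennreal ((L2_norm lborel ?G)\<^sup>2)"
    unfolding pw_shift pw_of_real nn_integral_eq_L2_norm[OF P(1)] P(2) ..
  also have "\<dots> \<le> ennreal ((exp (pi * W * \<bar>Im w\<bar>) * L2_norm lborel F)\<^sup>2)"
    by (intro ennreal_leI power_mono bandlimited_modulate F) simp
  also have "(exp (pi * W * \<bar>Im w\<bar>) * L2_norm lborel F)\<^sup>2 = exp (2 * pi * W * \<bar>Im w\<bar>) * (L2_norm lborel F)\<^sup>2"
    by (simp add: power_mult_distrib exp_double[symmetric] mult_ac)
  finally show ?thesis .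
qed

lemma nn_integral_pw:
  assumes F: "bandlimited W F"
  shows "energy lborel (\<lambda>x. pw F (complex_of_real x)) = ennreal ((L2_norm lborel F)\<^sup>2)"
  using inv_fourier_plancherel[OF bandlimitedD(3,1)[OF F]]
  by (simp add: pw_of_real nn_integral_eq_L2_norm)

text \<open>Differentiation under the integral by hand: on the band the second order Taylor
  remainder of the character is of order \<open>(cmod h)\<^sup>2\<close> uniformly in the frequency,
  and \<open>F\<close> is integrable.\<close>

lemma pw_holomorphic:
  assumes F: "bandlimited W F" and W: "W \<ge> 0"
  shows "pw F holomorphic_on UNIV"
proof -
  note bandlimitedD(2)[OF F, measurable]
  have "(pw F has_field_derivative (LINT \<nu>|lborel. F \<nu> * exp (2 * pi * \<i> * z * \<nu>) * (2 * pi * \<i> * \<nu>))) (at z)" for z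
  proof -
    let ?e = "\<lambda>z \<nu>. exp (2 * pi * \<i> * z * complex_of_real \<nu>)"
    let ?l = "\<lambda>h \<nu>. 2 * pi * \<i> * h * complex_of_real \<nu>"
    define G where "G \<nu> = F \<nu> * ?e z \<nu>" for \<nu>
    have G: "bandlimited W G" unfolding G_def by (rule bandlimited_modulate[OF F])
    note bandlimitedD(2)[OF G, measurable]
    define D where "D = (LINT \<nu>|lborel. G \<nu> * (2 * pi * \<i> * \<nu>))"
    have int_D: "integrable lborel (\<lambda>\<nu>. G \<nu> * (2 * pi * \<i> * \<nu>))"
    proof (rule Bochner_Integration.integrable_bound[of _ "\<lambda>\<nu>. (pi * W) *\<^sub>R G \<nu>"])
      show "AE \<nu> in lborel. norm (G \<nu> * (2 * pi * \<i> * \<nu>)) \<le> norm ((pi * W) *\<^sub>R G \<nu>)"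
        using bandlimitedD(4)[OF G]
      proof eventually_elim
        case (elim \<nu>)
        show ?case
        proof (cases "W / 2 < \<bar>\<nu>\<bar>")
          case False
          then have "(2 * \<bar>\<nu>\<bar>) * (pi * cmod (G \<nu>)) \<le> W * (pi * cmod (G \<nu>))"
            by (intro mult_right_mono) auto
          then show ?thesis using W by (simp add: norm_mult mult_ac)
        qed (use elim in simp)
      qed
    qed (use bandlimitedD(3)[OF G] in auto)
    have int_e: "integrable lborel (\<lambda>\<nu>. G \<nu> * ?e h \<nu>)" for h
      by (rule bandlimitedD(3)[OF bandlimited_modulate(1)[OF G]])
    define C where "C = exp (pi * W) * (pi * W)\<^sup>2 * (LINT \<nu>|lborel. cmod (G \<nu>))"
    have bound: "cmod (pw F (z + h) - pw F z - h * D) \<le> C * (cmod h)\<^sup>2" if h: "cmod h \<le> 1" for h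
    proof -
      have "pw F (z + h) - pw F z - h * D = (LINT \<nu>|lborel. G \<nu> * ?e h \<nu> - G \<nu> - h * (G \<nu> * (2 * pi * \<i> * \<nu>)))"
      proof -
        have "pw F (z + h) = (LINT \<nu>|lborel. G \<nu> * ?e h \<nu>)"
          unfolding pw_def G_def by (simp add: exp_add[symmetric] algebra_simps)
        moreover have "pw F z = (LINT \<nu>|lborel. G \<nu>)" unfolding pw_def G_def ..
        ultimately show ?thesis
          unfolding D_def using int_e[of h] bandlimitedD(3)[OF G] int_D by simp
      qed
      also have "\<dots> = (LINT \<nu>|lborel. G \<nu> * (exp (?l h \<nu>) - 1 - ?l h \<nu>))"
        by (intro Bochner_Integration.integral_cong) (auto simp: algebra_simps)
      also have "cmod \<dots> \<le> (LINT \<nu>|lborel. exp (pi * W) * (pi * W)\<^sup>2 * (cmod h)\<^sup>2 * cmod (G \<nu>))"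
      proof (rule order_trans[OF integral_norm_bound integral_mono_AE])
        have "integrable lborel (\<lambda>\<nu>. G \<nu> * ?e h \<nu> - G \<nu> - h * (G \<nu> * (2 * pi * \<i> * \<nu>)))"
          using int_e[of h] bandlimitedD(3)[OF G] int_D by simp
        then show "integrable lborel (\<lambda>\<nu>. norm (G \<nu> * (exp (?l h \<nu>) - 1 - ?l h \<nu>)))"
          by (intro integrable_norm) (simp add: algebra_simps)
        show "AE \<nu> in lborel. norm (G \<nu> * (exp (?l h \<nu>) - 1 - ?l h \<nu>)) \<le> exp (pi * W) * (pi * W)\<^sup>2 * (cmod h)\<^sup>2 * cmod (G \<nu>)"
          using bandlimitedD(4)[OF G]
        proof eventually_elim
          case (elim \<nu>)
          show ?case
          proof (cases "W / 2 < \<bar>\<nu>\<bar>")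
            case False
            have l: "cmod (?l h \<nu>) \<le> pi * W * cmod h"
            proof -
              have "cmod (?l h \<nu>) = (2 * \<bar>\<nu>\<bar>) * (pi * cmod h)" by (simp add: norm_mult)
              also have "\<dots> \<le> W * (pi * cmod h)" using False by (intro mult_right_mono) auto
              finally show ?thesis by (simp add: mult_ac)
            qed
            have "\<bar>Re (?l h \<nu>)\<bar> \<le> cmod (?l h \<nu>)" by (rule abs_Re_le_cmod)
            also have "\<dots> \<le> pi * W * 1" using l by (rule order_trans) (intro mult_left_mono h; use W in simp)
            finally have Re: "exp \<bar>Re (?l h \<nu>)\<bar> \<le> exp (pi * W)" by simp
            have "cmod (exp (?l h \<nu>) - 1 - ?l h \<nu>) \<le> exp \<bar>Re (?l h \<nu>)\<bar> * (cmod (?l h \<nu>))\<^sup>2"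
              using Taylor_exp[of "?l h \<nu>" 1] by (simp add: numeral_2_eq_2 diff_diff_eq)
            also have "\<dots> \<le> exp (pi * W) * (pi * W * cmod h)\<^sup>2"
              by (intro mult_mono Re power_mono l) auto
            finally have "cmod (G \<nu>) * cmod (exp (?l h \<nu>) - 1 - ?l h \<nu>) \<le> cmod (G \<nu>) * (exp (pi * W) * (pi * W * cmod h)\<^sup>2)"
              by (intro mult_left_mono) auto
            then show ?thesis by (simp add: norm_mult power_mult_distrib mult_ac)
          qed (use elim in simp)
        qed
      qed (use bandlimitedD(3)[OF G] in simp)
      finally show ?thesis by (simp add: C_def mult_ac)
    qed
    have "((\<lambda>h. (pw F (z + h) - pw F z) / h) \<longlongrightarrow> D) (at 0)"
    proof (rule Lim_transform2[OF tendsto_const], rule Lim_null_comparison)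
      show "eventually (\<lambda>h. norm (D - (pw F (z + h) - pw F z) / h) \<le> C * cmod h) (at 0)"
        unfolding eventually_at
      proof (intro exI[of _ 1] conjI ballI impI)
        fix h :: complex assume h: "h \<noteq> 0 \<and> dist h 0 < 1"
        then have "norm (D - (pw F (z + h) - pw F z) / h) = cmod (pw F (z + h) - pw F z - h * D) / cmod h"
          by (subst norm_minus_commute) (simp add: norm_divide[symmetric] field_simps)
        also have "\<dots> \<le> C * (cmod h)\<^sup>2 / cmod h" using h by (intro divide_right_mono bound) auto
        finally show "norm (D - (pw F (z + h) - pw F z) / h) \<le> C * cmod h"
          using h by (simp add: power2_eq_square)
      qed simp
      show "((\<lambda>h. C * cmod h) \<longlongrightarrow> 0) (at 0)"
        by (rule tendsto_eq_intros refl | simp)+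
    qed
    then show ?thesis by (simp add: DERIV_def D_def G_def)
  qed
  then show ?thesis
    by (auto simp: holomorphic_on_def field_differentiable_def intro: has_field_derivative_at_within)
qed


section \<open>Jensen's inequality on a disc\<close>

lemma mean_value_circle:
  assumes cont: "continuous_on (cball 0 R) h" and holo: "h holomorphic_on ball 0 R" and R: "R > 0"
  shows "ennreal (cmod (h 0)) \<le> (\<integral>\<^sup>+s\<in>{0..1}. ennreal (cmod (h (R * cis (2 * pi * s)))) \<partial>lborel)"
proof -
  let ?h = "\<lambda>s::real. h (R * cis (2 * pi * s))"
  have "((\<lambda>u. h u / (u - 0)) has_contour_integral (2 * of_real pi * \<i> * h 0)) (circlepath 0 R)"
    by (rule Cauchy_integral_circlepath[OF cont holo]) (use R in simp)
  then have "((\<lambda>x. h (circlepath 0 R x) / circlepath 0 R x * (2 * pi * \<i> * R * exp (2 * of_real pi * \<i> * x)))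
      has_integral (2 * of_real pi * \<i> * h 0)) {0..1}"
    unfolding has_contour_integral by (rule has_integral_eq[rotated]) (simp add: vector_derivative_circlepath)
  then have "((\<lambda>x. (2 * pi * \<i>) * ?h x) has_integral (2 * of_real pi * \<i> * h 0)) {0..1}"
    by (rule has_integral_eq[rotated]) (use R in \<open>simp add: circlepath cis_conv_exp field_simps\<close>)
  then have "((\<lambda>x. (1 / (2 * pi * \<i>)) * ((2 * pi * \<i>) * ?h x)) has_integral (1 / (2 * pi * \<i>)) * (2 * of_real pi * \<i> * h 0)) {0..1}"
    by (rule has_integral_mult_right)
  then have int: "(?h has_integral h 0) {0..1}" by simp
  have "continuous_on {0..1} ?h"
    using R by (intro continuous_on_compose2[OF cont] continuous_intros) (auto simp: norm_mult)
  then have leb: "set_integrable lborel {0..1} ?h"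
    by (rule borel_integrable_atLeastAtMost')
  have "h 0 = (LINT s:{0..1}|lborel. ?h s)"
    using set_borel_integral_eq_integral(2)[OF leb] int by (simp add: integral_unique)
  also have "ennreal (cmod \<dots>) \<le> (\<integral>\<^sup>+s. ennreal (cmod (indicator {0..1} s *\<^sub>R ?h s)) \<partial>lborel)"
    unfolding set_lebesgue_integral_def by (rule norm_integral_le_nn_integral)
  also have "\<dots> = (\<integral>\<^sup>+s\<in>{0..1}. ennreal (cmod (?h s)) \<partial>lborel)"
    by (intro nn_integral_cong) (auto simp: indicator_def)
  finally show ?thesis .
qed

text \<open>Zeros are divided out one by one as removable singularities. Since \<open>A\<close> is a
  set, the product over the earlier points is nonzero at the next one, which forces the current
  quotient to vanish there.\<close>

lemma holomorphic_factor_zeros: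
  assumes "f holomorphic_on UNIV" "finite A" "\<And>a. a \<in> A \<Longrightarrow> f a = 0"
  shows "\<exists>q. q holomorphic_on UNIV \<and> (\<forall>z. f z = (\<Prod>a\<in>A. z - a) * q z)"
  using assms(2,3)
proof (induction A rule: finite_induct)
  case empty
  then show ?case using assms(1) by auto
next
  case (insert b A)
  then obtain q where q: "q holomorphic_on UNIV" "\<And>z. f z = (\<Prod>a\<in>A. z - a) * q z" by auto
  have "(\<Prod>a\<in>A. b - a) \<noteq> 0" using insert by auto
  then have qb: "q b = 0" using q(2)[of b] insert.prems[of b] by simp
  define r where "r z = (if z = b then deriv q b else (q z - q b) / (z - b))" for z
  have "r holomorphic_on UNIV"
    unfolding r_def by (rule pole_lemma_open[OF q(1)]) auto
  moreover have "q z = (z - b) * r z" for z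
    using qb by (simp add: r_def)
  then have "f z = (\<Prod>a\<in>insert b A. z - a) * r z" for z
    using insert q(2)[of z] by (simp add: mult_ac)
  ultimately show ?case by blast
qed

text \<open>The only point of the closed right half plane on the branch cut is 0, where the factor
  \<open>w\<close> tames the logarithm and the value \<open>0 * Ln 0 = 0\<close> is the limit. This
  makes \<open>jensen_weight\<close> continuous up to the points 1 and -1 of the circle.\<close>

lemma continuous_on_times_Ln: "continuous_on {w. 0 \<le> Re w} (\<lambda>w. w * Ln w)"
proof -
  have lim0: "((\<lambda>w. w * Ln w) \<longlongrightarrow> 0) (at (0::complex))"
  proof (rule Lim_null_comparison)
    show "eventually (\<lambda>w. norm (w * Ln w) \<le> cmod w * (\<bar>ln (cmod w)\<bar> + pi)) (at (0::complex))"
    proof (rule eventually_at_topological[THEN iffD2], intro exI[of _ UNIV] conjI ballI impI)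
      fix w :: complex assume w: "w \<noteq> 0"
      have "cmod (Ln w) \<le> \<bar>Re (Ln w)\<bar> + \<bar>Im (Ln w)\<bar>" by (rule cmod_le)
      also have "\<dots> \<le> \<bar>ln (cmod w)\<bar> + pi"
        using w Im_Ln_le_pi[OF w] mpi_less_Im_Ln[OF w] by (auto simp: Re_Ln)
      finally show "norm (w * Ln w) \<le> cmod w * (\<bar>ln (cmod w)\<bar> + pi)"
        by (simp add: norm_mult mult_left_mono)
    qed auto
    have "((\<lambda>x::real. x * (\<bar>ln x\<bar> + pi)) \<longlongrightarrow> 0) (at_right 0)" by real_asymp
    moreover have "filterlim cmod (at_right 0) (at 0)"
      unfolding filterlim_at by (auto intro!: tendsto_eq_intros eventually_at_topological[THEN iffD2] exI[of _ UNIV])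
    ultimately show "((\<lambda>w. cmod w * (\<bar>ln (cmod w)\<bar> + pi)) \<longlongrightarrow> 0) (at (0::complex))"
      by (rule filterlim_compose)
  qed
  show ?thesis
    unfolding continuous_on_eq_continuous_within
  proof
    fix w :: complex assume w: "w \<in> {w. 0 \<le> Re w}"
    show "continuous (at w within {w. 0 \<le> Re w}) (\<lambda>w. w * Ln w)"
    proof (cases "w = 0")
      case True
      then have "continuous (at w) (\<lambda>w. w * Ln w)" using lim0 by (simp add: continuous_at)
      then show ?thesis by (rule continuous_at_imp_continuous_at_within)
    next
      case False
      then have "w \<notin> \<real>\<^sub>\<le>\<^sub>0" using w by (auto simp: complex_nonpos_Reals_iff complex_eq_iff)
      then have "continuous (at w) (\<lambda>w. w * Ln w)" by (intro continuous_intros) auto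
      then show ?thesis by (rule continuous_at_imp_continuous_at_within)
    qed
  qed
qed

text \<open>
  On the unit circle \<open>1 / z - z = - 2 i sin \<theta>\<close>, and \<open>ln ((1 + z) / (1 - z))\<close> has imaginary part
  \<open>\<plusminus>\<pi>/2\<close>, so \<open>jensen_weight\<close> is the holomorphic function with real part \<open>|sin \<theta>|\<close> there. Its value
  \<open>2/\<pi>\<close> at the centre is the mean of \<open>|sin \<theta>|\<close>, the sharp constant in Jensen's formula. At
  \<open>z = \<plusminus>1\<close> the junk value \<open>Ln 0\<close> is multiplied by \<open>0\<close>, which is the right limit.
\<close>

definition jensen_log :: "complex \<Rightarrow> complex" where
  "jensen_log z = Ln (1 + z) - Ln (1 - z)"

definition jensen_weight :: "complex \<Rightarrow> complex" where
  "jensen_weight z = (1 - z\<^sup>2) / pi * (if z = 0 then 2 else jensen_log z / z)"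

lemma jensen_log_derivative:
  assumes "cmod z < 1"
  shows "(jensen_log has_field_derivative (1 / (1 + z) + 1 / (1 - z))) (at z)"
proof -
  have re: "0 < Re (1 + z)" "0 < Re (1 - z)"
    using assms abs_Re_le_cmod[of z] by auto
  then have "1 + z \<notin> \<real>\<^sub>\<le>\<^sub>0" "1 - z \<notin> \<real>\<^sub>\<le>\<^sub>0"
    by (auto simp: complex_nonpos_Reals_iff)
  then show ?thesis
    unfolding jensen_log_def by (auto intro!: derivative_eq_intros simp: divide_inverse)
qed

text \<open>The value 2 in \<open>jensen_weight\<close> is the derivative of
  \<open>jensen_log\<close> at 0, so the case distinction fills a removable singularity.\<close>

lemma jensen_weight_holomorphic: "jensen_weight holomorphic_on ball 0 1"
proof -
  have "jensen_log field_differentiable (at z within ball 0 1)" if "z \<in> ball 0 1" for z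
  proof (rule field_differentiable_at_within)
    show "jensen_log field_differentiable (at z)"
      unfolding field_differentiable_def using jensen_log_derivative[of z] that by auto
  qed
  then have "jensen_log holomorphic_on ball 0 1" by (rule holomorphic_onI)
  then have "(\<lambda>z. if z = 0 then deriv jensen_log 0 else (jensen_log z - jensen_log 0) / (z - 0)) holomorphic_on ball 0 1"
    by (rule pole_lemma_open) simp
  moreover have "deriv jensen_log 0 = 2"
    using jensen_log_derivative[of 0] by (intro DERIV_imp_deriv) simp
  moreover have "jensen_log 0 = 0" by (simp add: jensen_log_def)
  ultimately have "(\<lambda>z. if z = 0 then 2 else jensen_log z / z) holomorphic_on ball 0 1"
    by (simp only: diff_zero)
  then have "(\<lambda>z. (1 - z\<^sup>2) / pi * (if z = 0 then 2 else jensen_log z / z)) holomorphic_on ball 0 1"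
    by (rule holomorphic_on_mult[rotated]) (auto intro!: holomorphic_intros)
  then show ?thesis by (simp only: jensen_weight_def[abs_def])
qed

text \<open>Writing \<open>1 - z\<^sup>2\<close> as a product gives each logarithm the linear factor
  that vanishes with its argument, so \<open>continuous_on_times_Ln\<close> covers the boundary;
  near 0 holomorphy is already known, and the two relatively open pieces cover the closed
  disc.\<close>

lemma jensen_weight_continuous: "continuous_on (cball 0 1) jensen_weight"
proof -
  have union: "cball 0 1 = ball 0 1 \<union> (cball 0 1 - {0::complex})" by auto
  have re: "0 \<le> Re (1 + z)" "0 \<le> Re (1 - z)" if "cmod z \<le> 1" for z
    using that abs_Re_le_cmod[of z] by auto
  have "continuous_on (cball 0 1 - {0}) (\<lambda>z::complex. ((1 - z) * ((1 + z) * Ln (1 + z)) - (1 + z) * ((1 - z) * Ln (1 - z))) / (complex_of_real pi * z))"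
    by (intro continuous_intros continuous_on_compose2[OF continuous_on_times_Ln]) (use re in auto)
  then have "continuous_on (cball 0 1 - {0}) jensen_weight"
  proof (rule continuous_on_eq)
    fix z :: complex assume "z \<in> cball 0 1 - {0}"
    then have "z \<noteq> 0" by simp
    have "(1 - z) * ((1 + z) * Ln (1 + z)) - (1 + z) * ((1 - z) * Ln (1 - z)) = (1 - z\<^sup>2) * (Ln (1 + z) - Ln (1 - z))"
      by (simp add: algebra_simps power2_eq_square)
    then show "((1 - z) * ((1 + z) * Ln (1 + z)) - (1 + z) * ((1 - z) * Ln (1 - z))) / (complex_of_real pi * z) = jensen_weight z"
      using \<open>z \<noteq> 0\<close> by (simp add: jensen_weight_def jensen_log_def)
  qed
  moreover have "openin (top_of_set (cball 0 1)) (cball 0 1 - {0::complex})"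
    by (auto simp: openin_open intro!: exI[of _ "- {0}"])
  moreover have "openin (top_of_set (cball 0 1)) (ball 0 (1::real) :: complex set)"
    by (auto simp: openin_open intro!: exI[of _ "ball 0 1"])
  ultimately have "continuous_on (ball 0 1 \<union> (cball 0 1 - {0})) jensen_weight"
    using holomorphic_on_imp_continuous_on[OF jensen_weight_holomorphic]
    by (intro continuous_on_Un_local_open) (simp_all only: union[symmetric])
  then show ?thesis by (simp only: union[symmetric])
qed

lemma jensen_weight_0: "jensen_weight 0 = 2 / pi"
  by (simp add: jensen_weight_def)

text \<open>The map \<open>(1 + z) / (1 - z)\<close> sends the upper half circle into the imaginary
  axis, so the cosine of the argument vanishes; the bounds on the two logarithms confine the
  argument to \<open>{0..pi}\<close>, where the cosine has a single zero.\<close>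

lemma Im_jensen_log:
  assumes z: "cmod z = 1" and Im: "0 < Im z"
  shows "Im (jensen_log z) = pi / 2"
proof -
  have "Re z < 1" "- 1 < Re z"
  proof -
    have "(Re z)\<^sup>2 + (Im z)\<^sup>2 = 1" using z by (simp add: cmod_def)
    moreover have "0 < (Im z)\<^sup>2" using Im by simp
    ultimately have "(Re z)\<^sup>2 < 1" by linarith
    then have "\<bar>Re z\<bar> < 1" by (simp add: abs_square_less_1)
    then show "Re z < 1" "- 1 < Re z" by auto
  qed
  then have re: "0 < Re (1 + z)" "0 < Re (1 - z)" by auto
  have nz: "1 + z \<noteq> 0" "1 - z \<noteq> 0" using re by (metis less_irrefl zero_complex.sel(1))+
  have "0 < Im (Ln (1 + z))" "Im (Ln (1 + z)) < pi / 2"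
    using Im_Ln_pos_lt[OF nz(1)] Im Re_Ln_pos_lt[OF nz(1)] re by auto
  moreover have "Im (Ln (1 - z)) < 0" "- (pi / 2) < Im (Ln (1 - z))"
    using Im_Ln_pos_le[OF nz(2)] Im Re_Ln_pos_lt[OF nz(2)] re Im_Ln_le_pi[OF nz(2)] by auto
  ultimately have range: "0 \<le> Im (jensen_log z)" "Im (jensen_log z) \<le> pi"
    by (auto simp: jensen_log_def)
  have "exp (jensen_log z) = (1 + z) / (1 - z)"
    using nz by (simp add: jensen_log_def exp_diff)
  moreover have "Re ((1 + z) / (1 - z)) = 0"
  proof -
    have "(Re z)\<^sup>2 + (Im z)\<^sup>2 = 1" using z by (simp add: cmod_def)
    then have "Re (1 + z) * Re (1 - z) + Im (1 + z) * Im (1 - z) = 0"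
      by (simp add: power2_eq_square algebra_simps)
    then show ?thesis by (simp only: Re_divide div_0)
  qed
  ultimately have "exp (Re (jensen_log z)) * cos (Im (jensen_log z)) = 0"
    by (simp only: Re_exp[symmetric])
  then have "cos (Im (jensen_log z)) = 0" by simp
  then show ?thesis
    using cos_inj_pi[of "Im (jensen_log z)" "pi / 2"] range by simp
qed

text \<open>Oddness of \<open>jensen_log\<close> reduces the lower half circle to the upper one; at
  1 and -1 the factor \<open>1 - z\<^sup>2\<close> vanishes.\<close>

lemma Re_jensen_weight:
  assumes z: "cmod z = 1"
  shows "Re (jensen_weight z) = \<bar>Im z\<bar>"
proof (cases "Im z = 0")
  case True
  then have "\<bar>Re z\<bar> = 1" using z by (simp add: cmod_def)
  then have "(Re z)\<^sup>2 = 1" by (metis power2_abs one_power2)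
  then have "z\<^sup>2 = 1" using True by (simp add: complex_eq_iff power2_eq_square)
  then show ?thesis using True by (simp add: jensen_weight_def)
next
  case False
  have "z \<noteq> 0" using z by auto
  have "z * cnj z = 1" using z complex_norm_square[of z] by simp
  then have "1 - z\<^sup>2 = (cnj z - z) * z" by (simp add: algebra_simps power2_eq_square)
  then have "(1 - z\<^sup>2) / z = cnj z - z" using \<open>z \<noteq> 0\<close> by simp
  also have "\<dots> = - 2 * \<i> * Im z" by (simp add: complex_eq_iff)
  finally have *: "(1 - z\<^sup>2) / z = - 2 * \<i> * Im z" .
  have "jensen_weight z = ((1 - z\<^sup>2) / z) / pi * jensen_log z"
    using \<open>z \<noteq> 0\<close> by (simp add: jensen_weight_def)
  then have "jensen_weight z = (- 2 * \<i> * Im z) / pi * jensen_log z"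
    unfolding * .
  then have eq: "Re (jensen_weight z) = 2 * Im z * Im (jensen_log z) / pi"
    by simp
  show ?thesis
  proof (cases "Im z > 0")
    case True
    then show ?thesis using eq Im_jensen_log[OF z True] by simp
  next
    case neg: False
    have "jensen_log z = - jensen_log (- z)" by (simp add: jensen_log_def)
    moreover have "Im (jensen_log (- z)) = pi / 2"
      by (rule Im_jensen_log) (use z neg False in auto)
    ultimately have "Im (jensen_log z) = - (pi / 2)" by (simp only: uminus_complex.sel)
    then show ?thesis using neg by (simp add: eq)
  qed
qed

text \<open>At the centre the Blaschke product contributes the factors \<open>cmod a / R\<close>,
  and \<open>G\<close> contributes \<open>exp (- (2 * W * R))\<close>, because
  \<open>pi * W * R\<close> times the central value \<open>2 / pi\<close> of the weight is
  \<open>2 * W * R\<close>. Using the mean of the modulus instead of its logarithm keeps the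
  estimate linear in the circle term.\<close>

lemma jensen_disc:
  assumes f: "f holomorphic_on UNIV" and A: "finite A" "\<And>a. a \<in> A \<Longrightarrow> f a = 0"
    and R: "R > 0" and W: "W \<ge> 0"
  shows "ennreal (cmod (f 0)) \<le> ennreal (exp (2 * W * R) * (\<Prod>a\<in>A. cmod a / R)) *
     (\<integral>\<^sup>+s\<in>{0..1}. ennreal (cmod (f (R * cis (2 * pi * s))) * exp (- (pi * W * R * \<bar>sin (2 * pi * s)\<bar>))) \<partial>lborel)"
proof -
  obtain q where q: "q holomorphic_on UNIV" and fq: "\<And>z. f z = (\<Prod>a\<in>A. z - a) * q z"
    using holomorphic_factor_zeros[OF f A] by blast
  define G :: "complex \<Rightarrow> complex" where "G z = exp (- complex_of_real (pi * W * R) * jensen_weight (z / complex_of_real R))" for z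
  \<comment> \<open>Replacing each factor \<open>z - a\<close> of \<open>f\<close> by
    \<open>R - cnj a * z / R\<close> keeps the modulus on the circle, since
    \<open>z * cnj z = R\<^sup>2\<close> there, and changes it from \<open>cmod a\<close> to
    \<open>R\<close> at the centre. This is division by the Blaschke product.\<close>
  define h :: "complex \<Rightarrow> complex" where "h z = q z * (\<Prod>a\<in>A. complex_of_real R - cnj a * z / complex_of_real R) * G z" for z
  have "continuous_on (cball 0 R) (\<lambda>z::complex. jensen_weight (z / complex_of_real R))"
    by (rule continuous_on_compose2[OF jensen_weight_continuous])
       (use R in \<open>auto simp: norm_divide intro!: continuous_intros\<close>)
  then have "continuous_on (cball 0 R) G"
    unfolding G_def by (intro continuous_intros)
  moreover have "continuous_on (cball 0 R) q"
    using holomorphic_on_imp_continuous_on[OF q] continuous_on_subset by blast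
  ultimately have "continuous_on (cball 0 R) h"
    unfolding h_def using R by (intro continuous_intros) auto
  moreover have "h holomorphic_on ball 0 R"
  proof -
    have "jensen_weight \<circ> (\<lambda>z::complex. z / complex_of_real R) holomorphic_on ball 0 R"
      by (rule holomorphic_on_compose_gen[OF _ jensen_weight_holomorphic])
         (use R in \<open>auto simp: norm_divide intro!: holomorphic_intros\<close>)
    then have "G holomorphic_on ball 0 R"
      unfolding G_def o_def by (intro holomorphic_intros)
    moreover have "q holomorphic_on ball 0 R" using q holomorphic_on_subset by blast
    ultimately show ?thesis
      unfolding h_def using R by (intro holomorphic_intros) auto
  qed
  ultimately have mean: "ennreal (cmod (h 0)) \<le> (\<integral>\<^sup>+s\<in>{0..1}. ennreal (cmod (h (complex_of_real R * cis (2 * pi * s)))) \<partial>lborel)"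
    by (rule mean_value_circle[OF _ _ R])
  have circle: "cmod (h (complex_of_real R * cis (2 * pi * s))) 
      = cmod (f (R * cis (2 * pi * s))) * exp (- (pi * W * R * \<bar>sin (2 * pi * s)\<bar>))" for s
  proof -
    define z where "z = complex_of_real R * cis (2 * pi * s)"
    have zR: "cmod z = R" using R by (simp add: z_def norm_mult)
    have "cmod (complex_of_real R - cnj a * z / complex_of_real R) = cmod (z - a)" for a
    proof -
      have "z * cnj z = complex_of_real (R\<^sup>2)" using complex_norm_square[of z] zR by simp
      then have "z * cnj (z - a) = complex_of_real (R\<^sup>2) - cnj a * z" by (simp add: algebra_simps)
      then have "complex_of_real R - cnj a * z / complex_of_real R = z * cnj (z - a) / complex_of_real R"
        using R by (simp add: diff_divide_distrib power2_eq_square)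
      then show ?thesis using zR R by (simp add: norm_mult norm_divide del: complex_cnj_diff)
    qed
    moreover have "cmod (G z) = exp (- (pi * W * R * \<bar>sin (2 * pi * s)\<bar>))"
    proof -
      have "z / complex_of_real R = cis (2 * pi * s)" using R by (simp add: z_def)
      then have "Re (jensen_weight (z / complex_of_real R)) = \<bar>sin (2 * pi * s)\<bar>"
        by (subst Re_jensen_weight) auto
      then show ?thesis by (simp add: G_def)
    qed
    ultimately show ?thesis
      unfolding z_def[symmetric] by (simp add: h_def fq norm_mult prod_norm[symmetric])
  qed
  have "cmod (G 0) = exp (- (2 * W * R))" by (simp add: G_def jensen_weight_0)
  then have "cmod (f 0) = exp (2 * W * R) * (\<Prod>a\<in>A. cmod a / R) * cmod (h 0)"
    using R by (simp add: h_def fq norm_mult prod_norm[symmetric] prod_dividef exp_minus norm_power field_simps)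
  also have "ennreal \<dots> = ennreal (exp (2 * W * R) * (\<Prod>a\<in>A. cmod a / R)) * ennreal (cmod (h 0))"
    using R by (intro ennreal_mult mult_nonneg_nonneg prod_nonneg) auto
  also have "\<dots> \<le> ennreal (exp (2 * W * R) * (\<Prod>a\<in>A. cmod a / R)) * 
     (\<integral>\<^sup>+s\<in>{0..1}. ennreal (cmod (h (complex_of_real R * cis (2 * pi * s)))) \<partial>lborel)"
    by (intro mult_left_mono mean) auto
  finally show ?thesis unfolding circle .
qed

text \<open>Only separation, radius and the number \<open>n\<close> enter the bound: each quotient
  is at most \<open>2 * R / \<delta>\<close>. The maximum with 1 permits the common power
  \<open>n\<close> when \<open>A\<close> has fewer points.\<close>

lemma lagrange_interpolation:
  fixes A :: "complex set" and v :: "complex \<Rightarrow> complex"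
  assumes A: "finite A" "card A \<le> n" "\<And>a. a \<in> A \<Longrightarrow> cmod a \<le> R"
    and sep: "\<And>a b. a \<in> A \<Longrightarrow> b \<in> A \<Longrightarrow> a \<noteq> b \<Longrightarrow> \<delta> \<le> cmod (a - b)" and \<delta>: "\<delta> > 0" and R: "R > 0"
  obtains p where "p holomorphic_on UNIV" "\<And>a. a \<in> A \<Longrightarrow> p a = v a"
    "\<And>z. cmod z \<le> R \<Longrightarrow> cmod (p z) \<le> (max 1 (2 * R / \<delta>)) ^ n * (\<Sum>a\<in>A. cmod (v a))"
proof
  define p where "p z = (\<Sum>a\<in>A. v a * (\<Prod>b\<in>A - {a}. (z - b) / (a - b)))" for z
  show "p holomorphic_on UNIV"
    unfolding p_def by (intro holomorphic_intros) auto
  show "p a = v a" if a: "a \<in> A" for a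
  proof -
    have "(\<Prod>b\<in>A - {c}. (a - b) / (c - b)) = (if c = a then 1 else 0)" if "c \<in> A" for c
    proof (cases "c = a")
      case True
      have "(a - b) / (a - b) = 1" if "b \<in> A - {a}" for b using that by auto
      then have "(\<Prod>b\<in>A - {a}. (a - b) / (a - b)) = 1" by (blast intro: prod.neutral)
      then show ?thesis using True by simp
    next
      case False
      then show ?thesis using A(1) a by (auto intro!: prod_zero bexI[of _ a])
    qed
    then have "p a = (\<Sum>c\<in>A. v c * (if c = a then 1 else 0))"
      unfolding p_def by (intro sum.cong) auto
    also have "\<dots> = v a" using A(1) a by (simp add: if_distrib cong: if_cong)
    finally show ?thesis .
  qed
  let ?M = "max 1 (2 * R / \<delta>)"
  fix z assume z: "cmod z \<le> R"
  have "cmod (p z) \<le> (\<Sum>a\<in>A. cmod (v a) * ?M ^ n)"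
    unfolding p_def
  proof (rule order_trans[OF norm_sum sum_mono])
    fix a assume a: "a \<in> A"
    have "cmod (\<Prod>b\<in>A - {a}. (z - b) / (a - b)) = (\<Prod>b\<in>A - {a}. cmod (z - b) / cmod (a - b))"
      by (simp add: prod_norm[symmetric] norm_divide)
    also have "\<dots> \<le> (\<Prod>b\<in>A - {a}. ?M)"
    proof (intro prod_mono conjI)
      fix b assume b: "b \<in> A - {a}"
      have "cmod (z - b) \<le> 2 * R" using norm_triangle_ineq4[of z b] z A(3)[of b] b by auto
      moreover have "\<delta> \<le> cmod (a - b)" using sep a b by auto
      ultimately have "cmod (z - b) / cmod (a - b) \<le> 2 * R / \<delta>" using \<delta> R by (intro frac_le) auto
      then show "cmod (z - b) / cmod (a - b) \<le> ?M" by simp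
    qed auto
    also have "\<dots> = ?M ^ card (A - {a})" by simp
    also have "\<dots> \<le> ?M ^ n"
      using A(1,2) card_Diff1_le[of A a] by (intro power_increasing) (auto intro: le_trans)
    finally show "cmod (v a * (\<Prod>b\<in>A - {a}. (z - b) / (a - b))) \<le> cmod (v a) * ?M ^ n"
      by (simp add: norm_mult mult_left_mono)
  qed
  then show "cmod (p z) \<le> ?M ^ n * (\<Sum>a\<in>A. cmod (v a))"
    by (simp add: sum_distrib_right mult.commute)
qed


section \<open>The sampling estimate at one point\<close>

lemma ennreal_square_add_le: "(x + y)\<^sup>2 \<le> 2 * x\<^sup>2 + 2 * (y :: ennreal)\<^sup>2"
proof (cases x; cases y)
  fix a b :: real assume ab: "x = ennreal a" "0 \<le> a" "y = ennreal b" "0 \<le> b"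
  have "(a + b)\<^sup>2 \<le> 2 * a\<^sup>2 + 2 * b\<^sup>2" using weighted_square_add[of 1 a b] by simp
  then have "ennreal ((a + b)\<^sup>2) \<le> ennreal (2 * a\<^sup>2 + 2 * b\<^sup>2)" by (rule ennreal_leI)
  also have "\<dots> = 2 * (ennreal a)\<^sup>2 + 2 * (ennreal b)\<^sup>2"
    using ab by (simp add: ennreal_power ennreal_mult)
  finally show ?thesis using ab by (simp add: ennreal_power flip: ennreal_plus)
qed (auto simp: ennreal_mult_eq_top_iff power2_eq_square)

lemma nn_integral_unit_interval_square_le:
  assumes [measurable]: "g \<in> borel_measurable borel"
  shows "(\<integral>\<^sup>+s\<in>{0..1}. g s \<partial>lborel)\<^sup>2 \<le> (\<integral>\<^sup>+s\<in>{0..1::real}. (g s)\<^sup>2 \<partial>lborel)"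
proof -
  have "(\<integral>\<^sup>+s\<in>{0..1}. g s \<partial>lborel) = (\<integral>\<^sup>+s. (g s * indicator {0..1} s) * indicator {0..1} s \<partial>lborel)"
    by (intro nn_integral_cong) (auto simp: indicator_def)
  also have "\<dots>\<^sup>2 \<le> (\<integral>\<^sup>+s. (g s * indicator {0..1} s)\<^sup>2 \<partial>lborel) * (\<integral>\<^sup>+s. (indicator {0..1::real} s)\<^sup>2 \<partial>lborel)"
    by (rule Cauchy_Schwarz_nn_integral) measurable
  also have "(\<integral>\<^sup>+s. (indicator {0..1::real} s)\<^sup>2 \<partial>lborel) = (\<integral>\<^sup>+s. indicator {0..1::real} s \<partial>lborel)"
    by (intro nn_integral_cong) (auto simp: indicator_def)
  also have "(\<integral>\<^sup>+s. (g s * indicator {0..1} s)\<^sup>2 \<partial>lborel) = (\<integral>\<^sup>+s\<in>{0..1}. (g s)\<^sup>2 \<partial>lborel)"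
    by (intro nn_integral_cong) (auto simp: indicator_def)
  finally show ?thesis by simp
qed

text \<open>\<open>jensen_disc\<close> is applied to \<open>f - p\<close>, where \<open>p\<close>
  interpolates \<open>f\<close> on \<open>A\<close>; the samples pay for \<open>p\<close> twice, on
  the circle and at the centre. The small factor \<open>\<theta>\<close> stands before the circle
  term, the only one to be absorbed later; the constant before the samples may be large.\<close>

lemma local_sampling_estimate:
  assumes f: "f holomorphic_on UNIV"
    and A: "finite A" "card A \<le> n" "\<And>a. a \<in> A \<Longrightarrow> cmod a \<le> R"
    and sep: "\<And>a b. a \<in> A \<Longrightarrow> b \<in> A \<Longrightarrow> a \<noteq> b \<Longrightarrow> \<delta> \<le> cmod (a - b)" and \<delta>: "\<delta> > 0"
    and R: "R > 0" and W: "W \<ge> 0"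
    and \<theta>: "exp (2 * W * R) * (\<Prod>a\<in>A. cmod a / R) \<le> \<theta>" "0 \<le> \<theta>"
  shows "ennreal ((cmod (f 0))\<^sup>2) \<le> ennreal (2 * \<theta>\<^sup>2) *
       (\<integral>\<^sup>+s\<in>{0..1}. ennreal ((cmod (f (R * cis (2 * pi * s))))\<^sup>2 * exp (- (2 * pi * W * R * \<bar>sin (2 * pi * s)\<bar>))) \<partial>lborel)
     + ennreal (2 * ((\<theta> + 1) * (max 1 (2 * R / \<delta>)) ^ n)\<^sup>2 * n) * (\<Sum>a\<in>A. ennreal ((cmod (f a))\<^sup>2))"
proof -
  obtain p where p: "p holomorphic_on UNIV" "\<And>a. a \<in> A \<Longrightarrow> p a = f a"
    "\<And>z. cmod z \<le> R \<Longrightarrow> cmod (p z) \<le> (max 1 (2 * R / \<delta>)) ^ n * (\<Sum>a\<in>A. cmod (f a))"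
    by (rule lagrange_interpolation[where v=f, OF A sep \<delta> R]) blast+
  define S where "S = (\<Sum>a\<in>A. cmod (f a))"
  define M where "M = (max 1 (2 * R / \<delta>)) ^ n"
  define c where "c s = complex_of_real R * cis (2 * pi * s)" for s
  define w where "w s = exp (- (pi * W * R * \<bar>sin (2 * pi * s)\<bar>))" for s
  have w: "0 \<le> w s" "w s \<le> 1" for s using W R by (auto simp: w_def)
  have S: "0 \<le> S" by (auto simp: S_def intro: sum_nonneg)
  have M: "1 \<le> M" by (auto simp: M_def intro!: one_le_power)
  have c: "cmod (c s) = R" for s using R by (simp add: c_def norm_mult)
  have [measurable]: "f \<in> borel_measurable borel"
    using holomorphic_on_imp_continuous_on[OF f] by (rule borel_measurable_continuous_onI)
  have [measurable]: "c \<in> borel_measurable borel" "w \<in> borel_measurable borel"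
    unfolding c_def[abs_def] w_def[abs_def] by measurable
  let ?I = "\<integral>\<^sup>+s\<in>{0..1}. ennreal (cmod (f (c s)) * w s) \<partial>lborel"
  have "ennreal (cmod (f 0 - p 0)) \<le> ennreal (exp (2 * W * R) * (\<Prod>a\<in>A. cmod a / R)) *
     (\<integral>\<^sup>+s\<in>{0..1}. ennreal (cmod (f (c s) - p (c s)) * w s) \<partial>lborel)"
    unfolding c_def w_def
    by (rule jensen_disc[of "\<lambda>z. f z - p z", OF _ A(1) _ R W]) (use f p in \<open>auto intro: holomorphic_intros\<close>)
  also have "\<dots> \<le> ennreal \<theta> * (\<integral>\<^sup>+s\<in>{0..1}. (ennreal (cmod (f (c s)) * w s) + ennreal (M * S)) \<partial>lborel)"
  proof (intro mult_mono nn_integral_mono mult_right_mono ennreal_leI \<theta>)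
    fix s :: real
    have "cmod (f (c s) - p (c s)) * w s \<le> (cmod (f (c s)) + cmod (p (c s))) * w s"
      using w by (intro mult_right_mono norm_triangle_ineq4) auto
    also have "\<dots> \<le> cmod (f (c s)) * w s + cmod (p (c s))"
      using w[of s] by (simp add: distrib_right mult_left_le)
    also have "\<dots> \<le> cmod (f (c s)) * w s + M * S"
      using p(3)[of "c s"] c by (simp add: M_def S_def)
    finally show "ennreal (cmod (f (c s) - p (c s)) * w s) \<le> ennreal (cmod (f (c s)) * w s) + ennreal (M * S)"
      using w[of s] M S by (simp add: ennreal_leI flip: ennreal_plus)
  qed auto
  also have "(\<integral>\<^sup>+s\<in>{0..1}. (ennreal (cmod (f (c s)) * w s) + ennreal (M * S)) \<partial>lborel) = ?I + ennreal (M * S)"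
    by (simp add: distrib_right nn_integral_add nn_integral_cmult)
  finally have g: "ennreal (cmod (f 0 - p 0)) \<le> ennreal \<theta> * ?I + ennreal (\<theta> * (M * S))"
    using \<theta>(2) M S by (simp add: distrib_left ennreal_mult)
  have "cmod (f 0) \<le> cmod (f 0 - p 0) + cmod (p 0)"
    using norm_triangle_ineq[of "f 0 - p 0" "p 0"] by simp
  also have "\<dots> \<le> cmod (f 0 - p 0) + M * S"
    using p(3)[of 0] R by (simp add: M_def S_def)
  finally have "ennreal (cmod (f 0)) \<le> ennreal (cmod (f 0 - p 0)) + ennreal (M * S)"
    using M S by (simp add: ennreal_leI flip: ennreal_plus)
  also have "\<dots> \<le> ennreal \<theta> * ?I + ennreal (\<theta> * (M * S)) + ennreal (M * S)"
    by (intro add_right_mono g)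
  also have "\<dots> = ennreal \<theta> * ?I + ennreal ((\<theta> + 1) * M * S)"
    using \<theta>(2) M S by (simp add: add.assoc ennreal_plus[symmetric] algebra_simps del: ennreal_plus)
  finally have "(ennreal (cmod (f 0)))\<^sup>2 \<le> (ennreal \<theta> * ?I + ennreal ((\<theta> + 1) * M * S))\<^sup>2"
    by (rule power_mono) simp
  also have "\<dots> \<le> 2 * (ennreal \<theta> * ?I)\<^sup>2 + 2 * (ennreal ((\<theta> + 1) * M * S))\<^sup>2"
    by (rule ennreal_square_add_le)
  also have "(ennreal \<theta> * ?I)\<^sup>2 \<le> ennreal (\<theta>\<^sup>2) * (\<integral>\<^sup>+s\<in>{0..1}. (ennreal (cmod (f (c s)) * w s))\<^sup>2 \<partial>lborel)"
    unfolding power_mult_distrib using \<theta>(2)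
    by (intro mult_mono nn_integral_unit_interval_square_le) (auto simp: ennreal_power)
  also have "(\<lambda>s. (ennreal (cmod (f (c s)) * w s))\<^sup>2) = (\<lambda>s. ennreal ((cmod (f (c s)))\<^sup>2 * exp (- (2 * pi * W * R * \<bar>sin (2 * pi * s)\<bar>))))"
    using w by (auto simp: ennreal_power power_mult_distrib w_def exp_double[symmetric] mult_ac)
  also have "(ennreal ((\<theta> + 1) * M * S))\<^sup>2 \<le> ennreal (((\<theta> + 1) * M)\<^sup>2 * n) * (\<Sum>a\<in>A. ennreal ((cmod (f a))\<^sup>2))"
  proof -
    have "S\<^sup>2 = (\<Sum>a\<in>A. cmod (f a) * 1)\<^sup>2" by (simp add: S_def)
    also have "\<dots> \<le> (\<Sum>a\<in>A. (cmod (f a))\<^sup>2) * (\<Sum>a\<in>A. 1\<^sup>2)" by (rule Cauchy_Schwarz_ineq_sum)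
    also have "\<dots> \<le> (\<Sum>a\<in>A. (cmod (f a))\<^sup>2) * n" using A(2) by (intro mult_left_mono) (auto intro: sum_nonneg)
    finally have "((\<theta> + 1) * M)\<^sup>2 * S\<^sup>2 \<le> ((\<theta> + 1) * M)\<^sup>2 * ((\<Sum>a\<in>A. (cmod (f a))\<^sup>2) * n)"
      by (rule mult_left_mono) simp
    then have "ennreal (((\<theta> + 1) * M * S)\<^sup>2) \<le> ennreal (((\<theta> + 1) * M)\<^sup>2 * n * (\<Sum>a\<in>A. (cmod (f a))\<^sup>2))"
      by (intro ennreal_leI) (simp add: power_mult_distrib mult_ac)
    also have "\<dots> = ennreal (((\<theta> + 1) * M)\<^sup>2 * n) * (\<Sum>a\<in>A. ennreal ((cmod (f a))\<^sup>2))"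
      by (subst ennreal_mult) (auto intro: sum_nonneg)
    finally show ?thesis using \<theta>(2) M S by (simp add: ennreal_power)
  qed
  finally have "(ennreal (cmod (f 0)))\<^sup>2 \<le> 2 * (ennreal (\<theta>\<^sup>2) * 
       (\<integral>\<^sup>+s\<in>{0..1}. ennreal ((cmod (f (c s)))\<^sup>2 * exp (- (2 * pi * W * R * \<bar>sin (2 * pi * s)\<bar>))) \<partial>lborel))
     + 2 * (ennreal (((\<theta> + 1) * M)\<^sup>2 * n) * (\<Sum>a\<in>A. ennreal ((cmod (f a))\<^sup>2)))"
    by (simp add: add_mono mult_left_mono)
  then show ?thesis
    by (simp add: ennreal_power c_def M_def ennreal_mult mult.assoc)
qed


section \<open>Separated sequences and the global lower bound\<close>

definition separated :: "real \<Rightarrow> (int \<Rightarrow> real) \<Rightarrow> bool" where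
  "separated \<delta> \<Lambda> \<longleftrightarrow> \<delta> > 0 \<and> (\<forall>k. \<delta> \<le> \<Lambda> (k + 1) - \<Lambda> k)"

lemma separated_diff_le:
  assumes "separated \<delta> \<Lambda>" "i \<le> j"
  shows "\<delta> * real_of_int (j - i) \<le> \<Lambda> j - \<Lambda> i"
  using assms(2)
proof (induction j rule: int_ge_induct)
  case (step j)
  have "\<delta> \<le> \<Lambda> (j + 1) - \<Lambda> j" using assms(1) by (auto simp: separated_def)
  with step.IH show ?case by (simp add: algebra_simps)
qed simp

lemma separated_dist:
  assumes "separated \<delta> \<Lambda>" "i \<noteq> j"
  shows "\<delta> \<le> \<bar>\<Lambda> i - \<Lambda> j\<bar>"
proof -
  have less: "\<delta> \<le> \<Lambda> j - \<Lambda> i" if "i < j" for i j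
  proof -
    have "\<delta> * 1 \<le> \<delta> * real_of_int (j - i)"
      using assms(1) that by (intro mult_left_mono) (auto simp: separated_def)
    with separated_diff_le[OF assms(1), of i j] that show ?thesis by simp
  qed
  show ?thesis
    using assms(2) less[of i j] less[of j i] by (cases "i < j") auto
qed

lemma separated_inj: "separated \<delta> \<Lambda> \<Longrightarrow> inj \<Lambda>"
  using separated_dist by (intro injI) (force simp: separated_def)

text \<open>Distinct points fall into distinct cells of length \<open>\<delta>\<close>; the ceiling
  plus 1 bounds the number of cells met.\<close>

lemma separated_finite:
  assumes "separated \<delta> \<Lambda>"
  shows "finite {k. \<Lambda> k \<in> {a..<b}}"
    and "card {k. \<Lambda> k \<in> {a..<b}} \<le> nat (\<lceil>(b - a) / \<delta>\<rceil> + 1)"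
proof -
  let ?K = "{k. \<Lambda> k \<in> {a..<b}}" and ?g = "\<lambda>k. \<lfloor>(\<Lambda> k - a) / \<delta>\<rfloor>"
  have \<delta>: "\<delta> > 0" using assms by (simp add: separated_def)
  have "inj_on ?g ?K"
  proof (rule inj_onI, rule ccontr)
    fix i j assume "?g i = ?g j" "i \<noteq> j"
    then have "\<bar>(\<Lambda> i - a) / \<delta> - (\<Lambda> j - a) / \<delta>\<bar> < 1" by linarith
    then have "\<bar>(\<Lambda> i - \<Lambda> j) / \<delta>\<bar> < 1" by (simp add: diff_divide_distrib)
    then have "\<bar>\<Lambda> i - \<Lambda> j\<bar> < \<delta>" using \<delta> by (simp add: abs_divide)
    with separated_dist[OF assms \<open>i \<noteq> j\<close>] show False by simp
  qed
  moreover have sub: "?g ` ?K \<subseteq> {0..\<lceil>(b - a) / \<delta>\<rceil>}"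
  proof (rule image_subsetI)
    fix k assume k: "k \<in> ?K"
    then have "(\<Lambda> k - a) / \<delta> \<le> (b - a) / \<delta>" "0 \<le> (\<Lambda> k - a) / \<delta>" using \<delta> by (auto simp: divide_right_mono)
    then show "?g k \<in> {0..\<lceil>(b - a) / \<delta>\<rceil>}" unfolding atLeastAtMost_iff by linarith
  qed
  ultimately show "finite ?K"
    using finite_imageD finite_subset by blast
  show "card ?K \<le> nat (\<lceil>(b - a) / \<delta>\<rceil> + 1)"
    using card_inj_on_le[OF \<open>inj_on ?g ?K\<close> sub] by simp
qed

text \<open>An enumeration of the integers turns the sum into a series, whose measurability in a
  parameter is available.\<close>

lemma nn_integral_count_space_int:
  "(\<integral>\<^sup>+k. f k \<partial>count_space (UNIV :: int set)) = (\<Sum>n. f (int_decode n))"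
  using nn_integral_bij_count_space[OF bij_int_decode, of f] by (simp add: nn_integral_count_space_nat)

lemma borel_measurable_nn_integral_count_space_int [measurable (raw)]:
  assumes [measurable]: "\<And>k. (\<lambda>x. f x k) \<in> borel_measurable M"
  shows "(\<lambda>x. \<integral>\<^sup>+k. f x k \<partial>count_space (UNIV :: int set)) \<in> borel_measurable M"
  unfolding nn_integral_count_space_int by measurable

text \<open>The estimate at every real \<open>x\<close> is integrated over \<open>x\<close>. Fubini
  reduces the circle term to horizontal lines, where the weight cancels the growth, and each
  sampling point is counted for \<open>x\<close> in an interval of length \<open>2 * R\<close>.
  Since \<open>2 * \<theta>\<^sup>2 \<le> 1 / 2\<close>, the circle term takes at most half of the
  left side.\<close>

lemma sampling_lower_bound_aux:
  assumes sep: "separated \<delta> \<Lambda>" and R: "R > 0" and W: "W \<ge> 0" and \<theta>: "0 \<le> \<theta>" "\<theta> \<le> 1 / 2"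
    and density: "\<And>x. exp (2 * W * R) * (\<Prod>k | \<Lambda> k \<in> {x - R..<x + R}. \<bar>\<Lambda> k - x\<bar> / R) \<le> \<theta>"
  shows "\<exists>C>0. \<forall>F. bandlimited W F \<longrightarrow>
    ennreal ((L2_norm lborel F)\<^sup>2) \<le> ennreal C * sample_energy \<Lambda> F"
proof -
  define n where "n = nat (\<lceil>2 * R / \<delta>\<rceil> + 1)"
  define C where "C = 2 * ((\<theta> + 1) * (max 1 (2 * R / \<delta>)) ^ n)\<^sup>2 * real n"
  have \<delta>: "\<delta> > 0" using sep by (simp add: separated_def)
  have "0 \<le> \<lceil>2 * R / \<delta>\<rceil>" using R \<delta> by (simp add: zero_le_ceiling) (smt (verit) divide_pos_pos)
  then have "n > 0" by (simp add: n_def)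
  then have C: "C > 0" using \<theta> by (auto simp: C_def)
  show ?thesis
  \<comment> \<open>The length \<open>2 * R\<close> of the counting intervals, doubled by moving
    half of the norm to the left.\<close>
  proof (intro exI[of _ "4 * R * C"] conjI allI impI)
    show "4 * R * C > 0" using R C by simp
    fix F assume F: "bandlimited W F"
    define K where "K x = {k. \<Lambda> k \<in> {x - R..<x + R}}" for x
    let ?w = "\<lambda>s. exp (- (2 * pi * W * R * \<bar>sin (2 * pi * s)\<bar>))"
    let ?z = "\<lambda>s. complex_of_real R * cis (2 * pi * s)"
    have [measurable]: "pw F \<in> borel_measurable borel"
      using holomorphic_on_imp_continuous_on[OF pw_holomorphic[OF F W]] by (rule borel_measurable_continuous_onI)
    have pointwise: "ennreal ((cmod (pw F (complex_of_real x)))\<^sup>2) \<le> ennreal (2 * \<theta>\<^sup>2) *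
        (\<integral>\<^sup>+s\<in>{0..1}. ennreal ((cmod (pw F (complex_of_real x + ?z s)))\<^sup>2 * ?w s) \<partial>lborel)
      + ennreal C * (\<integral>\<^sup>+k. ennreal ((cmod (pw F (\<Lambda> k)))\<^sup>2) * indicator {\<Lambda> k - R<..\<Lambda> k + R} x \<partial>count_space UNIV)" for x
    proof -
      define a where "a k = complex_of_real (\<Lambda> k - x)" for k
      have inj: "inj_on a (K x)"
        using separated_inj[OF sep] by (auto simp: inj_on_def a_def)
      have fin: "finite (K x)" "card (K x) \<le> n"
        using separated_finite[OF sep, of "x - R" "x + R"] by (auto simp: K_def n_def)
      have "ennreal ((cmod (pw F (complex_of_real x + 0)))\<^sup>2) \<le> ennreal (2 * \<theta>\<^sup>2) *
        (\<integral>\<^sup>+s\<in>{0..1}. ennreal ((cmod (pw F (complex_of_real x + ?z s)))\<^sup>2 * ?w s) \<partial>lborel)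
        + ennreal C * (\<Sum>b\<in>a ` K x. ennreal ((cmod (pw F (complex_of_real x + b)))\<^sup>2))"
        unfolding C_def
      proof (rule local_sampling_estimate[where f="\<lambda>z. pw F (complex_of_real x + z)"])
        have "pw F \<circ> (\<lambda>z. complex_of_real x + z) holomorphic_on UNIV"
          by (rule holomorphic_on_compose_gen[OF _ pw_holomorphic[OF F W]]) (auto intro!: holomorphic_intros)
        then show "(\<lambda>z. pw F (complex_of_real x + z)) holomorphic_on UNIV" by (simp add: o_def)
        show "finite (a ` K x)" "card (a ` K x) \<le> n"
          using fin inj by (auto simp: card_image)
        show "cmod b \<le> R" if "b \<in> a ` K x" for b
          using that by (auto simp: a_def K_def simp del: of_real_diff)
        show "\<delta> \<le> cmod (b - c)" if bc: "b \<in> a ` K x" "c \<in> a ` K x" "b \<noteq> c" for b c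
        proof -
          obtain i j where ij: "b = a i" "c = a j" using bc by blast
          then have "i \<noteq> j" using bc by auto
          moreover have "b - c = complex_of_real (\<Lambda> i - \<Lambda> j)" by (simp add: ij a_def)
          ultimately show ?thesis using separated_dist[OF sep] by (simp del: of_real_diff)
        qed
        have "(\<Prod>b\<in>a ` K x. cmod b / R) = (\<Prod>k\<in>K x. \<bar>\<Lambda> k - x\<bar> / R)"
          unfolding prod.reindex[OF inj] by (simp add: a_def del: of_real_diff)
        then show "exp (2 * W * R) * (\<Prod>b\<in>a ` K x. cmod b / R) \<le> \<theta>"
          using density[of x] by (simp add: K_def)
      qed fact+
      also have "(\<Sum>b\<in>a ` K x. ennreal ((cmod (pw F (complex_of_real x + b)))\<^sup>2)) = (\<Sum>k\<in>K x. ennreal ((cmod (pw F (\<Lambda> k)))\<^sup>2))"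
        unfolding sum.reindex[OF inj] by (simp add: a_def)
      also have "\<dots> = (\<Sum>k\<in>K x. ennreal ((cmod (pw F (\<Lambda> k)))\<^sup>2) * indicator {\<Lambda> k - R<..\<Lambda> k + R} x)"
        by (intro sum.cong) (auto simp: K_def indicator_def)
      also have "\<dots> = (\<integral>\<^sup>+k. ennreal ((cmod (pw F (\<Lambda> k)))\<^sup>2) * indicator {\<Lambda> k - R<..\<Lambda> k + R} x \<partial>count_space UNIV)"
        using fin by (intro nn_integral_count_space'[symmetric]) (auto simp: K_def indicator_def)
      finally show ?thesis by simp
    qed
    let ?S = "\<integral>\<^sup>+k. ennreal ((cmod (pw F (\<Lambda> k)))\<^sup>2) \<partial>count_space UNIV"
    let ?N = "ennreal ((L2_norm lborel F)\<^sup>2)"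
    have circle: "(\<integral>\<^sup>+x. (\<integral>\<^sup>+s\<in>{0..1}. ennreal ((cmod (pw F (complex_of_real x + ?z s)))\<^sup>2 * ?w s) \<partial>lborel) \<partial>lborel) \<le> ?N"
    proof -
      have "(\<integral>\<^sup>+x. (\<integral>\<^sup>+s\<in>{0..1}. ennreal ((cmod (pw F (complex_of_real x + ?z s)))\<^sup>2 * ?w s) \<partial>lborel) \<partial>lborel)
        = (\<integral>\<^sup>+s. \<integral>\<^sup>+x. ennreal ((cmod (pw F (complex_of_real x + ?z s)))\<^sup>2 * ?w s) * indicator {0..1} s \<partial>lborel \<partial>lborel)"
        by (rule lborel_pair.Fubini'[symmetric]) measurable
      also have "\<dots> \<le> (\<integral>\<^sup>+s. ?N * indicator {0..1::real} s \<partial>lborel)"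
      proof (rule nn_integral_mono)
        fix s :: real
        have "(\<integral>\<^sup>+x. ennreal ((cmod (pw F (complex_of_real x + ?z s)))\<^sup>2 * ?w s) * indicator {0..1} s \<partial>lborel)
          = (energy lborel (\<lambda>x. pw F (complex_of_real x + ?z s))) * (ennreal (?w s) * indicator {0..1} s)"
          by (subst nn_integral_multc[symmetric]) (auto simp: ennreal_mult mult_ac)
        also have "\<dots> \<le> ennreal (exp (2 * pi * W * \<bar>Im (?z s)\<bar>) * (L2_norm lborel F)\<^sup>2) * (ennreal (?w s) * indicator {0..1} s)"
          by (intro mult_right_mono nn_integral_pw_horizontal F) auto
        also have "\<dots> = ennreal (exp (2 * pi * W * \<bar>Im (?z s)\<bar>) * (L2_norm lborel F)\<^sup>2 * ?w s) * indicator {0..1} s"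
          by (simp add: ennreal_mult mult_ac)
        \<comment> \<open>Here
          \<open>\<bar>Im (?z s)\<bar> = R * \<bar>sin (2 * pi * s)\<bar>\<close>, so growth and
          weight cancel exactly.\<close>
        also have "exp (2 * pi * W * \<bar>Im (?z s)\<bar>) * (L2_norm lborel F)\<^sup>2 * ?w s = (L2_norm lborel F)\<^sup>2"
          using R by (simp add: abs_mult exp_minus mult_ac)
        finally show "(\<integral>\<^sup>+x. ennreal ((cmod (pw F (complex_of_real x + ?z s)))\<^sup>2 * ?w s) * indicator {0..1} s \<partial>lborel) \<le> ?N * indicator {0..1} s" .
      qed
      also have "\<dots> = ?N" by (simp add: nn_integral_cmult)
      finally show ?thesis .
    qed
    have nodes: "(\<integral>\<^sup>+x. \<integral>\<^sup>+k. ennreal ((cmod (pw F (\<Lambda> k)))\<^sup>2) * indicator {\<Lambda> k - R<..\<Lambda> k + R} x \<partial>count_space UNIV \<partial>lborel) = ennreal (2 * R) * ?S"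
    proof -
      have "(\<integral>\<^sup>+x. \<integral>\<^sup>+k. ennreal ((cmod (pw F (\<Lambda> k)))\<^sup>2) * indicator {\<Lambda> k - R<..\<Lambda> k + R} x \<partial>count_space UNIV \<partial>lborel)
        = (\<integral>\<^sup>+k. \<integral>\<^sup>+x. ennreal ((cmod (pw F (\<Lambda> k)))\<^sup>2) * indicator {\<Lambda> k - R<..\<Lambda> k + R} x \<partial>lborel \<partial>count_space UNIV)"
        by (rule nn_integral_count_space_nn_integral) auto
      also have "\<dots> = (\<integral>\<^sup>+k. ennreal (2 * R) * ennreal ((cmod (pw F (\<Lambda> k)))\<^sup>2) \<partial>count_space UNIV)"
        using R by (intro nn_integral_cong) (simp add: nn_integral_cmult mult.commute)
      finally show ?thesis by (simp add: nn_integral_cmult)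
    qed
    have "?N = energy lborel (\<lambda>x. pw F (complex_of_real x))"
      by (rule nn_integral_pw[OF F, symmetric])
    also have "\<dots> \<le> (\<integral>\<^sup>+x. ennreal (2 * \<theta>\<^sup>2) *
        (\<integral>\<^sup>+s\<in>{0..1}. ennreal ((cmod (pw F (complex_of_real x + ?z s)))\<^sup>2 * ?w s) \<partial>lborel)
      + ennreal C * (\<integral>\<^sup>+k. ennreal ((cmod (pw F (\<Lambda> k)))\<^sup>2) * indicator {\<Lambda> k - R<..\<Lambda> k + R} x \<partial>count_space UNIV) \<partial>lborel)"
      by (rule nn_integral_mono) (rule pointwise)
    also have "\<dots> = ennreal (2 * \<theta>\<^sup>2) *
        (\<integral>\<^sup>+x. (\<integral>\<^sup>+s\<in>{0..1}. ennreal ((cmod (pw F (complex_of_real x + ?z s)))\<^sup>2 * ?w s) \<partial>lborel) \<partial>lborel)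
      + ennreal C * (ennreal (2 * R) * ?S)"
      unfolding nodes[symmetric] by (simp add: nn_integral_add nn_integral_cmult)
    also have "\<dots> \<le> ennreal (2 * \<theta>\<^sup>2) * ?N + ennreal C * (ennreal (2 * R) * ?S)"
      by (intro add_right_mono mult_left_mono circle) auto
    finally have le: "?N \<le> ennreal (2 * \<theta>\<^sup>2) * ?N + ennreal C * (ennreal (2 * R) * ?S)" .
    show "?N \<le> ennreal (4 * R * C) * ?S"
    \<comment> \<open>Absorption subtracts real numbers, so the case of infinite sample energy,
      where the bound is trivial, is split off.\<close>
    proof (cases ?S)
      case (real S)
      define q where "q = 2 * \<theta>\<^sup>2"
      have "\<theta>\<^sup>2 \<le> (1 / 2)\<^sup>2" using \<theta> by (intro power_mono) auto
      then have q: "0 \<le> q" "q \<le> 1 / 2" by (auto simp: q_def power2_eq_square)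
      have "ennreal ((L2_norm lborel F)\<^sup>2) \<le> ennreal (q * (L2_norm lborel F)\<^sup>2 + C * (2 * R * S))"
        using le C R q real unfolding q_def[symmetric]
        by (simp add: ennreal_plus[symmetric] ennreal_mult[symmetric] del: ennreal_plus)
      then have "(L2_norm lborel F)\<^sup>2 \<le> q * (L2_norm lborel F)\<^sup>2 + C * (2 * R * S)"
        using C R real q by (subst (asm) ennreal_le_iff) auto
      moreover have "q * (L2_norm lborel F)\<^sup>2 \<le> 1 / 2 * (L2_norm lborel F)\<^sup>2"
        using q by (intro mult_right_mono) auto
      ultimately have "(L2_norm lborel F)\<^sup>2 \<le> (L2_norm lborel F)\<^sup>2 / 2 + C * (2 * R * S)" by simp
      then have "(L2_norm lborel F)\<^sup>2 \<le> 4 * R * C * S" by (simp add: field_simps)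
      then show ?thesis using real C R by (simp add: ennreal_mult[symmetric] ennreal_leI)
    next
      case top
      then show ?thesis using C R by (simp add: ennreal_mult_top)
    qed
  qed
qed


section \<open>The Blaschke product in terms of point counts\<close>

lemma prod_blocks_le:
  assumes "\<And>i. i < m \<Longrightarrow> finite (B i)" "\<And>i. i < m \<Longrightarrow> N \<le> card (B i)"
    and disj: "\<And>i j. i < m \<Longrightarrow> j < m \<Longrightarrow> i \<noteq> j \<Longrightarrow> B i \<inter> B j = {}"
    and d: "\<And>i k. i < m \<Longrightarrow> k \<in> B i \<Longrightarrow> 0 \<le> d k \<and> d k \<le> real (Suc i) / real m"
  shows "(\<Prod>k\<in>(\<Union>i<m. B i). d k) \<le> (fact m / real m ^ m) ^ N"
proof -
  have "(\<Prod>k\<in>(\<Union>i<m. B i). d k) = (\<Prod>i<m. \<Prod>k\<in>B i. d k)"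
    using assms by (intro prod.UNION_disjoint) auto
  also have "\<dots> \<le> (\<Prod>i<m. (real (Suc i) / real m) ^ N)"
  proof (intro prod_mono conjI)
    fix i assume i: "i \<in> {..<m}"
    have "(\<Prod>k\<in>B i. d k) \<le> (\<Prod>k\<in>B i. real (Suc i) / real m)"
      using d i by (intro prod_mono) auto
    also have "\<dots> = (real (Suc i) / real m) ^ card (B i)" by simp
    also have "\<dots> \<le> (real (Suc i) / real m) ^ N"
      using assms i by (intro power_decreasing) auto
    finally show "(\<Prod>k\<in>B i. d k) \<le> (real (Suc i) / real m) ^ N" .
    show "0 \<le> (\<Prod>k\<in>B i. d k)" using d i by (intro prod_nonneg) auto
  qed
  also have "\<dots> = (\<Prod>i<m. real (Suc i) / real m) ^ N" by (rule prod_power_distrib[symmetric])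
  also have "(\<Prod>i<m. real (Suc i) / real m) = fact m / real m ^ m"
    by (simp add: prod_dividef fact_prod_Suc atLeast0LessThan)
  finally show ?thesis .
qed

text \<open>Each side of \<open>x\<close> is cut into \<open>m\<close> cells of length
  \<open>h\<close> with at least \<open>N\<close> points each. Points of cell \<open>i\<close> have
  relative distance at most \<open>(i + 1) / m\<close>, and surplus points only contribute factors
  at most 1, so each side is bounded by \<open>(fact m / m ^ m) ^ N\<close>.\<close>

lemma prod_nodes_le:
  assumes fin: "\<And>a b. finite {k::int. \<Lambda> k \<in> {a..<b::real}}" and h: "h > 0" and m: "m > 0"
    and N: "\<And>y. N \<le> card {k. \<Lambda> k \<in> {y..<y + h}}"
  shows "(\<Prod>k | \<Lambda> k \<in> {x - real m * h..<x + real m * h}. \<bar>\<Lambda> k - x\<bar> / (real m * h)) \<le> ((fact m / real m ^ m) ^ N)\<^sup>2"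
proof -
  define d where "d k = \<bar>\<Lambda> k - x\<bar> / (real m * h)" for k
  define P where "P i = {k. \<Lambda> k \<in> {x + real i * h..<x + real i * h + h}}" for i :: nat
  define M where "M i = {k. \<Lambda> k \<in> {x - real (Suc i) * h..<x - real (Suc i) * h + h}}" for i :: nat
  have block: "j = i" if "real i \<le> t" "t < real (Suc i)" "real j \<le> t" "t < real (Suc j)" for i j t
    using that by linarith
  have P_iff: "k \<in> P i \<longleftrightarrow> real i \<le> (\<Lambda> k - x) / h \<and> (\<Lambda> k - x) / h < real (Suc i)" for k i
    using h by (auto simp: P_def field_simps)
  have M_iff: "k \<in> M i \<longleftrightarrow> real i < (x - \<Lambda> k) / h \<and> (x - \<Lambda> k) / h \<le> real (Suc i)" for k i
    using h by (auto simp: M_def field_simps)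
  have d_eq: "d k = \<bar>(\<Lambda> k - x) / h\<bar> / real m" for k
    using h by (simp add: d_def abs_divide field_simps)
  have UP: "(\<Union>i<m. P i) = {k. \<Lambda> k \<in> {x..<x + real m * h}}"
  proof (intro set_eqI iffI)
    fix k assume "k \<in> (\<Union>i<m. P i)"
    then obtain i where "i < m" "real i \<le> (\<Lambda> k - x) / h" "(\<Lambda> k - x) / h < real (Suc i)" by (auto simp: P_iff)
    then have "0 \<le> (\<Lambda> k - x) / h" "(\<Lambda> k - x) / h < real m" by linarith+
    then show "k \<in> {k. \<Lambda> k \<in> {x..<x + real m * h}}" using h by (auto simp: field_simps zero_le_divide_iff)
  next
    fix k assume "k \<in> {k. \<Lambda> k \<in> {x..<x + real m * h}}"
    then have "0 \<le> (\<Lambda> k - x) / h" "(\<Lambda> k - x) / h < real m" using h by (auto simp: field_simps)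
    then have "nat \<lfloor>(\<Lambda> k - x) / h\<rfloor> < m" "k \<in> P (nat \<lfloor>(\<Lambda> k - x) / h\<rfloor>)" unfolding P_iff by linarith+
    then show "k \<in> (\<Union>i<m. P i)" by auto
  qed
  have UM: "(\<Union>i<m. M i) = {k. \<Lambda> k \<in> {x - real m * h..<x}}"
  proof (intro set_eqI iffI)
    fix k assume "k \<in> (\<Union>i<m. M i)"
    then obtain i where "i < m" "real i < (x - \<Lambda> k) / h" "(x - \<Lambda> k) / h \<le> real (Suc i)" by (auto simp: M_iff)
    then have "0 < (x - \<Lambda> k) / h" "(x - \<Lambda> k) / h \<le> real m" by linarith+
    then show "k \<in> {k. \<Lambda> k \<in> {x - real m * h..<x}}" using h by (auto simp: field_simps zero_less_divide_iff)
  next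
    fix k assume "k \<in> {k. \<Lambda> k \<in> {x - real m * h..<x}}"
    then have "0 < (x - \<Lambda> k) / h" "(x - \<Lambda> k) / h \<le> real m" using h by (auto simp: field_simps)
    \<comment> \<open>Left cells contain their far end and not their near one, so the cell index is
      the ceiling minus 1 rather than the floor.\<close>
    then have "nat (\<lceil>(x - \<Lambda> k) / h\<rceil> - 1) < m" "k \<in> M (nat (\<lceil>(x - \<Lambda> k) / h\<rceil> - 1))" unfolding M_iff by linarith+
    then show "k \<in> (\<Union>i<m. M i)" by auto
  qed
  have "{k. \<Lambda> k \<in> {x - real m * h..<x + real m * h}} = (\<Union>i<m. M i) \<union> (\<Union>i<m. P i)"
  proof -
    have "0 < real m * h" using h m by simp
    then show ?thesis unfolding UP UM by auto
  qed
  moreover have "(\<Union>i<m. M i) \<inter> (\<Union>i<m. P i) = {}" unfolding UP UM by auto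
  moreover have "finite (\<Union>i<m. M i)" "finite (\<Union>i<m. P i)" unfolding UP UM by (rule fin)+
  ultimately have "(\<Prod>k | \<Lambda> k \<in> {x - real m * h..<x + real m * h}. d k) = (\<Prod>k\<in>(\<Union>i<m. M i). d k) * (\<Prod>k\<in>(\<Union>i<m. P i). d k)"
    by (simp add: prod.union_disjoint)
  also have "\<dots> \<le> (fact m / real m ^ m) ^ N * (fact m / real m ^ m) ^ N"
  proof (rule mult_mono)
    show "(\<Prod>k\<in>(\<Union>i<m. P i). d k) \<le> (fact m / real m ^ m) ^ N"
    proof (rule prod_blocks_le)
      show "finite (P i)" for i unfolding P_def by (rule fin)
      show "N \<le> card (P i)" for i unfolding P_def by (rule N)
      show "P i \<inter> P j = {}" if "i \<noteq> j" for i j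
        using that block by (auto simp: P_iff)
      show "0 \<le> d k \<and> d k \<le> real (Suc i) / real m" if "k \<in> P i" for i k
        using that unfolding P_iff d_eq by (intro conjI divide_right_mono) auto
    qed
    show "(\<Prod>k\<in>(\<Union>i<m. M i). d k) \<le> (fact m / real m ^ m) ^ N"
    proof (rule prod_blocks_le)
      show "finite (M i)" for i unfolding M_def by (rule fin)
      show "N \<le> card (M i)" for i unfolding M_def by (rule N)
      show "M i \<inter> M j = {}" if "i \<noteq> j" for i j
        using that by (auto simp: M_iff)
      show "0 \<le> d k \<and> d k \<le> real (Suc i) / real m" if "k \<in> M i" for i k
      proof -
        have "(\<Lambda> k - x) / h = - ((x - \<Lambda> k) / h)" by (simp add: diff_divide_distrib)
        then show ?thesis
          using that unfolding M_iff d_eq by (intro conjI divide_right_mono) auto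
      qed
    qed
  qed (auto intro!: prod_nonneg simp: d_def h less_imp_le)
  finally show ?thesis by (simp add: d_def power2_eq_square)
qed

text \<open>A form of Stirling's bound, with a polynomial factor that exponential decay will absorb.
  In the induction, \<open>ln (1 + 1 / m) \<ge> 1 / (m + 1)\<close> says that
  \<open>(m / (m + 1)) ^ (m + 1)\<close> is at most \<open>exp (- 1)\<close>.\<close>

lemma fact_upper_bound:
  assumes "m > 0"
  shows "fact m / real m ^ m \<le> exp 1 * real m * exp (- real m)"
  using assms
proof (induction m rule: nat_induct_non_zero)
  case (Suc m)
  have "1 / real (Suc m) \<le> ln (1 + 1 / real m)"
  proof -
    have "ln (real m / real (Suc m)) \<le> real m / real (Suc m) - 1"
      using Suc.hyps by (intro ln_le_minus_one) auto
    also have "\<dots> = - (1 / real (Suc m))" by (simp add: field_simps)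
    finally show ?thesis using Suc.hyps by (simp add: ln_div field_simps)
  qed
  then have "1 \<le> real (Suc m) * ln (1 + 1 / real m)" by (simp add: field_simps)
  then have "exp 1 \<le> exp (real (Suc m) * ln (1 + 1 / real m))" by simp
  also have "\<dots> = (1 + 1 / real m) ^ Suc m"
    using Suc.hyps by (subst exp_of_nat_mult) (auto simp: add_pos_pos)
  also have "1 + 1 / real m = real (Suc m) / real m"
    using Suc.hyps by (simp add: field_simps)
  finally have "inverse ((real (Suc m) / real m) ^ Suc m) \<le> inverse (exp 1)"
    by (intro le_imp_inverse_le) auto
  then have ratio: "real m ^ Suc m / real (Suc m) ^ Suc m \<le> exp (- 1)"
    by (simp only: exp_minus power_divide inverse_divide)
  define S P where "S = real (Suc m)" and "P = S ^ Suc m"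
  have nz: "S > 0" "P > 0" "real m > 0" using Suc.hyps by (auto simp: S_def P_def)
  have "fact (Suc m) / real (Suc m) ^ Suc m = (fact m / real m ^ m) * (S / real m) * (real m ^ Suc m / P)"
  proof -
    have "fact (Suc m) = S * fact m" "real m ^ Suc m = real m * real m ^ m" by (simp_all add: S_def)
    moreover have "real (Suc m) ^ Suc m = P" by (simp add: S_def P_def)
    ultimately show ?thesis using nz by simp
  qed
  also have "\<dots> \<le> (exp 1 * real m * exp (- real m)) * (S / real m) * exp (- 1)"
    using nz ratio by (intro mult_mono Suc.IH order_refl) (auto simp: S_def P_def)
  also have "\<dots> = exp 1 * S * (exp (- real m) * exp (- 1))" using nz by simp
  also have "exp (- real m) * exp (- 1) = exp (- S)" by (simp add: exp_add[symmetric] S_def)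
  finally show ?case by (simp add: S_def)
qed (simp add: exp_minus)

text \<open>Up to the polynomial factor \<open>(exp 1 * m) ^ (2 * N)\<close> the expression is at
  most \<open>exp (- (2 * m * (N - W * h)))\<close>, and this decays because the count exceeds
  \<open>W * h\<close>. The radius of the disc will be \<open>m * h\<close>.\<close>

lemma exists_small_density_factor:
  assumes "W * h < real N" "W \<ge> 0" "h > 0"
  shows "\<exists>m>0. exp (2 * W * (real m * h)) * ((fact m / real m ^ m) ^ N)\<^sup>2 \<le> 1 / 2"
proof -
  define c where "c = real N - W * h"
  have c: "c > 0" using assms by (simp add: c_def)
  have "(\<lambda>m::nat. ((exp 1 * real m) ^ N * exp (- (c * real m)))\<^sup>2) \<longlonglongrightarrow> 0" 
    using c by real_asymp
  then have "eventually (\<lambda>m::nat. ((exp 1 * real m) ^ N * exp (- (c * real m)))\<^sup>2 < 1 / 2) sequentially"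
    by (rule order_tendstoD) simp
  then have "eventually (\<lambda>m::nat. ((exp 1 * real m) ^ N * exp (- (c * real m)))\<^sup>2 < 1 / 2 \<and> m > 0) sequentially"
    using eventually_gt_at_top[of 0] by (rule eventually_conj)
  then obtain m :: nat where m: "((exp 1 * real m) ^ N * exp (- (c * real m)))\<^sup>2 < 1 / 2" "m > 0"
    using eventually_happens by force
  have "exp (2 * W * (real m * h)) * ((fact m / real m ^ m) ^ N)\<^sup>2 \<le> exp (2 * W * (real m * h)) * ((exp 1 * real m * exp (- real m)) ^ N)\<^sup>2"
    by (intro mult_left_mono power_mono fact_upper_bound m) auto
  also have "\<dots> = (exp (W * (real m * h)) * (exp 1 * real m) ^ N * exp (- real m) ^ N)\<^sup>2"
    by (simp add: power_mult_distrib exp_double[symmetric] mult_ac)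
  also have "exp (- real m) ^ N = exp (- (real N * real m))"
    by (simp add: exp_of_nat_mult[symmetric])
  also have "exp (W * (real m * h)) * (exp 1 * real m) ^ N * exp (- (real N * real m)) = (exp 1 * real m) ^ N * exp (- (c * real m))"
    by (simp add: c_def exp_add[symmetric] exp_diff exp_minus field_simps left_diff_distrib)
  finally show ?thesis using m by (intro exI[of _ m]) auto
qed

theorem sampling_lower_bound:
  assumes sep: "separated \<delta> \<Lambda>" and W: "W \<ge> 0" and h: "h > 0" and N: "W * h < real N"
    and count: "\<And>y. N \<le> card {k. \<Lambda> k \<in> {y..<y + h}}"
  shows "\<exists>C>0. \<forall>F. bandlimited W F \<longrightarrow>
    ennreal ((L2_norm lborel F)\<^sup>2) \<le> ennreal C * sample_energy \<Lambda> F"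
proof -
  obtain m where m: "m > 0" "exp (2 * W * (real m * h)) * ((fact m / real m ^ m) ^ N)\<^sup>2 \<le> 1 / 2"
    using exists_small_density_factor[OF N W h] by blast
  show ?thesis
  proof (rule sampling_lower_bound_aux[where \<theta>="1 / 2", OF sep _ W])
    show "real m * h > 0" using m h by simp
    show "exp (2 * W * (real m * h)) * (\<Prod>k | \<Lambda> k \<in> {x - real m * h..<x + real m * h}. \<bar>\<Lambda> k - x\<bar> / (real m * h)) \<le> 1 / 2" for x
    proof -
      have "(\<Prod>k | \<Lambda> k \<in> {x - real m * h..<x + real m * h}. \<bar>\<Lambda> k - x\<bar> / (real m * h)) \<le> ((fact m / real m ^ m) ^ N)\<^sup>2"
        by (rule prod_nodes_le[OF separated_finite(1)[OF sep] h m(1) count])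
      then have "exp (2 * W * (real m * h)) * (\<Prod>k | \<Lambda> k \<in> {x - real m * h..<x + real m * h}. \<bar>\<Lambda> k - x\<bar> / (real m * h))
        \<le> exp (2 * W * (real m * h)) * ((fact m / real m ^ m) ^ N)\<^sup>2" by (rule mult_left_mono) simp
      then show ?thesis using m(2) by (rule order_trans)
    qed
  qed auto
qed

section \<open>The upper bound for the samples\<close>

lemma nn_integral_disjoint_intervals_le:
  assumes sep: "separated \<delta> \<Lambda>" and d: "d \<le> \<delta>" and [measurable]: "g \<in> borel_measurable borel"
  shows "(\<integral>\<^sup>+k. (\<integral>\<^sup>+y. g y * indicator {\<Lambda> k..<\<Lambda> k + d} y \<partial>lborel) \<partial>count_space UNIV) \<le> (\<integral>\<^sup>+y. g y \<partial>lborel)"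
proof -
  have "(\<integral>\<^sup>+k. (\<integral>\<^sup>+y. g y * indicator {\<Lambda> k..<\<Lambda> k + d} y \<partial>lborel) \<partial>count_space UNIV)
    = (\<integral>\<^sup>+y. \<integral>\<^sup>+k. g y * indicator {\<Lambda> k..<\<Lambda> k + d} y \<partial>count_space UNIV \<partial>lborel)"
    by (rule nn_integral_count_space_nn_integral[symmetric]) auto
  also have "\<dots> \<le> (\<integral>\<^sup>+y. g y \<partial>lborel)"
  proof (rule nn_integral_mono)
    fix y :: real
    show "(\<integral>\<^sup>+k. g y * indicator {\<Lambda> k..<\<Lambda> k + d} y \<partial>count_space UNIV) \<le> g y"
    proof (cases "\<exists>k. y \<in> {\<Lambda> k..<\<Lambda> k + d}")
      case True
      then obtain k where k: "y \<in> {\<Lambda> k..<\<Lambda> k + d}" by blast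
      have "y \<notin> {\<Lambda> j..<\<Lambda> j + d}" if "j \<noteq> k" for j
        using separated_dist[OF sep that] k d by auto
      then have "(\<integral>\<^sup>+k. g y * indicator {\<Lambda> k..<\<Lambda> k + d} y \<partial>count_space UNIV) = (\<Sum>j\<in>{k}. g y * indicator {\<Lambda> j..<\<Lambda> j + d} y)"
        by (intro nn_integral_count_space') auto
      also have "\<dots> \<le> g y" using k by simp
      finally show ?thesis .
    next
      case False
      then have "(\<integral>\<^sup>+k. g y * indicator {\<Lambda> k..<\<Lambda> k + d} y \<partial>count_space UNIV) = (\<integral>\<^sup>+(k::int). 0 \<partial>count_space UNIV)"
        by (intro nn_integral_cong) auto
      then show ?thesis by simp
    qed
  qed
  finally show ?thesis .
qed

text \<open>
  Dividing \<open>F\<close> by this multiplier exhibits \<open>f\<close> as a local average of another band-limited function,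
  so that the samples of \<open>f\<close> are bounded by its integrals over disjoint intervals.
\<close>

definition box_multiplier :: "real \<Rightarrow> real \<Rightarrow> complex" where
  "box_multiplier d \<nu> = (LINT s|lborel. complex_of_real (indicator {0..<d} s / d) * cis (2 * pi * s * \<nu>))"

lemma integrable_indicator_Ico [simp]: "integrable lborel (\<lambda>s::real. indicator {a..<b} s :: real)"
  by (cases "a \<le> b") auto

text \<open>For \<open>s\<close> in \<open>{0..<d}\<close> the phase stays within
  \<open>pi / 3\<close> of 0, so the real part of the average is at least
  \<open>cos (pi / 3)\<close>.\<close>

lemma norm_box_multiplier_ge:
  assumes d: "d > 0" and \<nu>: "2 * d * \<bar>\<nu>\<bar> \<le> 1 / 3"
  shows "1 / 2 \<le> cmod (box_multiplier d \<nu>)"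
proof -
  have int: "integrable lborel (\<lambda>s. complex_of_real (indicator {0..<d} s / d) * cis (2 * pi * s * \<nu>))"
    using d by (intro integrable_mult_cis) (auto simp del: of_real_divide)
  have cos: "1 / 2 \<le> cos (2 * pi * s * \<nu>)" if s: "s \<in> {0..<d}" for s
  proof -
    have "\<bar>2 * pi * s * \<nu>\<bar> = pi * (2 * s * \<bar>\<nu>\<bar>)" using s by (simp add: abs_mult)
    also have "\<dots> \<le> pi * (2 * d * \<bar>\<nu>\<bar>)" using s by (intro mult_left_mono mult_right_mono) auto
    also have "\<dots> \<le> pi * (1 / 3)" using \<nu> by (intro mult_left_mono) auto
    finally have "cos (pi / 3) \<le> cos \<bar>2 * pi * s * \<nu>\<bar>"
      by (intro cos_monotone_0_pi_le) auto
    then show ?thesis by (simp add: cos_60)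
  qed
  have "1 / 2 = (LINT s|lborel. indicator {0..<d} s * (1 / (2 * d)))"
    using d by simp
  also have "\<dots> \<le> (LINT s|lborel. Re (complex_of_real (indicator {0..<d} s / d) * cis (2 * pi * s * \<nu>)))"
  proof (rule integral_mono)
    fix s
    show "indicator {0..<d} s * (1 / (2 * d)) \<le> Re (complex_of_real (indicator {0..<d} s / d) * cis (2 * pi * s * \<nu>))"
      using cos[of s] d by (auto simp: indicator_def field_simps)
    show "integrable lborel (\<lambda>s. Re (complex_of_real (indicator {0..<d} s / d) * cis (2 * pi * s * \<nu>)))"
      by (rule integrable_Re[OF int])
  qed simp
  also have "\<dots> = Re (box_multiplier d \<nu>)"
    unfolding box_multiplier_def by (rule integral_Re[OF int])
  also have "\<dots> \<le> cmod (box_multiplier d \<nu>)" by (rule complex_Re_le_cmod)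
  finally show ?thesis .
qed

lemma pw_box_average:
  assumes F: "integrable lborel F" and d: "d > 0"
  shows "(LINT \<nu>|lborel. F \<nu> * box_multiplier d \<nu> * cis (2 * pi * x * \<nu>))
    = (LINT s|lborel. complex_of_real (indicator {0..<d} s / d) * inv_fourier F (x + s))"
proof -
  let ?b = "\<lambda>s. complex_of_real (indicator {0..<d} s / d)"
  let ?H = "\<lambda>s \<nu>. ?b s * F \<nu> * cis (2 * pi * (x + s) * \<nu>)"
  have [measurable]: "F \<in> borel_measurable lborel" using F by simp
  have "integrable (lborel \<Otimes>\<^sub>M lborel) (\<lambda>(s, \<nu>). ?b s * F \<nu> * (\<lambda>(s, \<nu>). cis (2 * pi * (x + s) * \<nu>)) (s, \<nu>))"
    by (rule integrable_pair_mult[where C=1]) (use F d in \<open>auto simp del: of_real_divide\<close>)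
  then have int: "integrable (lborel \<Otimes>\<^sub>M lborel) (\<lambda>(s, \<nu>). ?H s \<nu>)" by simp
  have "(LINT \<nu>|lborel. F \<nu> * box_multiplier d \<nu> * cis (2 * pi * x * \<nu>)) = (LINT \<nu>|lborel. LINT s|lborel. ?H s \<nu>)"
  proof (rule Bochner_Integration.integral_cong)
    fix \<nu>
    have "F \<nu> * box_multiplier d \<nu> * cis (2 * pi * x * \<nu>) = (F \<nu> * cis (2 * pi * x * \<nu>)) * box_multiplier d \<nu>"
      by (simp only: mult_ac)
    also have "\<dots> = (LINT s|lborel. (F \<nu> * cis (2 * pi * x * \<nu>)) * (?b s * cis (2 * pi * s * \<nu>)))"
      unfolding box_multiplier_def by (rule integral_mult_right_zero[symmetric])
    also have "\<dots> = (LINT s|lborel. ?H s \<nu>)"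
    proof (rule Bochner_Integration.integral_cong)
      fix s
      have "cis (2 * pi * x * \<nu>) * cis (2 * pi * s * \<nu>) = cis (2 * pi * (x + s) * \<nu>)"
        by (simp add: cis_mult algebra_simps)
      then show "(F \<nu> * cis (2 * pi * x * \<nu>)) * (?b s * cis (2 * pi * s * \<nu>)) = ?H s \<nu>"
        by (simp only: mult_ac)
    qed simp
    finally show "F \<nu> * box_multiplier d \<nu> * cis (2 * pi * x * \<nu>) = (LINT s|lborel. ?H s \<nu>)" .
  qed simp
  also have "\<dots> = (LINT s|lborel. LINT \<nu>|lborel. ?H s \<nu>)"
    by (rule lborel_pair.Fubini_integral[OF int])
  also have "\<dots> = (LINT s|lborel. ?b s * inv_fourier F (x + s))"
    unfolding inv_fourier_def by (simp only: mult.assoc integral_mult_right_zero)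
  finally show ?thesis .
qed

lemma box_average_sq_le:
  assumes g: "g \<in> borel_measurable borel" and d: "d > 0"
  shows "ennreal ((cmod (LINT s|lborel. complex_of_real (indicator {0..<d} s / d) * g (x + s)))\<^sup>2)
    \<le> ennreal (1 / d) * (\<integral>\<^sup>+y. ennreal ((cmod (g y))\<^sup>2) * indicator {x..<x + d} y \<partial>lborel)"
proof -
  note g[measurable]
  let ?G = "\<lambda>y. ennreal (cmod (g y))"
  have "ennreal (cmod (LINT s|lborel. complex_of_real (indicator {0..<d} s / d) * g (x + s)))
    \<le> (\<integral>\<^sup>+s. ennreal (cmod (complex_of_real (indicator {0..<d} s / d) * g (x + s))) \<partial>lborel)"
    by (rule norm_integral_le_nn_integral)
  also have "\<dots> = (\<integral>\<^sup>+s. (?G (x + s) * indicator {0..<d} s) * (ennreal (1 / d) * indicator {0..<d} s) \<partial>lborel)"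
    using d by (intro nn_integral_cong) (auto simp: indicator_def norm_divide ennreal_mult[symmetric])
  finally have "(ennreal (cmod (LINT s|lborel. complex_of_real (indicator {0..<d} s / d) * g (x + s))))\<^sup>2
    \<le> (\<integral>\<^sup>+s. (?G (x + s) * indicator {0..<d} s) * (ennreal (1 / d) * indicator {0..<d} s) \<partial>lborel)\<^sup>2"
    by (rule power_mono) simp
  also have "\<dots> \<le> (\<integral>\<^sup>+s. (?G (x + s) * indicator {0..<d} s)\<^sup>2 \<partial>lborel) * (\<integral>\<^sup>+s. (ennreal (1 / d) * indicator {0..<d} s)\<^sup>2 \<partial>lborel)"
    by (rule Cauchy_Schwarz_nn_integral) measurable
  also have "(\<integral>\<^sup>+s. (ennreal (1 / d) * indicator {0..<d} s)\<^sup>2 \<partial>lborel) = (\<integral>\<^sup>+s. ennreal ((1 / d)\<^sup>2) * indicator {0..<d} s \<partial>lborel)"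
    using d by (intro nn_integral_cong) (auto simp: indicator_def ennreal_power)
  also have "\<dots> = ennreal (1 / d)"
    using d by (simp add: nn_integral_cmult ennreal_mult[symmetric] power2_eq_square)
  also have "(\<integral>\<^sup>+s. (?G (x + s) * indicator {0..<d} s)\<^sup>2 \<partial>lborel) = (\<integral>\<^sup>+s. ennreal ((cmod (g (x + 1 * s)))\<^sup>2) * indicator {x..<x + d} (x + 1 * s) \<partial>lborel)"
    by (intro nn_integral_cong) (auto simp: indicator_def ennreal_power)
  also have "\<dots> = (\<integral>\<^sup>+y. ennreal ((cmod (g y))\<^sup>2) * indicator {x..<x + d} y \<partial>lborel)"
    by (subst nn_integral_real_affine[of _ 1 x]) auto
  finally show ?thesis by (simp add: ennreal_power mult.commute)
qed

theorem sampling_upper_bound: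
  assumes sep: "separated \<delta> \<Lambda>" and W: "W \<ge> 0"
  shows "\<exists>C>0. \<forall>F. bandlimited W F \<longrightarrow>
    sample_energy \<Lambda> F \<le> ennreal C * ennreal ((L2_norm lborel F)\<^sup>2)"
proof -
  have \<delta>: "\<delta> > 0" using sep by (simp add: separated_def)
  \<comment> \<open>Small enough for the intervals at the sampling points to be disjoint and for
    \<open>box_multiplier d\<close> to stay away from 0 on the band; \<open>W + 1\<close> covers the
    case \<open>W = 0\<close>.\<close>
  define d where "d = min \<delta> (1 / (3 * (W + 1)))"
  have d: "d > 0" "d \<le> \<delta>" using \<delta> W by (auto simp: d_def)
  have dW: "d * W \<le> 1 / 3"
  proof -
    have "d * W \<le> (1 / (3 * (W + 1))) * (W + 1)" using W by (intro mult_mono) (auto simp: d_def)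
    also have "\<dots> = 1 / 3" using W by (simp add: divide_simps)
    finally show ?thesis .
  qed
  let ?m = "box_multiplier d"
  have [measurable]: "?m \<in> borel_measurable borel" unfolding box_multiplier_def by measurable
  have m: "1 / 2 \<le> cmod (?m \<nu>)" if "\<bar>\<nu>\<bar> \<le> W / 2" for \<nu>
  proof (rule norm_box_multiplier_ge[OF d(1)])
    have "2 * d * \<bar>\<nu>\<bar> \<le> 2 * d * (W / 2)" using that d by (intro mult_left_mono) auto
    with dW show "2 * d * \<bar>\<nu>\<bar> \<le> 1 / 3" by simp
  qed
  show ?thesis
  \<comment> \<open>\<open>1 / d\<close> comes from Cauchy-Schwarz over an interval of length
    \<open>d\<close>, and 4 from dividing \<open>F\<close> by a multiplier of modulus at least
    1/2.\<close>
  proof (intro exI[of _ "4 / d"] conjI allI impI)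
    show "4 / d > 0" using d by simp
    fix F assume F: "bandlimited W F"
    note bandlimitedD(2)[OF F, measurable]
    define G where "G \<nu> = (if \<bar>\<nu>\<bar> \<le> W / 2 then F \<nu> / ?m \<nu> else 0)" for \<nu>
    have [measurable]: "G \<in> borel_measurable lborel" unfolding G_def by measurable
    have G_le: "(cmod (G \<nu>))\<^sup>2 \<le> 4 * (cmod (F \<nu>))\<^sup>2" for \<nu>
    proof (cases "\<bar>\<nu>\<bar> \<le> W / 2")
      case True
      have "cmod (G \<nu>) = cmod (F \<nu>) / cmod (?m \<nu>)" using True by (simp add: G_def norm_divide)
      also have "\<dots> \<le> cmod (F \<nu>) / (1 / 2)" using m[OF True] by (intro divide_left_mono) auto
      finally have "(cmod (G \<nu>))\<^sup>2 \<le> (2 * cmod (F \<nu>))\<^sup>2" by (intro power_mono) auto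
      then show ?thesis by (simp add: power_mult_distrib)
    qed (simp add: G_def)
    have int: "integrable lborel (\<lambda>\<nu>. 4 * (cmod (F \<nu>))\<^sup>2)"
      using bandlimitedD(1)[OF F] by (simp add: square_integrable_def)
    have G: "bandlimited W G"
      unfolding bandlimited_def
    proof
      show "square_integrable lborel G"
        by (rule square_integrable_bound[OF int _ AE_I2[OF G_le]]) measurable
      show "AE \<nu> in lborel. W / 2 < \<bar>\<nu>\<bar> \<longrightarrow> G \<nu> = 0" by (auto simp: G_def)
    qed
    have norm: "(L2_norm lborel G)\<^sup>2 \<le> 4 * (L2_norm lborel F)\<^sup>2"
    proof -
      have "(L2_norm lborel G)\<^sup>2 \<le> (LINT \<nu>|lborel. 4 * (cmod (F \<nu>))\<^sup>2)"
        unfolding L2_norm_sq using bandlimitedD(1)[OF G] int G_le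
        by (intro integral_mono) (auto simp: square_integrable_def)
      then show ?thesis by (simp add: L2_norm_sq)
    qed
    have avg: "pw F (complex_of_real x) = (LINT s|lborel. complex_of_real (indicator {0..<d} s / d) * inv_fourier G (x + s))" for x
    proof -
      have "pw F (complex_of_real x) = (LINT \<nu>|lborel. G \<nu> * ?m \<nu> * cis (2 * pi * x * \<nu>))"
        unfolding pw_of_real inv_fourier_def
      proof (rule integral_cong_AE)
        show "AE \<nu> in lborel. F \<nu> * cis (2 * pi * x * \<nu>) = G \<nu> * ?m \<nu> * cis (2 * pi * x * \<nu>)"
          using bandlimitedD(4)[OF F]
        proof eventually_elim
          case (elim \<nu>)
          show ?case
          proof (cases "\<bar>\<nu>\<bar> \<le> W / 2")
            case True
            then have "?m \<nu> \<noteq> 0" using m[OF True] by auto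
            then show ?thesis using True by (simp add: G_def)
          qed (use elim in \<open>simp add: G_def\<close>)
        qed
      qed measurable
      then show ?thesis using pw_box_average[OF bandlimitedD(3)[OF G] d(1)] by simp
    qed
    have [measurable]: "inv_fourier G \<in> borel_measurable borel"
      using borel_measurable_inv_fourier[of G] by simp
    have "sample_energy \<Lambda> F
      \<le> (\<integral>\<^sup>+k. ennreal (1 / d) * (\<integral>\<^sup>+y. ennreal ((cmod (inv_fourier G y))\<^sup>2) * indicator {\<Lambda> k..<\<Lambda> k + d} y \<partial>lborel) \<partial>count_space UNIV)"
      unfolding avg by (intro nn_integral_mono box_average_sq_le d) measurable
    also have "\<dots> = ennreal (1 / d) * (\<integral>\<^sup>+k. (\<integral>\<^sup>+y. ennreal ((cmod (inv_fourier G y))\<^sup>2) * indicator {\<Lambda> k..<\<Lambda> k + d} y \<partial>lborel) \<partial>count_space UNIV)"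
      by (rule nn_integral_cmult) simp
    also have "\<dots> \<le> ennreal (1 / d) * (energy lborel (inv_fourier G))"
      by (intro mult_left_mono nn_integral_disjoint_intervals_le[OF sep d(2)]) auto
    also have "\<dots> = ennreal (1 / d) * ennreal ((L2_norm lborel G)\<^sup>2)"
      using nn_integral_pw[OF G] by (simp add: pw_of_real)
    also have "\<dots> \<le> ennreal (1 / d) * ennreal (4 * (L2_norm lborel F)\<^sup>2)"
      by (intro mult_left_mono ennreal_leI norm) auto
    also have "\<dots> = ennreal (4 / d) * ennreal ((L2_norm lborel F)\<^sup>2)"
      using d by (simp add: ennreal_mult[symmetric])
    finally show "sample_energy \<Lambda> F \<le> ennreal (4 / d) * ennreal ((L2_norm lborel F)\<^sup>2)" .
  qed
qed

subsection \<open>Kernels, spreading functions and delta trains\<close>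

lemma AE_lborel_affine:
  assumes "AE t in lborel. P (t::real)" and c: "c \<noteq> 0"
  shows "AE x in lborel. P (a + c * x)"
proof -
  obtain N where N: "\<And>t. t \<in> space lborel - N \<Longrightarrow> P t" "N \<in> null_sets lborel"
    using AE_E3[OF assms(1)] by blast
  have [measurable]: "N \<in> sets borel" using N by auto
  have "AE x in lborel. a + c * x \<notin> N"
    by (rule AE_borel_affine[OF c _ AE_not_in[OF N(2)]]) measurable
  then show ?thesis using N(1) by (auto elim!: eventually_mono)
qed

text \<open>The shear from \<open>(x, y)\<close> to \<open>(x - y, x)\<close> preserves null sets by
  Fubini. Through it, equality of kernels almost everywhere in the plane becomes equality of impulse
  responses for almost every \<open>t\<close>.\<close>

lemma AE_lborel_pair_shear:
  assumes "AE z in (lborel :: (real \<times> real) measure). P z"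
  shows "AE t in lborel. AE x in lborel. P (x, x - t)"
proof -
  obtain N where N: "\<And>z. z \<in> space lborel - N \<Longrightarrow> P z" "N \<in> null_sets lborel"
    using AE_E3[OF assms] by blast
  have [measurable]: "N \<in> sets (borel \<Otimes>\<^sub>M borel)" unfolding borel_prod using N(2) by auto
  have "AE z in lborel \<Otimes>\<^sub>M lborel. z \<notin> N" unfolding lborel_prod using N(2) by (rule AE_not_in)
  then have "AE x in lborel. AE y in lborel. (x, y) \<notin> N" by (rule lborel_pair.AE_pair)
  then have "AE x in lborel. AE t in lborel. (x, x - t) \<notin> N"
  proof eventually_elim
    case (elim x)
    then show ?case using AE_lborel_affine[of "\<lambda>y. (x, y) \<notin> N" "-1" x] by simp
  qed
  moreover have "{z \<in> space (lborel \<Otimes>\<^sub>M lborel). (fst z, fst z - snd z) \<notin> N} \<in> sets (lborel \<Otimes>\<^sub>M lborel)"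
    by measurable
  ultimately have "AE t in lborel. AE x in lborel. (x, x - t) \<notin> N"
    using lborel_pair.AE_commute[of "\<lambda>x t. (x, x - t) \<notin> N"] by simp
  then show ?thesis using N(1) by (auto elim!: eventually_mono)
qed

lemma nn_integral_lborel_pair_shear:
  assumes "g \<in> borel_measurable (lborel :: (real \<times> real) measure)"
  shows "(\<integral>\<^sup>+z. g z \<partial>lborel) = (\<integral>\<^sup>+t. (\<integral>\<^sup>+x. g (x, x - t) \<partial>lborel) \<partial>lborel)"
proof -
  have [measurable]: "g \<in> borel_measurable (borel \<Otimes>\<^sub>M borel)" using assms by (simp add: borel_prod)
  have "(\<integral>\<^sup>+z. g z \<partial>lborel) = (\<integral>\<^sup>+x. (\<integral>\<^sup>+y. g (x, y) \<partial>lborel) \<partial>lborel)"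
    by (subst lborel_prod[symmetric], subst lborel.nn_integral_fst[symmetric]) auto
  also have "\<dots> = (\<integral>\<^sup>+x. (\<integral>\<^sup>+t. g (x, x - t) \<partial>lborel) \<partial>lborel)"
  proof (rule nn_integral_cong)
    fix x :: real
    show "(\<integral>\<^sup>+y. g (x, y) \<partial>lborel) = (\<integral>\<^sup>+t. g (x, x - t) \<partial>lborel)"
      using nn_integral_real_affine[of "\<lambda>y. g (x, y)" "-1" x] by simp
  qed
  also have "\<dots> = (\<integral>\<^sup>+t. (\<integral>\<^sup>+x. g (x, x - t) \<partial>lborel) \<partial>lborel)"
    by (rule lborel_pair.Fubini'[symmetric]) measurable
  finally show ?thesis .
qed

lemma square_integrable_lborel_pair_sections:
  assumes "square_integrable (lborel :: (real \<times> real) measure) \<kappa>"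
  shows "AE x in lborel. square_integrable lborel (\<lambda>y. \<kappa> (x, y))"
proof -
  have [measurable]: "\<kappa> \<in> borel_measurable (borel \<Otimes>\<^sub>M borel)"
    using assms by (simp add: square_integrable_def borel_prod)
  have "(\<integral>\<^sup>+x. (energy lborel (\<lambda>y. \<kappa> (x, y))) \<partial>lborel) = energy lborel \<kappa>"
    by (subst lborel_prod[symmetric], subst lborel.nn_integral_fst[symmetric]) auto
  also have "\<dots> < \<infinity>"
    using assms square_integrable_iff_nn_integral[of \<kappa> lborel] by (simp add: square_integrable_def)
  finally have "AE x in lborel. (energy lborel (\<lambda>y. \<kappa> (x, y))) \<noteq> \<infinity>"
    by (intro nn_integral_PInf_AE) auto
  then show ?thesis
    by eventually_elim (simp add: square_integrable_iff_nn_integral less_top)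
qed

lemma AE_fourier_zero_imp_AE_zero:
  assumes g: "integrable lborel g" "square_integrable lborel g"
    and zero: "AE \<nu> in lborel. fourier g \<nu> = 0"
  shows "AE x in lborel. g x = 0"
proof -
  have "L2_norm lborel (fourier g) = L2_norm lborel (\<lambda>_::real. 0)"
    using zero g by (intro L2_norm_cong_AE) auto
  then have "L2_norm lborel g = 0" using plancherel[OF g] by (simp add: L2_norm_def)
  then show ?thesis by (rule AE_eq_0_if_L2_norm_0[OF g(2)])
qed

text \<open>
  Testing against truncated exponentials shows that almost every section of the difference of the
  kernels has Fourier transform zero.
\<close>

lemma has_kernel_unique:
  assumes 1: "has_kernel H \<kappa>" and 2: "has_kernel H \<kappa>'"
  shows "AE z in lborel. \<kappa> z = \<kappa>' z"
proof -
  have \<kappa>: "square_integrable lborel \<kappa>" "square_integrable lborel \<kappa>'"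
    using 1 2 by (auto simp: has_kernel_def)
  have [measurable]: "\<kappa> \<in> borel_measurable (borel \<Otimes>\<^sub>M borel)" "\<kappa>' \<in> borel_measurable (borel \<Otimes>\<^sub>M borel)"
    using \<kappa> by (auto simp: square_integrable_def borel_prod)
  define D where "D z = \<kappa> z - \<kappa>' z" for z
  have [measurable]: "D \<in> borel_measurable (borel \<Otimes>\<^sub>M borel)" unfolding D_def by measurable
  have sections: "AE x in lborel. square_integrable lborel (\<lambda>y. \<kappa> (x, y)) \<and> square_integrable lborel (\<lambda>y. \<kappa>' (x, y))"
    using square_integrable_lborel_pair_sections[OF \<kappa>(1)] square_integrable_lborel_pair_sections[OF \<kappa>(2)]
    by eventually_elim simp
  let ?g = "\<lambda>N x t. indicator {- real N..real N} t *\<^sub>R D (x, t)"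
  have zero: "AE x in lborel. fourier (?g N x) \<nu> = 0" for N \<nu>
  proof -
    define e where "e t = indicator {- real N..real N} t *\<^sub>R cis (- (2 * pi * t * \<nu>))" for t
    have e: "square_integrable lborel e"
    proof (rule square_integrable_bound[of _ "indicator {- real N..real N}"])
      show "integrable lborel (indicator {- real N..real N} :: real \<Rightarrow> real)"
        by (intro integrable_real_indicator) auto
    qed (auto simp: e_def[abs_def] indicator_def)
    have "AE x in lborel. H e x = (LINT t|lborel. \<kappa> (x, t) * e t)" "AE x in lborel. H e x = (LINT t|lborel. \<kappa>' (x, t) * e t)"
      using 1 2 e by (auto simp: has_kernel_def)
    then show ?thesis
      using sections
    proof eventually_elim
      case (elim x)
      have "integrable lborel (\<lambda>t. \<kappa> (x, t) * e t)" "integrable lborel (\<lambda>t. \<kappa>' (x, t) * e t)"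
        using elim e by (auto intro: integrable_mult_square_integrable)
      then have "(LINT t|lborel. \<kappa> (x, t) * e t - \<kappa>' (x, t) * e t) = 0" using elim by simp
      moreover have "fourier (?g N x) \<nu> = (LINT t|lborel. \<kappa> (x, t) * e t - \<kappa>' (x, t) * e t)"
        unfolding fourier_def by (intro Bochner_Integration.integral_cong) (auto simp: e_def D_def algebra_simps)
      ultimately show ?case by simp
    qed
  qed
  have "AE x in lborel. AE t in lborel. ?g N x t = 0" for N
  proof -
    \<comment> \<open>The exceptional set of \<open>x\<close> depends on \<open>\<nu>\<close>;
      exchanging the quantifiers by Fubini gives almost every \<open>x\<close> a transform that
      vanishes almost everywhere.\<close>
    have "AE \<nu> in lborel. AE x in lborel. fourier (?g N x) \<nu> = 0"
      using zero by simp
    moreover have "{z \<in> space (lborel \<Otimes>\<^sub>M lborel). fourier (?g N (fst z)) (snd z) = 0} \<in> sets (lborel \<Otimes>\<^sub>M lborel)"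
      unfolding fourier_def by measurable
    ultimately have "AE x in lborel. AE \<nu> in lborel. fourier (?g N x) \<nu> = 0"
      using lborel_pair.AE_commute[of "\<lambda>x \<nu>. fourier (?g N x) \<nu> = 0"] by simp
    then show ?thesis
      using sections
    proof eventually_elim
      case (elim x)
      have "square_integrable lborel (\<lambda>y. D (x, y))"
        unfolding D_def using elim by (intro square_integrable_diff) auto
      from AE_fourier_zero_imp_AE_zero[OF truncation(1,2)[OF this]] elim show ?case by blast
    qed
  qed
  then have "AE x in lborel. \<forall>N. AE t in lborel. ?g N x t = 0" by (simp add: AE_all_countable)
  then have "AE x in lborel. AE t in lborel. \<kappa> (x, t) = \<kappa>' (x, t)"
  proof eventually_elim
    case (elim x)
    then have "AE t in lborel. \<forall>N. ?g N x t = 0" by (simp only: AE_all_countable simp_thms)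
    then show ?case
    proof eventually_elim
      case (elim t)
      obtain N where "\<bar>t\<bar> \<le> real N" using real_arch_simple by blast
      with elim[rule_format, of N] show ?case by (auto simp: indicator_def D_def)
    qed
  qed
  then have "AE z in lborel \<Otimes>\<^sub>M lborel. \<kappa> z = \<kappa>' z"
    by (rule lborel_pair.AE_pair_measure[rotated]) measurable
  then show ?thesis by (simp only: lborel_prod)
qed

text \<open>The complement of the support may be a union of uncountably many open sets on which
  \<open>F\<close> vanishes almost everywhere; the Lindelof property selects countably many with the
  same union.\<close>

lemma AE_outside_ess_support: "AE z in lborel. z \<notin> ess_support F \<longrightarrow> F z = 0"
proof -
  let ?\<U> = "{U. open U \<and> (AE z in lborel. z \<in> U \<longrightarrow> F z = 0)}"
  obtain \<V> where \<V>: "\<V> \<subseteq> ?\<U>" "countable \<V>" "\<Union>\<V> = \<Union>?\<U>"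
    using Lindelof[of ?\<U>] by auto
  have "AE z in lborel. \<forall>U\<in>\<V>. z \<in> U \<longrightarrow> F z = 0"
    using \<V>(1) by (subst AE_ball_countable[OF \<V>(2)]) auto
  then show ?thesis
  proof eventually_elim
    case (elim z)
    then have "z \<in> \<Union>\<V> \<longrightarrow> F z = 0" by blast
    then show ?case unfolding \<V>(3) by (simp only: ess_support_def Compl_iff not_not simp_thms)
  qed
qed

lemma summable_on_int_iff:
  fixes g :: "int \<Rightarrow> complex"
  shows "g summable_on UNIV \<longleftrightarrow> (\<integral>\<^sup>+k. ennreal (cmod (g k)) \<partial>count_space UNIV) < \<infinity>"
proof -
  have "g summable_on UNIV \<longleftrightarrow> (\<lambda>n. g (int_decode n)) summable_on UNIV"
    by (rule summable_on_reindex_bij_betw[OF bij_int_decode, symmetric])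
  also have "\<dots> \<longleftrightarrow> summable (\<lambda>n. cmod (g (int_decode n)))"
    by (simp add: summable_on_iff_abs_summable_on_complex summable_on_UNIV_nonneg_real_iff)
  also have "\<dots> \<longleftrightarrow> (\<Sum>n. ennreal (cmod (g (int_decode n)))) < \<infinity>"
    using ennreal_suminf_neq_top[OF _ norm_ge_zero, of "\<lambda>n. g (int_decode n)"]
      summable_suminf_not_top[OF norm_ge_zero, of "\<lambda>n. g (int_decode n)"]
    by (simp only: infinity_ennreal_def less_top) blast
  finally show ?thesis by (simp only: nn_integral_count_space_int)
qed

text \<open>A formula by countable operations, from which measurability in a parameter can be read
  off; the second case reproduces the default value 0 of \<open>infsum\<close>.\<close>

lemma infsum_int_eq:
  fixes g :: "int \<Rightarrow> complex"
  shows "(\<Sum>\<^sub>\<infinity>k. g k) = (if (\<Sum>n. ennreal (cmod (g (int_decode n)))) < \<infinity> then \<Sum>n. g (int_decode n) else 0)"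
proof (cases "g summable_on UNIV")
  case True
  then have "(\<lambda>n. g (int_decode n)) summable_on UNIV"
    by (subst summable_on_reindex_bij_betw[OF bij_int_decode])
  then have "(\<lambda>n. g (int_decode n)) sums (\<Sum>\<^sub>\<infinity>n. g (int_decode n))"
    by (intro has_sum_imp_sums has_sum_infsum)
  moreover have "(\<Sum>\<^sub>\<infinity>n. g (int_decode n)) = (\<Sum>\<^sub>\<infinity>k. g k)"
    by (rule infsum_reindex_bij_betw[OF bij_int_decode])
  ultimately show ?thesis
    using True by (simp add: summable_on_int_iff nn_integral_count_space_int sums_iff)
next
  case False
  then show ?thesis
    by (simp add: infsum_not_exists) (simp add: summable_on_int_iff nn_integral_count_space_int)
qed

lemma borel_measurable_infsum_int:
  fixes f :: "'a \<Rightarrow> int \<Rightarrow> complex"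
  assumes [measurable]: "\<And>k. (\<lambda>x. f x k) \<in> borel_measurable M"
  shows "(\<lambda>x. \<Sum>\<^sub>\<infinity>k. f x k) \<in> borel_measurable M"
  unfolding infsum_int_eq by measurable


section \<open>Sections of the spreading function and the response to a delta train\<close>

lemma has_spreading_function_unique:
  assumes "has_spreading_function H \<eta>" "has_spreading_function H \<eta>'"
  shows "AE t in lborel. AE \<nu> in lborel. \<eta> (t, \<nu>) = \<eta>' (t, \<nu>)"
proof -
  have "AE t in lborel. has_L2_fourier (impulse_response H t) (\<lambda>\<nu>. \<eta> (t, \<nu>))"
    "AE t in lborel. has_L2_fourier (impulse_response H t) (\<lambda>\<nu>. \<eta>' (t, \<nu>))"
    using assms by (auto simp: has_spreading_function_def)
  then show ?thesis
    by eventually_elim (rule has_L2_fourier_unique, auto)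
qed

lemma impulse_response_cont_eq_pw:
  "impulse_response_cont H t x = pw (\<lambda>\<nu>. spreading_function H (t, \<nu>)) (complex_of_real x)"
  by (simp add: impulse_response_cont_def pw_def)

lemma pw_zero: "AE \<nu> in lborel. F \<nu> = 0 \<Longrightarrow> pw F z = 0"
  unfolding pw_def by (rule integral_eq_zero_AE) (auto elim!: eventually_mono)

text \<open>Membership in \<open>OPW\<close> restricts the support of some spreading function;
  uniqueness transfers this to the one chosen by \<open>spreading_function\<close>, section by
  section, and the sections are what \<open>impulse_response_cont\<close> integrates.\<close>

lemma OPW_properties:
  assumes H: "H \<in> OPW ({0..T} \<times> {- \<Omega> / 2..\<Omega> / 2})"
  shows "has_kernel H (hs_kernel H)" and "has_spreading_function H (spreading_function H)"
    and "AE t in lborel. bandlimited \<Omega> (\<lambda>\<nu>. spreading_function H (t, \<nu>)) \<and>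
      (t \<notin> {0..T} \<longrightarrow> (AE \<nu> in lborel. spreading_function H (t, \<nu>) = 0))"
proof -
  show "has_kernel H (hs_kernel H)"
    using H someI_ex[of "has_kernel H"] by (auto simp: OPW_def HS_operators_def hs_kernel_def)
  obtain \<eta> where \<eta>: "has_spreading_function H \<eta>" and supp: "ess_support \<eta> \<subseteq> {0..T} \<times> {- \<Omega> / 2..\<Omega> / 2}"
    using H by (auto simp: OPW_def)
  show \<sigma>: "has_spreading_function H (spreading_function H)"
    unfolding spreading_function_def by (rule someI[of _ \<eta>]) (rule \<eta>)
  have "AE z in lborel. z \<notin> {0..T} \<times> {- \<Omega> / 2..\<Omega> / 2} \<longrightarrow> \<eta> z = 0"
    using AE_outside_ess_support[of \<eta>] by eventually_elim (use supp in auto)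
  then have "AE z in lborel \<Otimes>\<^sub>M lborel. z \<notin> {0..T} \<times> {- \<Omega> / 2..\<Omega> / 2} \<longrightarrow> \<eta> z = 0"
    by (simp only: lborel_prod)
  then have "AE t in lborel. AE \<nu> in lborel. (t, \<nu>) \<notin> {0..T} \<times> {- \<Omega> / 2..\<Omega> / 2} \<longrightarrow> \<eta> (t, \<nu>) = 0"
    by (rule lborel_pair.AE_pair)
  moreover have "AE t in lborel. square_integrable lborel (\<lambda>\<nu>. spreading_function H (t, \<nu>))"
    using \<sigma> by (intro square_integrable_lborel_pair_sections) (simp add: has_spreading_function_def)
  ultimately show "AE t in lborel. bandlimited \<Omega> (\<lambda>\<nu>. spreading_function H (t, \<nu>)) \<and>
      (t \<notin> {0..T} \<longrightarrow> (AE \<nu> in lborel. spreading_function H (t, \<nu>) = 0))"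
    using has_spreading_function_unique[OF \<eta> \<sigma>]
  proof eventually_elim
    case (elim t)
    have "AE \<nu> in lborel. \<Omega> / 2 < \<bar>\<nu>\<bar> \<longrightarrow> spreading_function H (t, \<nu>) = 0"
      using elim(1,3) by eventually_elim auto
    moreover have "AE \<nu> in lborel. spreading_function H (t, \<nu>) = 0" if "t \<notin> {0..T}"
      using elim(1,3) by eventually_elim (use that in auto)
    ultimately show ?case using elim(2) by (simp add: bandlimited_def)
  qed
qed

text \<open>The shear turns the norm of the kernel into an integral over \<open>t\<close> of norms
  of impulse responses, and Plancherel applies to almost every one of them.\<close>

lemma HS_norm_eq_spreading:
  assumes k: "has_kernel H (hs_kernel H)" and \<sigma>: "has_spreading_function H \<sigma>"
  shows "ennreal ((HS_norm H)\<^sup>2) = (\<integral>\<^sup>+t. ennreal ((L2_norm lborel (\<lambda>\<nu>. \<sigma> (t, \<nu>)))\<^sup>2) \<partial>lborel)"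
proof -
  have \<kappa>: "square_integrable lborel (hs_kernel H)" using k by (simp add: has_kernel_def)
  have "ennreal ((HS_norm H)\<^sup>2) = energy lborel (hs_kernel H)"
    by (simp add: HS_norm_def nn_integral_eq_L2_norm[OF \<kappa>])
  also have "\<dots> = (\<integral>\<^sup>+t. (energy lborel (\<lambda>x. hs_kernel H (x, x - t))) \<partial>lborel)"
  proof (rule nn_integral_lborel_pair_shear)
    note square_integrableD(1)[OF \<kappa>, measurable]
    show "(\<lambda>z. ennreal ((cmod (hs_kernel H z))\<^sup>2)) \<in> borel_measurable lborel" by measurable
  qed
  also have "\<dots> = (\<integral>\<^sup>+t. ennreal ((L2_norm lborel (\<lambda>\<nu>. \<sigma> (t, \<nu>)))\<^sup>2) \<partial>lborel)"
  proof (rule nn_integral_cong_AE)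
    have "AE t in lborel. has_L2_fourier (impulse_response H t) (\<lambda>\<nu>. \<sigma> (t, \<nu>))"
      using \<sigma> by (simp add: has_spreading_function_def)
    then show "AE t in lborel. (energy lborel (\<lambda>x. hs_kernel H (x, x - t))) = ennreal ((L2_norm lborel (\<lambda>\<nu>. \<sigma> (t, \<nu>)))\<^sup>2)"
    proof eventually_elim
      case (elim t)
      then have "square_integrable lborel (impulse_response H t)" by (simp add: has_L2_fourier_iff)
      from nn_integral_eq_L2_norm[OF this] has_L2_fourier_norm[OF elim]
      show ?case by (simp add: impulse_response_def)
    qed
  qed
  finally show ?thesis .
qed

lemma borel_measurable_impulse_response_cont:
  assumes "has_spreading_function H (spreading_function H)"
  shows "(\<lambda>z. impulse_response_cont H (fst z) (snd z)) \<in> borel_measurable (borel \<Otimes>\<^sub>M borel)"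
proof -
  have [measurable]: "spreading_function H \<in> borel_measurable (borel \<Otimes>\<^sub>M borel)"
    using assms by (simp add: has_spreading_function_def square_integrable_def borel_prod)
  show ?thesis unfolding impulse_response_cont_def by measurable
qed

text \<open>For almost every \<open>x\<close> at most one summand is nonzero, so squaring the
  modulus commutes with the sum; then \<open>x = \<Lambda> k + t\<close> is substituted in each
  term.\<close>

lemma apply_delta_train_nn_integral:
  assumes H: "H \<in> OPW ({0..T} \<times> {- \<Omega> / 2..\<Omega> / 2})"
    and gap: "\<forall>k. \<Lambda> (k + 1) - \<Lambda> k \<ge> T" and T: "T > 0"
  shows "apply_delta_train H c \<Lambda> \<in> borel_measurable borel"
    and "energy lborel (\<lambda>x. apply_delta_train H c \<Lambda> x)
      = (\<integral>\<^sup>+t. (energy (count_space UNIV) (\<lambda>k. c k * impulse_response_cont H t (\<Lambda> k + t))) \<partial>lborel)"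
proof -
  note P = OPW_properties[OF H]
  note borel_measurable_impulse_response_cont[OF P(2), measurable]
  have [measurable]: "(\<lambda>x. impulse_response_cont H (f x) (g x)) \<in> borel_measurable M" 
    if [measurable]: "f \<in> borel_measurable M" "g \<in> borel_measurable M" for f g and M :: "'a measure"
    using measurable_compose[OF _ borel_measurable_impulse_response_cont[OF P(2)], of "\<lambda>x. (f x, g x)" M] by simp
  show meas: "apply_delta_train H c \<Lambda> \<in> borel_measurable borel"
    unfolding apply_delta_train_def[abs_def] by (rule borel_measurable_infsum_int) measurable
  have sep: "separated T \<Lambda>" using gap T by (simp add: separated_def)
  have "AE t in lborel. t \<notin> {0..T} \<longrightarrow> (\<forall>x. impulse_response_cont H t x = 0)"
    using P(3) by eventually_elim (auto simp: impulse_response_cont_eq_pw intro!: pw_zero)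
  then have "AE x in lborel. x - \<Lambda> k \<notin> {0..T} \<longrightarrow> (\<forall>y. impulse_response_cont H (x - \<Lambda> k) y = 0)" for k
    using AE_lborel_affine[of "\<lambda>t. t \<notin> {0..T} \<longrightarrow> (\<forall>x. impulse_response_cont H t x = 0)" 1 "- \<Lambda> k"] by simp
  then have "AE x in lborel. \<forall>k. x - \<Lambda> k \<notin> {0..T} \<longrightarrow> (\<forall>y. impulse_response_cont H (x - \<Lambda> k) y = 0)"
    by (simp only: AE_all_countable simp_thms)
  \<comment> \<open>The closed intervals \<open>{\<Lambda> k..\<Lambda> k + T}\<close> share an
    endpoint when a gap equals \<open>T\<close>; these countably many points are discarded.\<close>
  moreover have "AE x in lborel. \<forall>k. x \<noteq> \<Lambda> k + T"
    unfolding AE_all_countable by (intro allI AE_lborel_singleton)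
  ultimately have pointwise: "AE x in lborel. ennreal ((cmod (apply_delta_train H c \<Lambda> x))\<^sup>2)
     = energy (count_space UNIV) (\<lambda>k. c k * impulse_response_cont H (x - \<Lambda> k) x)"
  proof eventually_elim
    case (elim x)
    let ?f = "\<lambda>k. c k * impulse_response_cont H (x - \<Lambda> k) x"
    have zero: "?f k = 0" if "\<not> (\<Lambda> k \<le> x \<and> x < \<Lambda> k + T)" for k
    proof -
      have "x \<noteq> \<Lambda> k + T" using elim(2) by blast
      then have "x - \<Lambda> k \<notin> {0..T}" using that by auto
      then show ?thesis using elim(1) by simp
    qed
    show ?case
    proof (cases "\<exists>k. \<Lambda> k \<le> x \<and> x < \<Lambda> k + T")
      case True
      then obtain k where k: "\<Lambda> k \<le> x \<and> x < \<Lambda> k + T" by blast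
      have other: "?f j = 0" if "j \<noteq> k" for j
        using separated_dist[OF sep that] k by (intro zero) auto
      have "apply_delta_train H c \<Lambda> x = (\<Sum>\<^sub>\<infinity>j\<in>{k}. ?f j)"
        unfolding apply_delta_train_def by (rule infsum_cong_neutral) (use other in auto)
      moreover have "energy (count_space UNIV) ?f = (\<Sum>j\<in>{k}. ennreal ((cmod (?f j))\<^sup>2))"
        by (rule nn_integral_count_space') (use other in auto)
      ultimately show ?thesis by simp
    next
      case False
      then have f0: "?f = (\<lambda>_. 0)" using zero by blast
      have "energy (count_space UNIV) ?f = 0"
        using fun_cong[OF f0] by (simp only:) simp
      then show ?thesis unfolding apply_delta_train_def f0 by simp
    qed
  qed
  have "energy lborel (\<lambda>x. apply_delta_train H c \<Lambda> x)
     = (\<integral>\<^sup>+x. \<integral>\<^sup>+k. ennreal ((cmod (c k * impulse_response_cont H (x - \<Lambda> k) x))\<^sup>2) \<partial>count_space UNIV \<partial>lborel)"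
    by (rule nn_integral_cong_AE[OF pointwise])
  also have "\<dots> = (\<integral>\<^sup>+k. \<integral>\<^sup>+x. ennreal ((cmod (c k * impulse_response_cont H (x - \<Lambda> k) x))\<^sup>2) \<partial>lborel \<partial>count_space UNIV)"
    by (rule nn_integral_count_space_nn_integral) auto
  also have "\<dots> = (\<integral>\<^sup>+k. \<integral>\<^sup>+t. ennreal ((cmod (c k * impulse_response_cont H t (\<Lambda> k + t)))\<^sup>2) \<partial>lborel \<partial>count_space UNIV)"
  proof (rule nn_integral_cong)
    fix k
    show "energy lborel (\<lambda>x. c k * impulse_response_cont H (x - \<Lambda> k) x)
      = energy lborel (\<lambda>t. c k * impulse_response_cont H t (\<Lambda> k + t))"
      using nn_integral_real_affine[of "\<lambda>x. ennreal ((cmod (c k * impulse_response_cont H (x - \<Lambda> k) x))\<^sup>2)" 1 "\<Lambda> k"] by simp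
  qed
  also have "\<dots> = (\<integral>\<^sup>+t. (energy (count_space UNIV) (\<lambda>k. c k * impulse_response_cont H t (\<Lambda> k + t))) \<partial>lborel)"
    by (rule nn_integral_count_space_nn_integral[symmetric]) auto
  finally show "energy lborel (\<lambda>x. apply_delta_train H c \<Lambda> x)
      = (\<integral>\<^sup>+t. (energy (count_space UNIV) (\<lambda>k. c k * impulse_response_cont H t (\<Lambda> k + t))) \<partial>lborel)" .
qed

subsection \<open>The sufficient condition\<close>

lemma norm_infsum_int_le:
  fixes g :: "int \<Rightarrow> complex"
  shows "ennreal (cmod (\<Sum>\<^sub>\<infinity>k. g k)) \<le> (\<integral>\<^sup>+k. ennreal (cmod (g k)) \<partial>count_space UNIV)"
proof (cases "g summable_on UNIV")
  case True
  then have "(\<lambda>k. cmod (g k)) summable_on UNIV" by (simp add: summable_on_iff_abs_summable_on_complex)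
  then have s: "(\<lambda>n. cmod (g (int_decode n))) summable_on UNIV"
    by (subst summable_on_reindex_bij_betw[OF bij_int_decode])
  then have s': "summable (\<lambda>n. cmod (g (int_decode n)))" by (simp add: summable_on_UNIV_nonneg_real_iff)
  have "(\<Sum>\<^sub>\<infinity>k. g k) = (if (\<integral>\<^sup>+k. ennreal (cmod (g k)) \<partial>count_space UNIV) < \<infinity> then \<Sum>n. g (int_decode n) else 0)"
    unfolding infsum_int_eq nn_integral_count_space_int ..
  then have "ennreal (cmod (\<Sum>\<^sub>\<infinity>k. g k)) \<le> ennreal (cmod (\<Sum>n. g (int_decode n)))" by simp
  also have "\<dots> \<le> ennreal (\<Sum>n. cmod (g (int_decode n)))"
    by (intro ennreal_leI summable_norm s')
  also have "\<dots> = (\<Sum>n. ennreal (cmod (g (int_decode n))))"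
    by (rule suminf_ennreal2[symmetric, OF _ s']) simp
  finally show ?thesis by (simp only: nn_integral_count_space_int)
qed (simp add: infsum_not_exists)

text \<open>Gaussian means of the inversion integral converge to \<open>p x\<close> and are bounded
  by the L1 norm of the transform, infinite or not.\<close>

lemma fourier_inversion_le:
  assumes p: "integrable lborel p" and cont: "isCont p x"
  shows "ennreal (cmod (p x)) \<le> (\<integral>\<^sup>+\<nu>. ennreal (cmod (fourier p \<nu>)) \<partial>lborel)"
proof (rule LIMSEQ_le_const2)
  let ?K = "\<lambda>n. LINT y|lborel. p y * complex_of_real (gauss_kernel (gauss_scale n) (x - y))"
  show "(\<lambda>n. ennreal (cmod (?K n))) \<longlonglongrightarrow> ennreal (cmod (p x))"
    by (intro tendsto_ennrealI tendsto_norm gauss_kernel_approx_identity p cont gauss_scale)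
  have "ennreal (cmod (?K n)) \<le> (\<integral>\<^sup>+\<nu>. ennreal (cmod (fourier p \<nu>)) \<partial>lborel)" for n
  proof -
    have "ennreal (cmod (?K n)) \<le> (\<integral>\<^sup>+\<nu>. ennreal (cmod (complex_of_real (gauss_weight (gauss_scale n) \<nu>) * (fourier p \<nu> * cis (2 * pi * x * \<nu>)))) \<partial>lborel)"
      unfolding gauss_summation[OF p gauss_scale(1), symmetric] by (rule norm_integral_le_nn_integral)
    also have "\<dots> \<le> (\<integral>\<^sup>+\<nu>. ennreal (cmod (fourier p \<nu>)) \<partial>lborel)"
      by (intro nn_integral_mono ennreal_leI) (simp add: norm_mult mult_left_le_one_le del: of_real_exp)
    finally show ?thesis .
  qed
  then show "\<exists>N. \<forall>n\<ge>N. ennreal (cmod (?K n)) \<le> (\<integral>\<^sup>+\<nu>. ennreal (cmod (fourier p \<nu>)) \<partial>lborel)" by blast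
qed

lemma gauss_window_eq: "gauss_window x = complex_of_real (exp (- (pi * x\<^sup>2)))"
  by (simp add: gauss_window_def exp_of_real[symmetric])

lemma square_integrable_gauss_window_shift: "square_integrable lborel (\<lambda>x. gauss_window (x - t))"
proof -
  have "integrable lborel (\<lambda>x::real. exp (- (pi * (sqrt 2 * x)\<^sup>2)))"
    by (rule integrable_gauss) simp
  then have "integrable lborel (\<lambda>x. exp (- (pi * (sqrt 2 * (- t + 1 * x))\<^sup>2)))"
    by (rule lborel_integrable_real_affine) simp
  moreover have "(cmod (gauss_window (x - t)))\<^sup>2 = exp (- (pi * (sqrt 2 * (- t + 1 * x))\<^sup>2))" for x
  proof -
    have "(sqrt 2 * (- t + 1 * x))\<^sup>2 = 2 * (x - t)\<^sup>2" by (simp add: power_mult_distrib)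
    then show ?thesis by (simp add: gauss_window_eq exp_double[symmetric] del: of_real_exp)
  qed
  ultimately show ?thesis
    unfolding square_integrable_def by (simp add: gauss_window_eq[abs_def] del: of_real_exp)
qed

lemma STFT_eq_fourier:
  "STFT gauss_window f (t, \<nu>) = fourier (\<lambda>x. f x * gauss_window (x - t)) \<nu>"
proof -
  have "cnj (exp (2 * pi * \<i> * \<nu> * x) * gauss_window (x - t)) = gauss_window (x - t) * cis (- (2 * pi * x * \<nu>))" for x :: real
    by (simp add: gauss_window_eq cis_conv_exp exp_cnj mult_ac del: of_real_exp)
  then show ?thesis
    unfolding STFT_def fourier_def prod.case by (simp only: mult.assoc)
qed

text \<open>For fixed \<open>t\<close>, \<open>fourier_inversion_le\<close> for \<open>f\<close>
  times the shifted window bounds \<open>cmod (f x) * exp (- (pi * (x - t)\<^sup>2))\<close> by the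
  integral of the modulus of the STFT over the frequencies. At a sampling point this is averaged
  over the \<open>t\<close> up to \<open>\<delta>\<close> further right, where the Gaussian is at
  least \<open>exp (- (pi * \<delta>\<^sup>2))\<close>; these intervals are disjoint, so the sum is
  controlled by the norm of \<open>S0\<close>.\<close>

lemma S0_samples_le:
  assumes f: "f \<in> S0" and sep: "separated \<delta> \<Lambda>"
  shows "(\<integral>\<^sup>+k. ennreal (cmod (f (\<Lambda> k))) \<partial>count_space UNIV) \<le> ennreal (exp (pi * \<delta>\<^sup>2) / \<delta>) * ennreal (S0_norm f)"
proof -
  have \<delta>: "\<delta> > 0" using sep by (simp add: separated_def)
  have cont: "continuous_on UNIV f" and sq: "square_integrable lborel f"
    and V: "integrable lborel (STFT gauss_window f)" using f by (auto simp: S0_def)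
  have [measurable]: "STFT gauss_window f \<in> borel_measurable (borel \<Otimes>\<^sub>M borel)"
    using borel_measurable_integrable[OF V] by (simp add: borel_prod)
  let ?p = "\<lambda>t x. f x * gauss_window (x - t)"
  define v where "v t = (\<integral>\<^sup>+\<nu>. ennreal (cmod (STFT gauss_window f (t, \<nu>))) \<partial>lborel)" for t
  have [measurable]: "v \<in> borel_measurable borel" unfolding v_def by measurable
  have point: "ennreal (cmod (f x) * exp (- (pi * (x - t)\<^sup>2))) \<le> v t" for x t
  proof -
    have "integrable lborel (?p t)"
      by (rule integrable_mult_square_integrable[OF sq square_integrable_gauss_window_shift])
    moreover have "isCont (?p t) x"
    proof -
      have "isCont f x" using cont by (simp add: continuous_on_eq_continuous_at)
      moreover have "isCont (\<lambda>x. gauss_window (x - t)) x"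
        unfolding gauss_window_def by (intro continuous_intros)
      ultimately show ?thesis by (intro continuous_intros)
    qed
    ultimately have "ennreal (cmod (?p t x)) \<le> (\<integral>\<^sup>+\<nu>. ennreal (cmod (fourier (?p t) \<nu>)) \<partial>lborel)"
      by (rule fourier_inversion_le)
    then show ?thesis by (simp add: v_def STFT_eq_fourier norm_mult gauss_window_eq del: of_real_exp)
  qed
  have single: "ennreal (cmod (f (\<Lambda> k))) \<le> ennreal (exp (pi * \<delta>\<^sup>2) / \<delta>) * (\<integral>\<^sup>+t. v t * indicator {\<Lambda> k..<\<Lambda> k + \<delta>} t \<partial>lborel)" for k
  proof -
    have le: "ennreal (cmod (f (\<Lambda> k))) * indicator {\<Lambda> k..<\<Lambda> k + \<delta>} t \<le> ennreal (exp (pi * \<delta>\<^sup>2)) * (v t * indicator {\<Lambda> k..<\<Lambda> k + \<delta>} t)" for t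
    proof (cases "t \<in> {\<Lambda> k..<\<Lambda> k + \<delta>}")
      case True
      then have "\<bar>\<Lambda> k - t\<bar> \<le> \<bar>\<delta>\<bar>" by auto
      then have "(\<Lambda> k - t)\<^sup>2 \<le> \<delta>\<^sup>2" by (simp only: abs_le_square_iff)
      then have "exp 0 \<le> exp (pi * \<delta>\<^sup>2 - pi * (\<Lambda> k - t)\<^sup>2)" by simp
      then have "1 \<le> exp (pi * \<delta>\<^sup>2) * exp (- (pi * (\<Lambda> k - t)\<^sup>2))" by (simp add: exp_diff exp_minus divide_inverse)
      then have "cmod (f (\<Lambda> k)) * 1 \<le> cmod (f (\<Lambda> k)) * (exp (pi * \<delta>\<^sup>2) * exp (- (pi * (\<Lambda> k - t)\<^sup>2)))"
        by (rule mult_left_mono) simp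
      then have "ennreal (cmod (f (\<Lambda> k))) \<le> ennreal (exp (pi * \<delta>\<^sup>2) * (cmod (f (\<Lambda> k)) * exp (- (pi * (\<Lambda> k - t)\<^sup>2))))"
        by (intro ennreal_leI) (simp add: mult_ac)
      also have "\<dots> = ennreal (exp (pi * \<delta>\<^sup>2)) * ennreal (cmod (f (\<Lambda> k)) * exp (- (pi * (\<Lambda> k - t)\<^sup>2)))"
        by (rule ennreal_mult) auto
      also have "\<dots> \<le> ennreal (exp (pi * \<delta>\<^sup>2)) * v t" by (intro mult_left_mono point) simp
      finally show ?thesis using True by simp
    qed simp
    have "ennreal \<delta> * ennreal (cmod (f (\<Lambda> k))) = (\<integral>\<^sup>+t. ennreal (cmod (f (\<Lambda> k))) * indicator {\<Lambda> k..<\<Lambda> k + \<delta>} t \<partial>lborel)"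
      using \<delta> by (simp add: nn_integral_cmult mult.commute)
    also have "\<dots> \<le> (\<integral>\<^sup>+t. ennreal (exp (pi * \<delta>\<^sup>2)) * (v t * indicator {\<Lambda> k..<\<Lambda> k + \<delta>} t) \<partial>lborel)"
      by (intro nn_integral_mono le)
    also have "\<dots> = ennreal (exp (pi * \<delta>\<^sup>2)) * (\<integral>\<^sup>+t. v t * indicator {\<Lambda> k..<\<Lambda> k + \<delta>} t \<partial>lborel)"
      by (rule nn_integral_cmult) measurable
    finally have "ennreal (1 / \<delta>) * (ennreal \<delta> * ennreal (cmod (f (\<Lambda> k)))) \<le> ennreal (1 / \<delta>) * (ennreal (exp (pi * \<delta>\<^sup>2)) * (\<integral>\<^sup>+t. v t * indicator {\<Lambda> k..<\<Lambda> k + \<delta>} t \<partial>lborel))"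
      by (rule mult_left_mono) simp
    moreover have "ennreal (1 / \<delta>) * (ennreal \<delta> * ennreal (cmod (f (\<Lambda> k)))) = ennreal (cmod (f (\<Lambda> k)))"
      using \<delta> by (simp add: ennreal_mult[symmetric])
    moreover have "ennreal (1 / \<delta>) * ennreal (exp (pi * \<delta>\<^sup>2)) = ennreal (exp (pi * \<delta>\<^sup>2) / \<delta>)"
      using \<delta> by (simp add: ennreal_mult[symmetric])
    ultimately show ?thesis by (simp only: mult.assoc[symmetric])
  qed
  have "(\<integral>\<^sup>+k. ennreal (cmod (f (\<Lambda> k))) \<partial>count_space UNIV)
    \<le> (\<integral>\<^sup>+k. ennreal (exp (pi * \<delta>\<^sup>2) / \<delta>) * (\<integral>\<^sup>+t. v t * indicator {\<Lambda> k..<\<Lambda> k + \<delta>} t \<partial>lborel) \<partial>count_space UNIV)"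
    by (intro nn_integral_mono single)
  also have "\<dots> = ennreal (exp (pi * \<delta>\<^sup>2) / \<delta>) * (\<integral>\<^sup>+k. (\<integral>\<^sup>+t. v t * indicator {\<Lambda> k..<\<Lambda> k + \<delta>} t \<partial>lborel) \<partial>count_space UNIV)"
    by (rule nn_integral_cmult) simp
  also have "\<dots> \<le> ennreal (exp (pi * \<delta>\<^sup>2) / \<delta>) * (\<integral>\<^sup>+t. v t \<partial>lborel)"
    by (intro mult_left_mono nn_integral_disjoint_intervals_le[OF sep]) auto
  also have "(\<integral>\<^sup>+t. v t \<partial>lborel) = (\<integral>\<^sup>+z. ennreal (cmod (STFT gauss_window f z)) \<partial>(lborel \<Otimes>\<^sub>M lborel))"
    unfolding v_def by (rule lborel.nn_integral_fst) measurable
  also have "\<dots> = (\<integral>\<^sup>+z. ennreal (cmod (STFT gauss_window f z)) \<partial>lborel)"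
    by (simp only: lborel_prod)
  also have "\<dots> = ennreal (S0_norm f)"
    unfolding S0_norm_def using V by (intro nn_integral_eq_integral) auto
  finally show ?thesis .
qed

lemma delta_train_one_in_S0_dual:
  assumes sep: "separated \<delta> \<Lambda>"
  shows "delta_train_in_S0_dual (\<lambda>_. 1) \<Lambda>"
proof -
  have sum: "(\<lambda>k. f (\<Lambda> k)) summable_on UNIV" if "f \<in> S0" for f
    using S0_samples_le[OF that sep] unfolding summable_on_int_iff
    by (rule le_less_trans) (simp add: ennreal_mult_less_top)
  have "cmod (\<Sum>\<^sub>\<infinity>k. f (\<Lambda> k)) \<le> exp (pi * \<delta>\<^sup>2) / \<delta> * S0_norm f" if "f \<in> S0" for f
  proof -
    have \<delta>: "\<delta> > 0" using sep by (simp add: separated_def)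
    have nn: "0 \<le> S0_norm f" by (simp add: S0_norm_def)
    have "ennreal (cmod (\<Sum>\<^sub>\<infinity>k. f (\<Lambda> k))) \<le> ennreal (exp (pi * \<delta>\<^sup>2) / \<delta>) * ennreal (S0_norm f)"
      by (rule order_trans[OF norm_infsum_int_le S0_samples_le[OF that sep]])
    also have "\<dots> = ennreal (exp (pi * \<delta>\<^sup>2) / \<delta> * S0_norm f)"
      using \<delta> nn by (intro ennreal_mult[symmetric]) auto
    finally show ?thesis using \<delta> nn by (subst (asm) ennreal_le_iff) auto
  qed
  then have "\<exists>B. \<forall>f\<in>S0. cmod (\<Sum>\<^sub>\<infinity>k. f (\<Lambda> k)) \<le> B * S0_norm f" by blast
  then show ?thesis
    using sum by (auto simp: delta_train_in_S0_dual_def S0_dual_def delta_train_def infsum_add infsum_cmult_right')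
qed


section \<open>Density as a point count, and the sufficient condition\<close>

lemma card_range_Int:
  assumes "inj \<Lambda>"
  shows "card (range \<Lambda> \<inter> I) = card {k. \<Lambda> k \<in> I}"
proof -
  have "range \<Lambda> \<inter> I = \<Lambda> ` {k. \<Lambda> k \<in> I}" by auto
  then show ?thesis using assms by (simp add: card_image inj_on_subset)
qed

text \<open>The density is used only through one window length: its lower limit exceeds
  \<open>\<Omega>\<close>, so some \<open>h\<close> has minimal count above
  \<open>\<Omega> * h\<close>.\<close>

lemma density_gt_imp_count:
  assumes inj: "inj \<Lambda>" and dens: "lower_beurling_density \<Lambda> > ereal \<Omega>"
  obtains h N where "h > 0" "\<Omega> * h < real N" "\<And>y. N \<le> card {k. \<Lambda> k \<in> {y..<y + h}}"
proof -
  have "eventually (\<lambda>h. ereal \<Omega> < ereal (real (min_points \<Lambda> h) / h)) at_top"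
    using dens unfolding lower_beurling_density_def by (rule less_LiminfD)
  then have "eventually (\<lambda>h. ereal \<Omega> < ereal (real (min_points \<Lambda> h) / h) \<and> h > 0) at_top"
    using eventually_gt_at_top[of 0] by (rule eventually_conj)
  then obtain h where h: "ereal \<Omega> < ereal (real (min_points \<Lambda> h) / h)" "h > 0"
    using eventually_happens'[OF trivial_limit_at_top_linorder] by blast
  show ?thesis
  proof (rule that[OF h(2)])
    show "\<Omega> * h < real (min_points \<Lambda> h)" using h by (simp add: field_simps)
    fix y
    have "min_points \<Lambda> h \<le> card (range \<Lambda> \<inter> {(y + h / 2) - h / 2..<(y + h / 2) + h / 2})"
      unfolding min_points_def by (rule cINF_lower) auto
    moreover have "(y + h / 2) - h / 2 = y" "(y + h / 2) + h / 2 = y + h" by simp_all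
    ultimately show "min_points \<Lambda> h \<le> card {k. \<Lambda> k \<in> {y..<y + h}}"
      by (simp only: card_range_Int[OF inj])
  qed
qed

lemma L2_norm_modulate_real:
  "L2_norm lborel (\<lambda>\<nu>. F \<nu> * exp (2 * pi * \<i> * complex_of_real t * complex_of_real \<nu>)) = L2_norm lborel F"
  by (simp add: L2_norm_def norm_mult)

lemma borel_measurable_section_norm:
  assumes "\<sigma> \<in> borel_measurable (borel \<Otimes>\<^sub>M borel)"
  shows "(\<lambda>t. L2_norm lborel (\<lambda>\<nu>. \<sigma> (t, \<nu>))) \<in> borel_measurable borel"
proof -
  note assms[measurable]
  show ?thesis unfolding L2_norm_def by measurable
qed

text \<open>Unit weights suffice. For almost every \<open>t\<close> the two sampling bounds apply to
  the section at \<open>t\<close> with constants independent of \<open>t\<close>, and integrating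
  over \<open>t\<close> compares the energy of the response with the Hilbert-Schmidt norm.\<close>

lemma sampling_sufficient:
  assumes T: "T > 0" and \<Omega>: "\<Omega> > 0" and gap: "\<forall>k. \<Lambda> (k + 1) - \<Lambda> k \<ge> T"
    and dens: "lower_beurling_density \<Lambda> > ereal \<Omega>"
  shows "set_of_sampling \<Lambda> (OPW ({0..T} \<times> {- \<Omega> / 2..\<Omega> / 2}))"
proof -
  have sep: "separated T \<Lambda>" using gap T by (simp add: separated_def)
  obtain h N where h: "h > 0" "\<Omega> * h < real N" "\<And>y. N \<le> card {k. \<Lambda> k \<in> {y..<y + h}}"
    using density_gt_imp_count[OF separated_inj[OF sep] dens] by blast
  obtain C1 where C1: "C1 > 0" "\<And>F. bandlimited \<Omega> F \<Longrightarrow>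
    ennreal ((L2_norm lborel F)\<^sup>2) \<le> ennreal C1 * sample_energy \<Lambda> F"
    using sampling_lower_bound[OF sep less_imp_le[OF \<Omega>] h] by blast
  obtain C2 where C2: "C2 > 0" "\<And>F. bandlimited \<Omega> F \<Longrightarrow>
    sample_energy \<Lambda> F \<le> ennreal C2 * ennreal ((L2_norm lborel F)\<^sup>2)"
    using sampling_upper_bound[OF sep less_imp_le[OF \<Omega>]] by blast
  have main: "square_integrable lborel (apply_delta_train H (\<lambda>_. 1) \<Lambda>) \<and>
      1 / sqrt C1 * HS_norm H \<le> L2_norm lborel (apply_delta_train H (\<lambda>_. 1) \<Lambda>) \<and>
      L2_norm lborel (apply_delta_train H (\<lambda>_. 1) \<Lambda>) \<le> sqrt C2 * HS_norm H"
    if H: "H \<in> OPW ({0..T} \<times> {- \<Omega> / 2..\<Omega> / 2})" for H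
  proof -
    note P = OPW_properties[OF H]
    let ?\<sigma> = "spreading_function H" and ?out = "apply_delta_train H (\<lambda>_. 1) \<Lambda>"
    let ?n = "\<lambda>t. ennreal ((L2_norm lborel (\<lambda>\<nu>. ?\<sigma> (t, \<nu>)))\<^sup>2)"
    define S where "S t = energy (count_space UNIV) (\<lambda>k. impulse_response_cont H t (\<Lambda> k + t))" for t
    have [measurable]: "?\<sigma> \<in> borel_measurable (borel \<Otimes>\<^sub>M borel)"
      using P(2) by (simp add: has_spreading_function_def square_integrable_def borel_prod)
    have [measurable]: "(\<lambda>t. L2_norm lborel (\<lambda>\<nu>. ?\<sigma> (t, \<nu>))) \<in> borel_measurable borel"
      by (rule borel_measurable_section_norm) measurable
    have [measurable]: "(\<lambda>t. impulse_response_cont H t (\<Lambda> k + t)) \<in> borel_measurable borel" for k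
      using measurable_compose[OF _ borel_measurable_impulse_response_cont[OF P(2)], of "\<lambda>t. (t, \<Lambda> k + t)" borel] by simp
    have [measurable]: "S \<in> borel_measurable borel" unfolding S_def by measurable
    have out: "energy lborel ?out = (\<integral>\<^sup>+t. S t \<partial>lborel)"
      using apply_delta_train_nn_integral(2)[OF H gap T, of "\<lambda>_. 1"] by (simp add: S_def)
    have meas: "?out \<in> borel_measurable lborel"
      using apply_delta_train_nn_integral(1)[OF H gap T, of "\<lambda>_. 1"] by simp
    have HS: "ennreal ((HS_norm H)\<^sup>2) = (\<integral>\<^sup>+t. ?n t \<partial>lborel)"
      by (rule HS_norm_eq_spreading[OF P(1,2)])
    have frame: "AE t in lborel. ?n t \<le> ennreal C1 * S t \<and> S t \<le> ennreal C2 * ?n t"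
      using P(3)
    proof eventually_elim
      case (elim t)
      \<comment> \<open>Samples are taken at \<open>\<Lambda> k + t\<close>; modulating the section
        moves them to \<open>\<Lambda> k\<close> without changing its norm, so one sequence serves
        all \<open>t\<close>.\<close>
      let ?G = "\<lambda>\<nu>. ?\<sigma> (t, \<nu>) * exp (2 * pi * \<i> * complex_of_real t * complex_of_real \<nu>)"
      have G: "bandlimited \<Omega> ?G" using elim by (intro bandlimited_modulate) auto
      have "impulse_response_cont H t (\<Lambda> k + t) = pw ?G (\<Lambda> k)" for k
        unfolding impulse_response_cont_eq_pw of_real_add pw_shift ..
      then have "S t = energy (count_space UNIV) (\<lambda>k. pw ?G (\<Lambda> k))"
        unfolding S_def by (simp only:)
      then show ?case
        using C1(2)[OF G] C2(2)[OF G] unfolding L2_norm_modulate_real by (simp only: simp_thms)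
    qed
    have lower: "ennreal ((HS_norm H)\<^sup>2) \<le> ennreal C1 * (\<integral>\<^sup>+t. S t \<partial>lborel)"
    proof -
      have "(\<integral>\<^sup>+t. ?n t \<partial>lborel) \<le> (\<integral>\<^sup>+t. ennreal C1 * S t \<partial>lborel)"
        by (rule nn_integral_mono_AE) (use frame in eventually_elim, simp)
      then show ?thesis by (simp add: HS nn_integral_cmult)
    qed
    have upper: "(\<integral>\<^sup>+t. S t \<partial>lborel) \<le> ennreal C2 * ennreal ((HS_norm H)\<^sup>2)"
    proof -
      have "(\<integral>\<^sup>+t. S t \<partial>lborel) \<le> (\<integral>\<^sup>+t. ennreal C2 * ?n t \<partial>lborel)"
        by (rule nn_integral_mono_AE) (use frame in eventually_elim, simp)
      then show ?thesis by (simp add: HS nn_integral_cmult)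
    qed
    have fin: "(\<integral>\<^sup>+t. S t \<partial>lborel) < \<infinity>"
      using upper by (rule le_less_trans) (simp add: ennreal_mult_less_top)
    have sq: "square_integrable lborel ?out"
      using fin out by (subst square_integrable_iff_nn_integral[OF meas]) simp
    have L2: "(\<integral>\<^sup>+t. S t \<partial>lborel) = ennreal ((L2_norm lborel ?out)\<^sup>2)"
      using nn_integral_eq_L2_norm[OF sq] out by simp
    have nn: "0 \<le> HS_norm H" by (simp add: HS_norm_def)
    have "(HS_norm H)\<^sup>2 \<le> C1 * (L2_norm lborel ?out)\<^sup>2"
      using lower C1(1) by (simp add: L2 ennreal_mult[symmetric])
    then have "sqrt ((HS_norm H)\<^sup>2) \<le> sqrt (C1 * (L2_norm lborel ?out)\<^sup>2)" by (rule real_sqrt_le_mono)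
    then have l: "HS_norm H \<le> sqrt C1 * L2_norm lborel ?out"
      using nn by (simp add: real_sqrt_mult)
    have "(L2_norm lborel ?out)\<^sup>2 \<le> C2 * (HS_norm H)\<^sup>2"
      using upper C2(1) by (simp add: L2 ennreal_mult[symmetric])
    then have "sqrt ((L2_norm lborel ?out)\<^sup>2) \<le> sqrt (C2 * (HS_norm H)\<^sup>2)" by (rule real_sqrt_le_mono)
    then have u: "L2_norm lborel ?out \<le> sqrt C2 * HS_norm H"
      using nn by (simp add: real_sqrt_mult)
    show ?thesis using sq l u C1(1) by (simp add: field_simps)
  qed
  have "delta_train_identifies (\<lambda>_. 1) \<Lambda> (OPW ({0..T} \<times> {- \<Omega> / 2..\<Omega> / 2}))"
    unfolding delta_train_identifies_def
    using main C1(1) C2(1) by (intro exI[of _ "1 / sqrt C1"] exI[of _ "sqrt C2"] conjI) auto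
  moreover have "bounded (range (\<lambda>_::int. 1 :: complex))" by simp
  ultimately show ?thesis
    unfolding set_of_sampling_def using delta_train_one_in_S0_dual[OF sep] by blast
qed

subsection \<open>The necessary condition\<close>

lemma pw_cong_AE:
  assumes "F \<in> borel_measurable lborel" "G \<in> borel_measurable lborel" "AE \<nu> in lborel. F \<nu> = G \<nu>"
  shows "pw F z = pw G z"
proof -
  note assms(1,2)[measurable]
  have "(\<lambda>\<nu>::real. exp (2 * pi * \<i> * z * \<nu>)) \<in> borel_measurable borel"
    by (intro borel_measurable_continuous_onI continuous_intros)
  note this[measurable]
  show ?thesis
    unfolding pw_def by (rule integral_cong_AE) (use assms(3) in \<open>auto elim!: eventually_mono\<close>)
qed

text \<open>Kernel of multiplication by \<open>f = inv_fourier F\<close> followed by convolution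
  with the indicator of \<open>{0..T}\<close>. Such an operator sends a point mass at
  \<open>y\<close> to \<open>f y\<close> times the indicator of \<open>{y..y + T}\<close>, so its
  response to a delta train shows nothing but weighted samples of \<open>f\<close>.\<close>

definition rank_shift_kernel :: "real \<Rightarrow> (real \<Rightarrow> complex) \<Rightarrow> real \<times> real \<Rightarrow> complex" where
  "rank_shift_kernel T F = (\<lambda>(x, y). indicator {0..T} (x - y) * inv_fourier F y)"

text \<open>For \<open>t\<close> in \<open>{0..T}\<close> the impulse response is \<open>f\<close>
  translated by \<open>t\<close>, whence the modulation of \<open>F\<close>.\<close>

definition rank_shift_spreading :: "real \<Rightarrow> (real \<Rightarrow> complex) \<Rightarrow> real \<times> real \<Rightarrow> complex" where
  "rank_shift_spreading T F = (\<lambda>(t, \<nu>). indicator {0..T} t * (F \<nu> * cis (- (2 * pi * t * \<nu>))))"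

lemma inv_fourier_modulate:
  "inv_fourier (\<lambda>\<nu>. c * (F \<nu> * cis (- (2 * pi * t * \<nu>)))) x = c * inv_fourier F (x - t)"
proof -
  have "c * (F \<nu> * cis (- (2 * pi * t * \<nu>))) * cis (2 * pi * x * \<nu>) = c * (F \<nu> * cis (2 * pi * (x - t) * \<nu>))" for \<nu>
  proof -
    have "cis (- (2 * pi * t * \<nu>)) * cis (2 * pi * x * \<nu>) = cis (2 * pi * (x - t) * \<nu>)"
      by (simp add: cis_mult algebra_simps)
    then show ?thesis by (simp only: mult.assoc)
  qed
  then show ?thesis unfolding inv_fourier_def by (simp only: integral_mult_right_zero)
qed

lemma rank_shift_kernel_square_integrable:
  assumes F: "bandlimited W F" and T: "T \<ge> 0"
  shows "square_integrable lborel (rank_shift_kernel T F)"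
proof -
  note bandlimitedD(2)[OF F, measurable]
  have [measurable]: "inv_fourier F \<in> borel_measurable borel"
    using borel_measurable_inv_fourier[of F] by simp
  have [measurable]: "rank_shift_kernel T F \<in> borel_measurable (borel \<Otimes>\<^sub>M borel)"
    unfolding rank_shift_kernel_def by measurable
  then have meas: "rank_shift_kernel T F \<in> borel_measurable lborel"
    unfolding borel_prod by simp
  note meas[measurable]
  have "energy lborel (\<lambda>z. rank_shift_kernel T F z)
    = (\<integral>\<^sup>+t. (energy lborel (\<lambda>x. rank_shift_kernel T F (x, x - t))) \<partial>lborel)"
    by (rule nn_integral_lborel_pair_shear) measurable
  also have "\<dots> = (\<integral>\<^sup>+t. ennreal ((L2_norm lborel F)\<^sup>2) * indicator {0..T} t \<partial>lborel)"
  proof (rule nn_integral_cong)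
    fix t :: real
    have "energy lborel (\<lambda>x. inv_fourier F (x - t)) = ennreal ((L2_norm lborel F)\<^sup>2)"
      using nn_integral_real_affine[of "\<lambda>x. ennreal ((cmod (inv_fourier F x))\<^sup>2)" 1 "- t"] nn_integral_pw[OF F]
      by (simp add: pw_of_real)
    then show "energy lborel (\<lambda>x. rank_shift_kernel T F (x, x - t)) = ennreal ((L2_norm lborel F)\<^sup>2) * indicator {0..T} t"
      by (auto simp: rank_shift_kernel_def indicator_def)
  qed
  also have "\<dots> < \<infinity>" using T by (simp add: nn_integral_cmult ennreal_mult_less_top)
  finally show ?thesis by (subst square_integrable_iff_nn_integral[OF meas])
qed

lemma ess_support_subset:
  assumes "closed S" "\<And>z. z \<notin> S \<Longrightarrow> F z = 0"
  shows "ess_support F \<subseteq> S"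
proof -
  have "- S \<subseteq> \<Union>{U. open U \<and> (AE z in lborel. z \<in> U \<longrightarrow> F z = 0)}"
    by (rule Union_upper) (use assms in auto)
  then show ?thesis unfolding ess_support_def by blast
qed

text \<open>Since \<open>F\<close> vanishes everywhere outside the band, the support can be read off
  pointwise. The same operator serves all \<open>T' \<ge> T\<close>: it belongs to the short strip,
  where responses are disjoint, and to the class that is assumed to be identified.\<close>

lemma rank_shift_operator:
  assumes F: "bandlimited \<Omega> F" and supp: "\<And>\<nu>. \<Omega> / 2 < \<bar>\<nu>\<bar> \<Longrightarrow> F \<nu> = 0" and T: "T > 0"
  shows "\<exists>H. (\<forall>T'\<ge>T. H \<in> OPW ({0..T'} \<times> {- \<Omega> / 2..\<Omega> / 2})) \<and>
    has_spreading_function H (rank_shift_spreading T F)"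
proof -
  define \<kappa> where "\<kappa> = rank_shift_kernel T F"
  define H where "H g x = (LINT t|lborel. \<kappa> (x, t) * g t)" for g x
  note bandlimitedD(2)[OF F, measurable]
  have [measurable]: "F \<in> borel_measurable borel" using bandlimitedD(2)[OF F] by simp
  have [measurable]: "inv_fourier F \<in> borel_measurable borel"
    using borel_measurable_inv_fourier[of F] by simp
  have \<kappa>: "has_kernel H \<kappa>"
    using rank_shift_kernel_square_integrable[OF F] T by (simp add: has_kernel_def H_def \<kappa>_def)
  have hs: "has_kernel H (hs_kernel H)"
    unfolding hs_kernel_def by (rule someI[of _ \<kappa>]) (rule \<kappa>)
  then have [measurable]: "hs_kernel H \<in> borel_measurable (borel \<Otimes>\<^sub>M borel)"
    by (simp add: has_kernel_def square_integrable_def borel_prod)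
  have spread_meas[measurable]: "rank_shift_spreading T F \<in> borel_measurable (borel \<Otimes>\<^sub>M borel)"
    unfolding rank_shift_spreading_def by measurable
  have sq: "square_integrable lborel (rank_shift_spreading T F)"
  proof -
    have meas: "rank_shift_spreading T F \<in> borel_measurable lborel"
      using spread_meas unfolding borel_prod by simp
    have "(\<integral>\<^sup>+z. ennreal ((cmod (rank_shift_spreading T F z))\<^sup>2) \<partial>(lborel \<Otimes>\<^sub>M lborel))
      = (\<integral>\<^sup>+t. (energy lborel (\<lambda>\<nu>. rank_shift_spreading T F (t, \<nu>))) \<partial>lborel)"
      by (rule lborel.nn_integral_fst[symmetric]) measurable
    also have "\<dots> = (\<integral>\<^sup>+t. ennreal ((L2_norm lborel F)\<^sup>2) * indicator {0..T} t \<partial>lborel)"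
      using nn_integral_eq_L2_norm[OF bandlimitedD(1)[OF F]]
      by (intro nn_integral_cong) (auto simp: rank_shift_spreading_def indicator_def norm_mult)
    also have "\<dots> < \<infinity>" using T by (simp add: nn_integral_cmult ennreal_mult_less_top)
    finally show ?thesis by (subst square_integrable_iff_nn_integral[OF meas]) (simp only: lborel_prod)
  qed
  have "AE t in lborel. AE x in lborel. hs_kernel H (x, x - t) = \<kappa> (x, x - t)"
    by (rule AE_lborel_pair_shear[OF has_kernel_unique[OF hs \<kappa>]])
  then have "AE t in lborel. has_L2_fourier (impulse_response H t) (\<lambda>\<nu>. rank_shift_spreading T F (t, \<nu>))"
  proof eventually_elim
    case (elim t)
    let ?c = "indicator {0..T} t :: complex"
    let ?F = "\<lambda>\<nu>. ?c * (F \<nu> * cis (- (2 * pi * t * \<nu>)))"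
    have int: "integrable lborel ?F"
      by (intro integrable_mult_right integrable_mult_cis bandlimitedD(3)[OF F]) measurable
    have "square_integrable lborel (\<lambda>\<nu>. F \<nu> * cis (- (2 * pi * t * \<nu>)))"
      using bandlimitedD(1)[OF F] by (auto simp: square_integrable_def norm_mult)
    then have sqF: "square_integrable lborel ?F" by (rule square_integrable_cmult)
    have "has_L2_fourier (inv_fourier ?F) ?F" by (rule has_L2_fourier_inv_fourier[OF int sqF])
    moreover have "impulse_response H t \<in> borel_measurable borel"
      unfolding impulse_response_def by measurable
    moreover have "AE x in lborel. inv_fourier ?F x = impulse_response H t x"
      using elim
    proof eventually_elim
      case (elim x)
      then show ?case unfolding inv_fourier_modulate by (simp add: impulse_response_def \<kappa>_def rank_shift_kernel_def)
    qed
    ultimately have "has_L2_fourier (impulse_response H t) ?F" by (rule has_L2_fourier_cong_AE)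
    then show ?case by (simp add: rank_shift_spreading_def)
  qed
  with sq have spread: "has_spreading_function H (rank_shift_spreading T F)"
    by (simp add: has_spreading_function_def)
  have "H \<in> OPW ({0..T'} \<times> {- \<Omega> / 2..\<Omega> / 2})" if "T' \<ge> T" for T'
  proof -
    have "rank_shift_spreading T F z = 0" if "z \<notin> {0..T'} \<times> {- \<Omega> / 2..\<Omega> / 2}" for z
      using that \<open>T' \<ge> T\<close> supp[of "snd z"] by (cases z) (auto simp: rank_shift_spreading_def indicator_def abs_if split: if_splits)
    then have "ess_support (rank_shift_spreading T F) \<subseteq> {0..T'} \<times> {- \<Omega> / 2..\<Omega> / 2}"
      by (intro ess_support_subset closed_Times) auto
    then show ?thesis using spread \<kappa> by (auto simp: OPW_def HS_operators_def)
  qed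
  then show ?thesis using spread by blast
qed

text \<open>The squared norm of a test operator from \<open>rank_shift_operator\<close> and the
  bound on its response both carry the factor \<open>T'\<close>, so it cancels; the weights enter
  only through their bound \<open>M\<close>.\<close>

lemma operator_sampling_imp_pw_sampling:
  assumes T: "T > 0" and \<Omega>: "\<Omega> > 0" and sep: "separated \<delta> \<Lambda>"
    and sampling: "set_of_sampling \<Lambda> (OPW ({0..T} \<times> {- \<Omega> / 2..\<Omega> / 2}))"
  shows "\<exists>C>0. \<forall>F. bandlimited \<Omega> F \<longrightarrow> (\<forall>\<nu>. \<Omega> / 2 < \<bar>\<nu>\<bar> \<longrightarrow> F \<nu> = 0) \<longrightarrow>
    ennreal ((L2_norm lborel F)\<^sup>2) \<le> ennreal C * sample_energy \<Lambda> F"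
proof -
  obtain c A where c: "bounded (range c)" and A: "A > 0"
    and ident: "\<And>H. H \<in> OPW ({0..T} \<times> {- \<Omega> / 2..\<Omega> / 2}) \<Longrightarrow> square_integrable lborel (apply_delta_train H c \<Lambda>) \<and>
        A * HS_norm H \<le> L2_norm lborel (apply_delta_train H c \<Lambda>)"
    using sampling unfolding set_of_sampling_def delta_train_identifies_def by blast
  obtain M where M: "M > 0" "\<And>k. cmod (c k) \<le> M"
    using c by (auto simp: bounded_pos)
  \<comment> \<open>On a strip of this width the responses to distinct points do not overlap, and
    the operators still lie in the class for \<open>T\<close>.\<close>
  define T' where "T' = min T \<delta>"
  have T': "T' > 0" "T' \<le> T" "T' \<le> \<delta>" using T sep by (auto simp: T'_def separated_def)
  have gap: "\<forall>k. \<Lambda> (k + 1) - \<Lambda> k \<ge> T'" using sep T' by (auto simp: separated_def intro: order_trans)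
  show ?thesis
  proof (intro exI[of _ "M\<^sup>2 / A\<^sup>2"] conjI allI impI)
    show "M\<^sup>2 / A\<^sup>2 > 0" using M A by simp
    fix F assume F: "bandlimited \<Omega> F" and supp: "\<forall>\<nu>. \<Omega> / 2 < \<bar>\<nu>\<bar> \<longrightarrow> F \<nu> = 0"
    obtain H where H: "\<And>S. S \<ge> T' \<Longrightarrow> H \<in> OPW ({0..S} \<times> {- \<Omega> / 2..\<Omega> / 2})"
      and spread: "has_spreading_function H (rank_shift_spreading T' F)"
      using rank_shift_operator[OF F _ T'(1)] supp by blast
    note P = OPW_properties[OF H[OF order_refl]]
    let ?out = "apply_delta_train H c \<Lambda>" and ?\<sigma> = "spreading_function H"
    let ?S = "\<integral>\<^sup>+k. ennreal ((cmod (pw F (\<Lambda> k)))\<^sup>2) \<partial>count_space UNIV"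
    let ?N = "ennreal ((L2_norm lborel F)\<^sup>2)"
    note bandlimitedD(2)[OF F, measurable]
    have [measurable]: "?\<sigma> \<in> borel_measurable (borel \<Otimes>\<^sub>M borel)"
      using P(2) by (simp add: has_spreading_function_def square_integrable_def borel_prod)
    have HS: "ennreal ((HS_norm H)\<^sup>2) = ennreal T' * ?N"
    proof -
      have "ennreal ((HS_norm H)\<^sup>2) = (\<integral>\<^sup>+t. ennreal ((L2_norm lborel (\<lambda>\<nu>. rank_shift_spreading T' F (t, \<nu>)))\<^sup>2) \<partial>lborel)"
        by (rule HS_norm_eq_spreading[OF P(1) spread])
      also have "\<dots> = (\<integral>\<^sup>+t. ?N * indicator {0..T'} t \<partial>lborel)"
        by (intro nn_integral_cong) (auto simp: rank_shift_spreading_def indicator_def L2_norm_def norm_mult)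
      also have "\<dots> = ?N * (\<integral>\<^sup>+t. indicator {0..T'} t \<partial>lborel)" by (rule nn_integral_cmult) simp
      finally show ?thesis using T' by (simp add: mult.commute)
    qed
    have "AE t in lborel. AE \<nu> in lborel. ?\<sigma> (t, \<nu>) = rank_shift_spreading T' F (t, \<nu>)"
      by (rule has_spreading_function_unique[OF P(2) spread])
    \<comment> \<open>The modulation in the spreading function cancels the shift by
      \<open>t\<close>: at \<open>\<Lambda> k + t\<close>, almost every section with
      \<open>t\<close> in \<open>{0..T'}\<close> shows the same value
      \<open>pw F (\<Lambda> k)\<close>.\<close>
    then have cont: "AE t in lborel. \<forall>k. impulse_response_cont H t (\<Lambda> k + t) = indicator {0..T'} t * pw F (\<Lambda> k)"
    proof eventually_elim
      case (elim t)
      have "impulse_response_cont H t (\<Lambda> k + t) = indicator {0..T'} t * pw F (\<Lambda> k)" for k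
      proof -
        have "impulse_response_cont H t (\<Lambda> k + t) = pw (\<lambda>\<nu>. rank_shift_spreading T' F (t, \<nu>)) (complex_of_real (\<Lambda> k + t))"
          unfolding impulse_response_cont_eq_pw
          by (rule pw_cong_AE[OF _ _ elim]) (auto simp: rank_shift_spreading_def)
        also have "\<dots> = indicator {0..T'} t * inv_fourier F (\<Lambda> k + t - t)"
          unfolding pw_of_real rank_shift_spreading_def prod.case inv_fourier_modulate ..
        finally show ?thesis by (simp add: pw_of_real)
      qed
      then show ?case by blast
    qed
    have "ennreal ((L2_norm lborel ?out)\<^sup>2) = energy lborel ?out"
      using ident[OF H[OF T'(2)]] by (simp add: nn_integral_eq_L2_norm)
    also have "\<dots> = (\<integral>\<^sup>+t. (energy (count_space UNIV) (\<lambda>k. c k * impulse_response_cont H t (\<Lambda> k + t))) \<partial>lborel)"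
      by (rule apply_delta_train_nn_integral(2)[OF H[OF order_refl] gap T'(1)])
    also have "\<dots> \<le> (\<integral>\<^sup>+t. ennreal (M\<^sup>2) * ?S * indicator {0..T'} t \<partial>lborel)"
    proof (rule nn_integral_mono_AE)
      show "AE t in lborel. (energy (count_space UNIV) (\<lambda>k. c k * impulse_response_cont H t (\<Lambda> k + t))) \<le> ennreal (M\<^sup>2) * ?S * indicator {0..T'} t"
        using cont
      proof eventually_elim
        case (elim t)
        have "energy (count_space UNIV) (\<lambda>k. c k * impulse_response_cont H t (\<Lambda> k + t))
          \<le> (\<integral>\<^sup>+k. (ennreal (M\<^sup>2) * indicator {0..T'} t) * ennreal ((cmod (pw F (\<Lambda> k)))\<^sup>2) \<partial>count_space UNIV)"
        proof (rule nn_integral_mono)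
          fix k
          have "(cmod (c k))\<^sup>2 * (cmod (pw F (\<Lambda> k)))\<^sup>2 \<le> M\<^sup>2 * (cmod (pw F (\<Lambda> k)))\<^sup>2"
            by (intro mult_right_mono power_mono M) auto
          then show "ennreal ((cmod (c k * impulse_response_cont H t (\<Lambda> k + t)))\<^sup>2) \<le> (ennreal (M\<^sup>2) * indicator {0..T'} t) * ennreal ((cmod (pw F (\<Lambda> k)))\<^sup>2)"
            using elim by (auto simp: indicator_def norm_mult power_mult_distrib ennreal_mult[symmetric])
        qed
        also have "\<dots> = (ennreal (M\<^sup>2) * indicator {0..T'} t) * ?S" by (rule nn_integral_cmult) simp
        finally show ?case by (simp only: mult_ac)
      qed
    qed
    also have "\<dots> = ennreal (M\<^sup>2) * ?S * ennreal T'" using T' by (simp add: nn_integral_cmult)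
    finally have out: "ennreal ((L2_norm lborel ?out)\<^sup>2) \<le> ennreal (M\<^sup>2) * ?S * ennreal T'" .
    have "0 \<le> HS_norm H" by (simp add: HS_norm_def)
    then have "(A * HS_norm H)\<^sup>2 \<le> (L2_norm lborel ?out)\<^sup>2"
      using ident[OF H[OF T'(2)]] A by (intro power_mono) auto
    then have "ennreal (A\<^sup>2) * ennreal ((HS_norm H)\<^sup>2) \<le> ennreal ((L2_norm lborel ?out)\<^sup>2)"
      by (simp add: ennreal_mult[symmetric] power_mult_distrib ennreal_leI)
    then have le: "ennreal (A\<^sup>2) * (ennreal T' * ?N) \<le> ennreal (M\<^sup>2) * ?S * ennreal T'"
      unfolding HS using out by (rule order_trans)
    have "ennreal (1 / (A\<^sup>2 * T')) * (ennreal (A\<^sup>2) * (ennreal T' * ?N)) \<le> ennreal (1 / (A\<^sup>2 * T')) * (ennreal (M\<^sup>2) * ?S * ennreal T')"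
      by (rule mult_left_mono[OF le]) simp
    moreover have "ennreal (1 / (A\<^sup>2 * T')) * (ennreal (A\<^sup>2) * (ennreal T' * ?N)) = ?N"
      using A T' by (simp add: ennreal_mult[symmetric])
    moreover have "ennreal (1 / (A\<^sup>2 * T')) * (ennreal (M\<^sup>2) * ?S * ennreal T') = ennreal (M\<^sup>2 / A\<^sup>2) * ?S"
    proof -
      have "ennreal (1 / (A\<^sup>2 * T')) * ennreal (M\<^sup>2) * ennreal T' = ennreal (M\<^sup>2 / A\<^sup>2)"
        using A T' by (simp add: ennreal_mult[symmetric])
      moreover have "x * (m * ?S * t) = (x * m * t) * ?S" for x m t :: ennreal by (simp only: mult_ac)
      ultimately show ?thesis by (simp only:)
    qed
    ultimately show "?N \<le> ennreal (M\<^sup>2 / A\<^sup>2) * ?S" by simp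
  qed
qed


section \<open>A band-limited window with quadratic decay\<close>

definition cos_window :: "real \<Rightarrow> real \<Rightarrow> complex" where
  "cos_window \<Omega> \<nu> = complex_of_real (indicator {- (\<Omega> / 2)..\<Omega> / 2} \<nu> * cos (pi * \<nu> / \<Omega>))"

lemma borel_measurable_cos_window [measurable]: "cos_window \<Omega> \<in> borel_measurable borel"
  unfolding cos_window_def[abs_def] by measurable

lemma norm_cos_window_le: "cmod (cos_window \<Omega> \<nu>) \<le> indicator {- (\<Omega> / 2)..\<Omega> / 2} \<nu>"
  by (simp add: cos_window_def indicator_def abs_le_iff cos_ge_minus_one minus_le_iff)

lemma integrable_indicator_Icc [simp]: "integrable lborel (\<lambda>x::real. indicator {a..b} x :: real)"
  by (intro integrable_real_indicator) (auto simp: emeasure_lborel_Icc_eq)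

lemma integrable_cos_window: "integrable lborel (cos_window \<Omega>)"
  by (rule Bochner_Integration.integrable_bound[of _ "\<lambda>x. indicator {- (\<Omega> / 2)..\<Omega> / 2} x :: real"])
     (use norm_cos_window_le in auto)

text \<open>The antiderivative of \<open>cos (\<beta> \<nu>) e\<^bsup>i\<omega>\<nu>\<^esup>\<close> is explicit, and the boundary terms with the
  factor \<open>cos\<close> vanish; this is what gives the quadratic decay.\<close>

lemma inv_fourier_cos_window:
  assumes \<Omega>: "\<Omega> > 0"
  defines "\<beta> \<equiv> pi / \<Omega>"
  shows "\<bar>\<beta>\<^sup>2 - (2 * pi * x)\<^sup>2\<bar> * cmod (inv_fourier (cos_window \<Omega>) x) \<le> 2 * \<beta>"
proof -
  define \<omega> where "\<omega> = 2 * pi * x"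
  define E where "E \<nu> = cis (\<omega> * \<nu>) * (\<i> * \<omega> * cos (\<beta> * \<nu>) + \<beta> * sin (\<beta> * \<nu>))" for \<nu> :: real
  let ?f = "\<lambda>\<nu>. complex_of_real ((\<beta>\<^sup>2 - \<omega>\<^sup>2) * cos (\<beta> * \<nu>)) * cis (\<omega> * \<nu>)"
  have deriv: "(E has_vector_derivative ?f \<nu>) (at \<nu> within S)" for \<nu> S
  proof -
    have "(E has_vector_derivative
        (cis (\<omega> * \<nu>) * (\<i> * \<omega> * (- (\<beta> * sin (\<beta> * \<nu>))) + \<beta> * (\<beta> * cos (\<beta> * \<nu>)))
         + (\<omega> *\<^sub>R (\<i> * cis (\<omega> * \<nu>))) * (\<i> * \<omega> * cos (\<beta> * \<nu>) + \<beta> * sin (\<beta> * \<nu>)))) (at \<nu> within S)"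
    proof -
      have 1: "((\<lambda>\<nu>. cis (\<omega> * \<nu>)) has_vector_derivative \<omega> *\<^sub>R (\<i> * cis (\<omega> * \<nu>))) (at \<nu> within S)"
      proof -
        have "((\<lambda>z. exp (\<i> * \<omega> * z)) has_field_derivative \<i> * \<omega> * exp (\<i> * \<omega> * \<nu>)) (at (complex_of_real \<nu>))"
          by (auto intro!: derivative_eq_intros)
        from has_vector_derivative_real_field[OF this, of S] show ?thesis
          by (simp add: cis_conv_exp scaleR_conv_of_real mult_ac)
      qed
      have 2: "((\<lambda>\<nu>. complex_of_real (cos (\<beta> * \<nu>))) has_vector_derivative complex_of_real (- (\<beta> * sin (\<beta> * \<nu>)))) (at \<nu> within S)"
        by (rule has_vector_derivative_of_real) (auto intro!: derivative_eq_intros)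
      have 3: "((\<lambda>\<nu>. complex_of_real (\<beta> * sin (\<beta> * \<nu>))) has_vector_derivative complex_of_real (\<beta> * (\<beta> * cos (\<beta> * \<nu>)))) (at \<nu> within S)"
        by (rule has_vector_derivative_of_real) (auto intro!: derivative_eq_intros)
      show ?thesis
        unfolding E_def
        by (rule has_vector_derivative_eq_rhs[OF has_vector_derivative_mult[OF 1 has_vector_derivative_add[OF
              has_vector_derivative_mult_right[OF 2] 3]]]) simp
    qed
    then show ?thesis
      by (rule has_vector_derivative_eq_rhs) (simp add: scaleR_conv_of_real algebra_simps power2_eq_square)
  qed
  have "(LINT \<nu>|lborel. indicator {- (\<Omega> / 2)..\<Omega> / 2} \<nu> *\<^sub>R ?f \<nu>) = E (\<Omega> / 2) - E (- (\<Omega> / 2))"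
    using \<Omega> by (intro integral_FTC_Icc deriv continuous_intros) auto
  moreover have "(LINT \<nu>|lborel. indicator {- (\<Omega> / 2)..\<Omega> / 2} \<nu> *\<^sub>R ?f \<nu>) = complex_of_real (\<beta>\<^sup>2 - \<omega>\<^sup>2) * inv_fourier (cos_window \<Omega>) x"
    unfolding inv_fourier_def integral_mult_right_zero[symmetric]
    by (intro Bochner_Integration.integral_cong)
       (auto simp: cos_window_def indicator_def \<beta>_def \<omega>_def mult_ac)
  moreover have "cmod (E (\<Omega> / 2) - E (- (\<Omega> / 2))) \<le> 2 * \<beta>"
  proof -
    have b: "\<beta> * (\<Omega> / 2) = pi / 2" "\<beta> > 0" using \<Omega> by (auto simp: \<beta>_def)
    have "cmod (E (\<Omega> / 2)) = \<beta>" "cmod (E (- (\<Omega> / 2))) = \<beta>"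
      using b unfolding E_def mult_minus_right b(1) by (simp_all add: norm_mult)
    then show ?thesis using norm_triangle_ineq4[of "E (\<Omega> / 2)" "E (- (\<Omega> / 2))"] by simp
  qed
  ultimately have "cmod (complex_of_real (\<beta>\<^sup>2 - \<omega>\<^sup>2) * inv_fourier (cos_window \<Omega>) x) \<le> 2 * \<beta>" by simp
  then show ?thesis by (simp only: norm_mult norm_of_real \<omega>_def)
qed

text \<open>The cosine vanishes at the band edges, which buys decay of order
  \<open>1 / x\<^sup>2\<close>, summable over separated points; the plain indicator of the band
  would give only \<open>1 / \<bar>x\<bar>\<close>. Where the factor in
  \<open>inv_fourier_cos_window\<close> may be small, \<open>x\<close> is bounded and the trivial
  bound \<open>\<Omega>\<close> takes over.\<close>

lemma inv_fourier_cos_window_decay: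
  assumes \<Omega>: "\<Omega> > 0"
  shows "\<exists>K>0. \<forall>x. cmod (inv_fourier (cos_window \<Omega>) x) \<le> K / (1 + x\<^sup>2)"
proof -
  define \<beta> where "\<beta> = pi / \<Omega>"
  have \<beta>: "\<beta> > 0" using \<Omega> by (simp add: \<beta>_def)
  let ?g = "\<lambda>x. cmod (inv_fourier (cos_window \<Omega>) x)"
  have bounded: "?g x \<le> \<Omega>" for x
  proof -
    have "?g x \<le> (LINT \<nu>|lborel. cmod (cos_window \<Omega> \<nu>))"
      using norm_fourier_le by (simp add: inv_fourier_eq_fourier)
    also have "\<dots> \<le> (LINT \<nu>|lborel. indicator {- (\<Omega> / 2)..\<Omega> / 2} \<nu>)"
      by (intro integral_mono norm_cos_window_le) (use integrable_cos_window in auto)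
    finally show ?thesis using \<Omega> by simp
  qed
  have decay: "x\<^sup>2 * ?g x \<le> max \<beta> (\<beta>\<^sup>2 * \<Omega>)" for x
  proof (cases "2 * \<beta>\<^sup>2 \<le> (2 * pi * x)\<^sup>2")
    case True
    have "1 * x\<^sup>2 \<le> pi\<^sup>2 * x\<^sup>2" using pi_ge_two by (intro mult_right_mono) (auto intro: order_trans[of _ "2\<^sup>2"] power_mono)
    then have "2 * x\<^sup>2 \<le> (2 * pi * x)\<^sup>2 / 2" by (simp add: power_mult_distrib)
    also have "\<dots> \<le> \<bar>\<beta>\<^sup>2 - (2 * pi * x)\<^sup>2\<bar>" using True by linarith
    finally have "(2 * x\<^sup>2) * ?g x \<le> \<bar>\<beta>\<^sup>2 - (2 * pi * x)\<^sup>2\<bar> * ?g x" by (intro mult_right_mono) auto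
    also have "\<dots> \<le> 2 * \<beta>" using inv_fourier_cos_window[OF \<Omega>] by (simp add: \<beta>_def)
    finally show ?thesis by simp
  next
    case False
    have "1 * x\<^sup>2 \<le> pi\<^sup>2 * x\<^sup>2" using pi_ge_two by (intro mult_right_mono) (auto intro: order_trans[of _ "2\<^sup>2"] power_mono)
    moreover have "0 \<le> pi\<^sup>2 * x\<^sup>2" by simp
    moreover have "2 * (pi\<^sup>2 * x\<^sup>2) < \<beta>\<^sup>2" using False by (simp add: power_mult_distrib)
    ultimately have "x\<^sup>2 \<le> \<beta>\<^sup>2" by linarith
    then have "x\<^sup>2 * ?g x \<le> \<beta>\<^sup>2 * \<Omega>" by (intro mult_mono bounded) auto
    then show ?thesis by simp
  qed
  show ?thesis
  proof (intro exI[of _ "\<Omega> + max \<beta> (\<beta>\<^sup>2 * \<Omega>)"] conjI allI)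
    show "\<Omega> + max \<beta> (\<beta>\<^sup>2 * \<Omega>) > 0" using \<Omega> \<beta> by simp
    fix x
    have "?g x * (1 + x\<^sup>2) \<le> \<Omega> + max \<beta> (\<beta>\<^sup>2 * \<Omega>)"
      using add_mono[OF bounded decay, of x x] by (simp add: algebra_simps)
    moreover have "0 < 1 + x\<^sup>2" by (simp add: add_pos_nonneg)
    ultimately show "?g x \<le> (\<Omega> + max \<beta> (\<beta>\<^sup>2 * \<Omega>)) / (1 + x\<^sup>2)" by (simp add: pos_le_divide_eq)
  qed
qed

text \<open>Elimination by induction on the equations: one unknown \<open>i\<close> with a nonzero
  coefficient in equation \<open>k\<close> is solved for, and the others satisfy one equation
  fewer.\<close>

lemma homogeneous_system_solution:
  fixes M :: "'k \<Rightarrow> 'j \<Rightarrow> 'a::field"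
  assumes "finite K" "finite J" "card K < card J"
  shows "\<exists>a. (\<exists>j\<in>J. a j \<noteq> 0) \<and> (\<forall>k\<in>K. (\<Sum>j\<in>J. M k j * a j) = 0)"
  using assms
proof (induction K arbitrary: J M rule: finite_induct)
  case empty
  then obtain j where "j \<in> J" by fastforce
  then show ?case by (intro exI[of _ "\<lambda>_. 1"]) auto
next
  case (insert k K)
  show ?case
  proof (cases "\<forall>j\<in>J. M k j = 0")
    case True
    have "card K < card J" using insert by simp
    from insert.IH[OF insert.prems(1) this, of M] obtain a where
      "\<exists>j\<in>J. a j \<noteq> 0" "\<forall>k\<in>K. (\<Sum>j\<in>J. M k j * a j) = 0" by blast
    with True show ?thesis by (intro exI[of _ a]) auto
  next
    case False
    then obtain i where i: "i \<in> J" "M k i \<noteq> 0" by blast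
    define L where "L = J - {i}"
    have L: "finite L" "card K < card L" "J = insert i L" "i \<notin> L"
      using insert.prems insert.hyps i by (auto simp: L_def)
    from insert.IH[OF L(1,2), of "\<lambda>k' j. M k' j - M k' i * M k j / M k i"] obtain a where
      a: "\<exists>j\<in>L. a j \<noteq> 0" "\<And>k'. k' \<in> K \<Longrightarrow> (\<Sum>j\<in>L. (M k' j - M k' i * M k j / M k i) * a j) = 0" by blast
    define s where "s = (\<Sum>j\<in>L. M k j * a j)"
    \<comment> \<open>The value at \<open>i\<close> is the one that satisfies equation
      \<open>k\<close>.\<close>
    define b where "b = a(i := - s / M k i)"
    have sum_b: "(\<Sum>j\<in>J. M k' j * b j) = (\<Sum>j\<in>L. M k' j * a j) - M k' i * s / M k i" for k'
    proof -
      have "(\<Sum>j\<in>L. M k' j * b j) = (\<Sum>j\<in>L. M k' j * a j)"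
        using L by (intro sum.cong) (auto simp: b_def)
      then show ?thesis using L by (simp add: b_def)
    qed
    have "(\<Sum>j\<in>J. M k' j * b j) = 0" if "k' \<in> K" for k'
    proof -
      have "(\<Sum>j\<in>L. (M k' j - M k' i * M k j / M k i) * a j)
        = (\<Sum>j\<in>L. M k' j * a j) - (\<Sum>j\<in>L. (M k' i / M k i) * (M k j * a j))"
        by (subst sum_subtractf[symmetric]) (intro sum.cong, auto simp: algebra_simps)
      also have "(\<Sum>j\<in>L. (M k' i / M k i) * (M k j * a j)) = M k' i * s / M k i"
        unfolding sum_distrib_left[symmetric] s_def by simp
      finally show ?thesis using a(2)[OF that] sum_b[of k'] by simp
    qed
    moreover have "(\<Sum>j\<in>J. M k j * b j) = 0" using i by (simp add: sum_b s_def[symmetric])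
    moreover have "\<exists>j\<in>J. b j \<noteq> 0" using a(1) L by (auto simp: b_def)
    ultimately show ?thesis by blast
  qed
qed


section \<open>Tails of sums over separated points\<close>

definition cauchy_tail :: "real \<Rightarrow> ennreal" where
  "cauchy_tail r = (\<integral>\<^sup>+s. ennreal (1 / (1 + s\<^sup>2)) * indicator {s. r \<le> \<bar>s\<bar>} s \<partial>lborel)"

lemma integrable_cauchy: "integrable lborel (\<lambda>s::real. 1 / (1 + s\<^sup>2))"
  using integrable_inverse_1_plus_square
  by (simp add: set_integrable_def einterval_eq_UNIV inverse_eq_divide)

lemma cauchy_tail_finite: "cauchy_tail r < \<infinity>"
proof -
  have "cauchy_tail r \<le> (\<integral>\<^sup>+s. ennreal (1 / (1 + s\<^sup>2)) \<partial>lborel)"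
    unfolding cauchy_tail_def by (intro nn_integral_mono) (auto simp: indicator_def)
  also have "\<dots> < \<infinity>"
    using integrable_cauchy by (subst nn_integral_eq_integral) auto
  finally show ?thesis .
qed

lemma cauchy_tail_small:
  assumes "\<epsilon> > 0"
  shows "\<exists>r\<ge>0. cauchy_tail r \<le> ennreal \<epsilon>"
proof -
  let ?f = "\<lambda>n s. 1 / (1 + s\<^sup>2) * indicator {s. real n \<le> \<bar>s\<bar>} s :: real"
  have "(\<lambda>n. LINT s|lborel. ?f n s) \<longlonglongrightarrow> (LINT s|(lborel :: real measure). (0::real))"
  proof (rule integral_dominated_convergence[where w="\<lambda>s. 1 / (1 + s\<^sup>2)"])
    show "integrable lborel (\<lambda>s::real. 1 / (1 + s\<^sup>2))" by (rule integrable_cauchy)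
    show "AE s in lborel. (\<lambda>n. ?f n s) \<longlonglongrightarrow> 0"
    proof (rule AE_I2)
      fix s :: real
      obtain m where m: "\<bar>s\<bar> < real m" using reals_Archimedean2 by blast
      then have "eventually (\<lambda>n. ?f n s = 0) sequentially"
        by (intro eventually_sequentiallyI[of m]) (auto simp: indicator_def)
      then show "(\<lambda>n. ?f n s) \<longlonglongrightarrow> 0" by (rule tendsto_eventually)
    qed
    show "AE s in lborel. norm (?f n s) \<le> 1 / (1 + s\<^sup>2)" for n
      by (auto simp: indicator_def add_nonneg_nonneg)
  qed auto
  then have "eventually (\<lambda>n. (LINT s|lborel. ?f n s) < \<epsilon>) sequentially"
    using assms by (intro order_tendstoD(2)) auto
  then obtain n where n: "(LINT s|lborel. ?f n s) < \<epsilon>"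
    by (auto simp: eventually_sequentially)
  have int: "integrable lborel (?f n)"
    by (rule Bochner_Integration.integrable_bound[OF integrable_cauchy]) (auto simp: indicator_def)
  have "cauchy_tail (real n) = (\<integral>\<^sup>+s. ennreal (?f n s) \<partial>lborel)"
    unfolding cauchy_tail_def by (intro nn_integral_cong) (auto simp: indicator_def)
  also have "\<dots> = ennreal (LINT s|lborel. ?f n s)"
    by (rule nn_integral_eq_integral[OF int]) (auto simp: indicator_def add_nonneg_nonneg)
  also have "\<dots> \<le> ennreal \<epsilon>" using n by (intro ennreal_leI) simp
  finally show ?thesis by (intro exI[of _ "real n"]) simp
qed

text \<open>Each term is compared with the integral over the interval of length
  \<open>\<delta>\<close> to the right of \<open>\<mu> k\<close>: a shift by at most
  \<open>\<delta>\<close> enlarges \<open>1 + p\<^sup>2\<close> at most by the factor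
  \<open>2 * (1 + \<delta>\<^sup>2)\<close>. Cutting at \<open>r + \<delta>\<close> keeps the whole
  interval outside the radius \<open>r\<close>.\<close>

lemma separated_cauchy_sum_le:
  assumes sep: "separated \<delta> \<mu>"
  shows "(\<integral>\<^sup>+k. ennreal (1 / (1 + (\<mu> k - y)\<^sup>2)) * indicator {k. r + \<delta> \<le> \<bar>\<mu> k - y\<bar>} k \<partial>count_space UNIV)
    \<le> ennreal (2 * (1 + \<delta>\<^sup>2) / \<delta>) * cauchy_tail r"
proof -
  have \<delta>: "\<delta> > 0" using sep by (simp add: separated_def)
  let ?g = "\<lambda>t. ennreal (1 / (1 + (t - y)\<^sup>2)) * indicator {s. r \<le> \<bar>s\<bar>} (t - y)"
  let ?w = "\<lambda>k. ennreal (1 / (1 + (\<mu> k - y)\<^sup>2)) * indicator {k. r + \<delta> \<le> \<bar>\<mu> k - y\<bar>} k"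
  have single: "?w k \<le> ennreal (2 * (1 + \<delta>\<^sup>2) / \<delta>) * (\<integral>\<^sup>+t. ?g t * indicator {\<mu> k..<\<mu> k + \<delta>} t \<partial>lborel)" for k
  proof -
    have le: "?w k * indicator {\<mu> k..<\<mu> k + \<delta>} t \<le> ennreal (2 * (1 + \<delta>\<^sup>2)) * (?g t * indicator {\<mu> k..<\<mu> k + \<delta>} t)" for t
    proof (cases "t \<in> {\<mu> k..<\<mu> k + \<delta>} \<and> r + \<delta> \<le> \<bar>\<mu> k - y\<bar>")
      case True
      then have r: "r \<le> \<bar>t - y\<bar>" by auto
      define p q where "p = \<mu> k - y" and "q = t - \<mu> k"
      have q: "0 \<le> q" "q \<le> \<delta>" using True by (auto simp: q_def)
      then have "q\<^sup>2 \<le> \<delta>\<^sup>2" by (intro power_mono)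
      moreover have "(p + q)\<^sup>2 \<le> 2 * p\<^sup>2 + 2 * q\<^sup>2" using weighted_square_add[of 1 p q] by simp
      moreover have "0 \<le> \<delta>\<^sup>2 * p\<^sup>2" by simp
      moreover have "2 * (1 + \<delta>\<^sup>2) * (1 + p\<^sup>2) = 2 + 2 * p\<^sup>2 + 2 * \<delta>\<^sup>2 + 2 * (\<delta>\<^sup>2 * p\<^sup>2)"
        by (simp add: algebra_simps)
      ultimately have "1 + (p + q)\<^sup>2 \<le> 2 * (1 + \<delta>\<^sup>2) * (1 + p\<^sup>2)" by linarith
      moreover have "0 < 1 + p\<^sup>2" "0 < 1 + (p + q)\<^sup>2" by (auto simp: add_pos_nonneg)
      ultimately have "1 / (1 + p\<^sup>2) \<le> 2 * (1 + \<delta>\<^sup>2) * (1 / (1 + (p + q)\<^sup>2))"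
        by (simp add: field_simps)
      moreover have pq: "p + q = t - y" by (simp add: p_def q_def)
      ultimately have "1 / (1 + (\<mu> k - y)\<^sup>2) \<le> 2 * (1 + \<delta>\<^sup>2) * (1 / (1 + (t - y)\<^sup>2))"
        unfolding pq by (simp only: p_def)
      then have "ennreal (1 / (1 + (\<mu> k - y)\<^sup>2)) \<le> ennreal (2 * (1 + \<delta>\<^sup>2) * (1 / (1 + (t - y)\<^sup>2)))" by (rule ennreal_leI)
      also have "\<dots> = ennreal (2 * (1 + \<delta>\<^sup>2)) * ennreal (1 / (1 + (t - y)\<^sup>2))"
        by (rule ennreal_mult) (auto simp: add_nonneg_nonneg)
      finally show ?thesis using True r by simp
    qed (auto simp: indicator_def)
    have "ennreal \<delta> * ?w k = (\<integral>\<^sup>+t. ?w k * indicator {\<mu> k..<\<mu> k + \<delta>} t \<partial>lborel)"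
      using \<delta> by (subst nn_integral_cmult) (auto simp: mult.commute)
    also have "\<dots> \<le> (\<integral>\<^sup>+t. ennreal (2 * (1 + \<delta>\<^sup>2)) * (?g t * indicator {\<mu> k..<\<mu> k + \<delta>} t) \<partial>lborel)"
      by (intro nn_integral_mono le)
    also have "\<dots> = ennreal (2 * (1 + \<delta>\<^sup>2)) * (\<integral>\<^sup>+t. ?g t * indicator {\<mu> k..<\<mu> k + \<delta>} t \<partial>lborel)"
      by (rule nn_integral_cmult) measurable
    finally have "ennreal (1 / \<delta>) * (ennreal \<delta> * ?w k) \<le> ennreal (1 / \<delta>) * (ennreal (2 * (1 + \<delta>\<^sup>2)) * (\<integral>\<^sup>+t. ?g t * indicator {\<mu> k..<\<mu> k + \<delta>} t \<partial>lborel))"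
      by (rule mult_left_mono) simp
    moreover have "ennreal (1 / \<delta>) * ennreal \<delta> = 1" 
      using \<delta> by (simp add: ennreal_mult[symmetric])
    moreover have "ennreal (1 / \<delta>) * ennreal (2 * (1 + \<delta>\<^sup>2)) = ennreal (2 * (1 + \<delta>\<^sup>2) / \<delta>)"
      using \<delta> by (subst ennreal_mult[symmetric]) (auto simp: add_nonneg_nonneg)
    ultimately show ?thesis by (simp only: mult.assoc[symmetric] mult_1)
  qed
  have "(\<integral>\<^sup>+k. ?w k \<partial>count_space UNIV) \<le> (\<integral>\<^sup>+k. ennreal (2 * (1 + \<delta>\<^sup>2) / \<delta>) * (\<integral>\<^sup>+t. ?g t * indicator {\<mu> k..<\<mu> k + \<delta>} t \<partial>lborel) \<partial>count_space UNIV)"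
    by (intro nn_integral_mono single)
  also have "\<dots> = ennreal (2 * (1 + \<delta>\<^sup>2) / \<delta>) * (\<integral>\<^sup>+k. (\<integral>\<^sup>+t. ?g t * indicator {\<mu> k..<\<mu> k + \<delta>} t \<partial>lborel) \<partial>count_space UNIV)"
    by (rule nn_integral_cmult) simp
  also have "\<dots> \<le> ennreal (2 * (1 + \<delta>\<^sup>2) / \<delta>) * (\<integral>\<^sup>+t. ?g t \<partial>lborel)"
    by (intro mult_left_mono nn_integral_disjoint_intervals_le[OF sep order_refl]) auto
  also have "(\<integral>\<^sup>+t. ?g t \<partial>lborel) = cauchy_tail r"
    unfolding cauchy_tail_def using nn_integral_real_affine[of ?g 1 y] by simp
  finally show ?thesis .
qed

section \<open>Stability of translates of the window\<close>

lemma integral_cis_period: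
  assumes "L > 0"
  shows "(LINT \<nu>|lborel. indicator {- (L / 2)..L / 2} \<nu> *\<^sub>R cis (2 * pi * real_of_int n * \<nu> / L)) = (if n = 0 then L else 0)"
proof (cases "n = 0")
  case True
  then have "(LINT \<nu>|lborel. indicator {- (L / 2)..L / 2} \<nu> *\<^sub>R cis (2 * pi * real_of_int n * \<nu> / L))
    = (LINT \<nu>|lborel. complex_of_real (indicator {- (L / 2)..L / 2} \<nu>))"
    by (simp add: scaleR_conv_of_real)
  also have "\<dots> = complex_of_real L" using assms by (simp only: integral_complex_of_real) simp
  finally show ?thesis using True by simp
next
  case False
  define \<omega> where "\<omega> = 2 * pi * real_of_int n / L"
  have \<omega>: "\<omega> \<noteq> 0" using False assms by (simp add: \<omega>_def)
  define E where "E \<nu> = exp (\<i> * \<omega> * complex_of_real \<nu>) / (\<i> * \<omega>)" for \<nu> :: real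
  have "(E has_vector_derivative cis (\<omega> * \<nu>)) (at \<nu> within S)" for \<nu> S
  proof -
    have "((\<lambda>z. exp (\<i> * \<omega> * z) / (\<i> * \<omega>)) has_field_derivative exp (\<i> * \<omega> * \<nu>)) (at (complex_of_real \<nu>))"
      using \<omega> by (auto intro!: derivative_eq_intros)
    from has_vector_derivative_real_field[OF this, of S] show ?thesis
      by (simp add: E_def[abs_def] cis_conv_exp mult_ac)
  qed
  then have "(LINT \<nu>|lborel. indicator {- (L / 2)..L / 2} \<nu> *\<^sub>R cis (\<omega> * \<nu>)) = E (L / 2) - E (- (L / 2))"
    using assms by (intro integral_FTC_Icc) (auto intro!: continuous_intros)
  also have "\<dots> = (cis (pi * real_of_int n) - cis (- (pi * real_of_int n))) / (\<i> * \<omega>)"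
  proof -
    have "\<omega> * (L / 2) = pi * real_of_int n" using assms by (simp add: \<omega>_def)
    then have "E (L / 2) = cis (pi * real_of_int n) / (\<i> * \<omega>)" "E (- (L / 2)) = cis (- (pi * real_of_int n)) / (\<i> * \<omega>)"
      unfolding E_def cis_conv_exp mult.assoc of_real_mult[symmetric] mult_minus_right by simp_all
    then show ?thesis by (simp only: diff_divide_distrib)
  qed
  also have "cis (pi * real_of_int n) - cis (- (pi * real_of_int n)) = 0" by (simp add: complex_eq_iff)
  finally show ?thesis using False by (simp add: \<omega>_def mult_ac)
qed


lemma trig_polynomial_norm:
  fixes a :: "int \<Rightarrow> complex"
  assumes L: "L > 0" and J: "finite J"
  shows "(LINT \<nu>|lborel. indicator {- (L / 2)..L / 2} \<nu> * (cmod (\<Sum>j\<in>J. a j * cis (- (2 * pi * real_of_int j * \<nu> / L))))\<^sup>2)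
    = L * (\<Sum>j\<in>J. (cmod (a j))\<^sup>2)"
proof -
  let ?I = "\<lambda>\<nu>. indicator {- (L / 2)..L / 2} \<nu> :: real"
  let ?e = "\<lambda>j \<nu>. cis (- (2 * pi * real_of_int j * \<nu> / L))"
  let ?P = "\<lambda>\<nu>. \<Sum>j\<in>J. a j * ?e j \<nu>"
  have prod: "?e j \<nu> * cnj (?e k \<nu>) = cis (2 * pi * real_of_int (k - j) * \<nu> / L)" for j k \<nu>
    by (simp add: cis_cnj cis_mult) (simp add: algebra_simps diff_divide_distrib)
  have int: "integrable lborel (\<lambda>\<nu>. ?I \<nu> *\<^sub>R cis (2 * pi * real_of_int n * \<nu> / L))" for n
  proof -
    have "integrable lborel (\<lambda>\<nu>. complex_of_real (?I \<nu>) * cis (2 * pi * real_of_int n * \<nu> / L))"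
      by (intro integrable_mult_cis) auto
    then show ?thesis by (simp add: scaleR_conv_of_real)
  qed
  have "complex_of_real (LINT \<nu>|lborel. ?I \<nu> * (cmod (?P \<nu>))\<^sup>2) = (LINT \<nu>|lborel. complex_of_real (?I \<nu> * (cmod (?P \<nu>))\<^sup>2))"
    by (simp only: integral_complex_of_real)
  also have "\<dots> = (LINT \<nu>|lborel. (\<Sum>j\<in>J. \<Sum>k\<in>J. (a j * cnj (a k)) * (?I \<nu> *\<^sub>R cis (2 * pi * real_of_int (k - j) * \<nu> / L))))"
  proof (rule Bochner_Integration.integral_cong)
    fix \<nu>
    have "complex_of_real (?I \<nu> * (cmod (?P \<nu>))\<^sup>2) = ?I \<nu> *\<^sub>R (?P \<nu> * cnj (?P \<nu>))"
      by (simp only: of_real_mult complex_norm_square scaleR_conv_of_real)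
    also have "?P \<nu> * cnj (?P \<nu>) = (\<Sum>j\<in>J. \<Sum>k\<in>J. (a j * ?e j \<nu>) * cnj (a k * ?e k \<nu>))"
      by (simp only: cnj_sum sum_product)
    also have "\<dots> = (\<Sum>j\<in>J. \<Sum>k\<in>J. (a j * cnj (a k)) * cis (2 * pi * real_of_int (k - j) * \<nu> / L))"
      unfolding prod[symmetric] by (intro sum.cong refl) (simp only: complex_cnj_mult mult_ac)
    also have "?I \<nu> *\<^sub>R \<dots> = (\<Sum>j\<in>J. \<Sum>k\<in>J. (a j * cnj (a k)) * (?I \<nu> *\<^sub>R cis (2 * pi * real_of_int (k - j) * \<nu> / L)))"
      by (simp only: scaleR_sum_right mult_scaleR_right)
    finally show "complex_of_real (?I \<nu> * (cmod (?P \<nu>))\<^sup>2)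
      = (\<Sum>j\<in>J. \<Sum>k\<in>J. (a j * cnj (a k)) * (?I \<nu> *\<^sub>R cis (2 * pi * real_of_int (k - j) * \<nu> / L)))" .
  qed simp
  also have "\<dots> = (\<Sum>j\<in>J. \<Sum>k\<in>J. (a j * cnj (a k)) * (LINT \<nu>|lborel. ?I \<nu> *\<^sub>R cis (2 * pi * real_of_int (k - j) * \<nu> / L)))"
    by (subst Bochner_Integration.integral_sum, intro Bochner_Integration.integrable_sum integrable_mult_right int,
        intro sum.cong refl, subst Bochner_Integration.integral_sum, intro integrable_mult_right int,
        intro sum.cong refl integral_mult_right_zero)
  also have "\<dots> = (\<Sum>j\<in>J. \<Sum>k\<in>J. (if k = j then a j * cnj (a j) * L else 0))"
    unfolding integral_cis_period[OF L] by (intro sum.cong refl) auto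
  also have "\<dots> = (\<Sum>j\<in>J. a j * cnj (a j) * L)" using J by simp
  also have "\<dots> = complex_of_real (\<Sum>j\<in>J. (cmod (a j))\<^sup>2 * L)"
    by (simp only: of_real_sum of_real_mult complex_norm_square)
  finally show ?thesis by (simp only: of_real_eq_iff sum_distrib_left mult.commute)
qed

text \<open>Translates by \<open>j / L\<close> are modulations of the window. On the shorter band of
  length \<open>L\<close> the exponentials are orthogonal and the window is at least
  \<open>cos (pi * L / (2 * \<Omega>))\<close>, which is positive because
  \<open>L < \<Omega>\<close>; this limits cancellation between the translates.\<close>

lemma cos_window_trig_polynomial:
  fixes a :: "int \<Rightarrow> complex"
  assumes L: "0 < L" "L < \<Omega>" and J: "finite J"
  defines "F \<equiv> \<lambda>\<nu>. cos_window \<Omega> \<nu> * (\<Sum>j\<in>J. a j * cis (- (2 * pi * real_of_int j * \<nu> / L)))"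
  shows "bandlimited \<Omega> F" and "\<forall>\<nu>. \<Omega> / 2 < \<bar>\<nu>\<bar> \<longrightarrow> F \<nu> = 0"
    and "pw F (complex_of_real x) = (\<Sum>j\<in>J. a j * inv_fourier (cos_window \<Omega>) (x - real_of_int j / L))"
    and "(cos (pi * L / (2 * \<Omega>)))\<^sup>2 * L * (\<Sum>j\<in>J. (cmod (a j))\<^sup>2) \<le> (L2_norm lborel F)\<^sup>2"
proof -
  let ?P = "\<lambda>\<nu>. \<Sum>j\<in>J. a j * cis (- (2 * pi * real_of_int j * \<nu> / L))"
  show supp: "\<forall>\<nu>. \<Omega> / 2 < \<bar>\<nu>\<bar> \<longrightarrow> F \<nu> = 0"
    by (auto simp: F_def cos_window_def indicator_def)
  have [measurable]: "F \<in> borel_measurable borel" unfolding F_def by measurable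
  have P_bound: "cmod (?P \<nu>) \<le> (\<Sum>j\<in>J. cmod (a j))" for \<nu>
    by (rule order_trans[OF norm_sum]) (simp add: norm_mult)
  have sq: "square_integrable lborel F"
  proof (rule square_integrable_bound)
    show "integrable lborel (\<lambda>\<nu>. (\<Sum>j\<in>J. cmod (a j))\<^sup>2 * indicator {- (\<Omega> / 2)..\<Omega> / 2} \<nu> :: real)" by simp
    show "AE \<nu> in lborel. (cmod (F \<nu>))\<^sup>2 \<le> (\<Sum>j\<in>J. cmod (a j))\<^sup>2 * indicator {- (\<Omega> / 2)..\<Omega> / 2} \<nu>"
    proof (rule AE_I2)
      fix \<nu>
      have "cmod (F \<nu>) \<le> indicator {- (\<Omega> / 2)..\<Omega> / 2} \<nu> * (\<Sum>j\<in>J. cmod (a j))"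
        unfolding F_def norm_mult by (intro mult_mono norm_cos_window_le P_bound) auto
      then have "(cmod (F \<nu>))\<^sup>2 \<le> (indicator {- (\<Omega> / 2)..\<Omega> / 2} \<nu> * (\<Sum>j\<in>J. cmod (a j)))\<^sup>2"
        by (intro power_mono) auto
      then show "(cmod (F \<nu>))\<^sup>2 \<le> (\<Sum>j\<in>J. cmod (a j))\<^sup>2 * indicator {- (\<Omega> / 2)..\<Omega> / 2} \<nu>"
        by (auto simp: indicator_def split: if_splits)
    qed
  qed measurable
  then show "bandlimited \<Omega> F" using supp by (simp add: bandlimited_def)
  show "pw F (complex_of_real x) = (\<Sum>j\<in>J. a j * inv_fourier (cos_window \<Omega>) (x - real_of_int j / L))"
  proof -
    have "pw F (complex_of_real x) = (LINT \<nu>|lborel. (\<Sum>j\<in>J. a j * (cos_window \<Omega> \<nu> * cis (2 * pi * (x - real_of_int j / L) * \<nu>))))"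
      unfolding pw_of_real inv_fourier_def
    proof (rule Bochner_Integration.integral_cong)
      fix \<nu>
      have "cis (- (2 * pi * real_of_int j * \<nu> / L)) * cis (2 * pi * x * \<nu>) = cis (2 * pi * (x - real_of_int j / L) * \<nu>)" for j
        by (simp add: cis_mult algebra_simps)
      then show "F \<nu> * cis (2 * pi * x * \<nu>) = (\<Sum>j\<in>J. a j * (cos_window \<Omega> \<nu> * cis (2 * pi * (x - real_of_int j / L) * \<nu>)))"
        unfolding F_def sum_distrib_left sum_distrib_right by (intro sum.cong refl) (simp only: mult_ac)
    qed simp
    also have "\<dots> = (\<Sum>j\<in>J. a j * (LINT \<nu>|lborel. cos_window \<Omega> \<nu> * cis (2 * pi * (x - real_of_int j / L) * \<nu>)))"
      by (subst Bochner_Integration.integral_sum, intro integrable_mult_right integrable_mult_cis integrable_cos_window, measurable)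
    finally show ?thesis by (simp only: inv_fourier_def)
  qed
  let ?c = "cos (pi * L / (2 * \<Omega>))" and ?I = "\<lambda>\<nu>. indicator {- (L / 2)..L / 2} \<nu> :: real"
  have c: "0 \<le> ?c"
  proof (rule cos_ge_zero)
    have "0 \<le> pi * L / (2 * \<Omega>)" using L by simp
    then show "- (pi / 2) \<le> pi * L / (2 * \<Omega>)" using pi_gt_zero by linarith
    show "pi * L / (2 * \<Omega>) \<le> pi / 2" using L by (simp add: field_simps)
  qed
  have le: "?c\<^sup>2 * (?I \<nu> * (cmod (?P \<nu>))\<^sup>2) \<le> (cmod (F \<nu>))\<^sup>2" for \<nu>
  proof (cases "\<nu> \<in> {- (L / 2)..L / 2}")
    case True
    then have abs: "\<bar>\<nu>\<bar> \<le> L / 2" by auto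
    have "\<bar>pi * \<nu> / \<Omega>\<bar> = pi * \<bar>\<nu>\<bar> / \<Omega>" using L by (simp add: abs_mult)
    also have "\<dots> \<le> pi * (L / 2) / \<Omega>" using L abs by (intro divide_right_mono mult_left_mono) auto
    finally have "\<bar>pi * \<nu> / \<Omega>\<bar> \<le> pi * L / (2 * \<Omega>)" by simp
    moreover have "pi * L / (2 * \<Omega>) \<le> pi" using L by (simp add: field_simps)
    ultimately have "?c \<le> cos \<bar>pi * \<nu> / \<Omega>\<bar>" by (intro cos_monotone_0_pi_le) auto
    also have "\<dots> = cos (pi * \<nu> / \<Omega>)" by (rule cos_abs_real)
    finally have cc: "?c \<le> cos (pi * \<nu> / \<Omega>)" .
    have "cmod (F \<nu>) = cos (pi * \<nu> / \<Omega>) * cmod (?P \<nu>)"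
      using abs L cc c by (auto simp: F_def cos_window_def indicator_def norm_mult)
    moreover have "?c * cmod (?P \<nu>) \<le> cos (pi * \<nu> / \<Omega>) * cmod (?P \<nu>)" using cc by (rule mult_right_mono) simp
    ultimately have "(?c * cmod (?P \<nu>))\<^sup>2 \<le> (cmod (F \<nu>))\<^sup>2" using c by (intro power_mono) auto
    then show ?thesis using True by (simp add: power_mult_distrib)
  qed simp
  have "?c\<^sup>2 * L * (\<Sum>j\<in>J. (cmod (a j))\<^sup>2) = (LINT \<nu>|lborel. ?c\<^sup>2 * (?I \<nu> * (cmod (?P \<nu>))\<^sup>2))"
    using trig_polynomial_norm[OF L(1) J, of a] by simp
  also have "\<dots> \<le> (LINT \<nu>|lborel. (cmod (F \<nu>))\<^sup>2)"
  proof (rule integral_mono)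
    show int: "integrable lborel (\<lambda>\<nu>. (cmod (F \<nu>))\<^sup>2)" using sq by (simp add: square_integrable_def)
    show "integrable lborel (\<lambda>\<nu>. ?c\<^sup>2 * (?I \<nu> * (cmod (?P \<nu>))\<^sup>2))"
      by (rule Bochner_Integration.integrable_bound[OF int]) (use le in auto)
  qed (rule le)
  finally show "?c\<^sup>2 * L * (\<Sum>j\<in>J. (cmod (a j))\<^sup>2) \<le> (L2_norm lborel F)\<^sup>2" by (simp add: L2_norm_sq)
qed


section \<open>Dimension count and density\<close>

lemma finite_scaled_integers:
  assumes "L > 0"
  shows "finite {j::int. real_of_int j / L \<in> {a..<b}}"
    and "L * (b - a) - 1 \<le> real (card {j::int. real_of_int j / L \<in> {a..<b}})"
proof -
  have eq: "{j::int. real_of_int j / L \<in> {a..<b}} = {\<lceil>a * L\<rceil>..<\<lceil>b * L\<rceil>}"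
    using assms by (auto simp: pos_le_divide_eq pos_divide_less_eq ceiling_le_iff less_ceiling_iff)
  show "finite {j::int. real_of_int j / L \<in> {a..<b}}" unfolding eq by simp
  have "L * (b - a) - 1 \<le> real_of_int (\<lceil>b * L\<rceil> - \<lceil>a * L\<rceil>)"
  proof -
    have "L * (b - a) = b * L - a * L" by (simp add: algebra_simps)
    then show ?thesis
      using le_of_int_ceiling[of "b * L"] of_int_ceiling_le_add_one[of "a * L"] unfolding of_int_diff by linarith
  qed
  also have "\<dots> \<le> real (nat (\<lceil>b * L\<rceil> - \<lceil>a * L\<rceil>))" by simp
  finally show "L * (b - a) - 1 \<le> real (card {j::int. real_of_int j / L \<in> {a..<b}})"
    unfolding eq by simp
qed

text \<open>With fewer sampling points near an interval than translates of the window inside it, some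
  nonzero combination of the translates vanishes at all of these points, and what is left of its
  samples is controlled by the tail of the window.\<close>

lemma pw_sampling_imp_card_le:
  assumes L: "0 < L" "L < \<Omega>" and sep: "separated \<delta> \<Lambda>" and C: "C > 0"
    and sampling: "\<And>F. bandlimited \<Omega> F \<Longrightarrow> (\<forall>\<nu>. \<Omega> / 2 < \<bar>\<nu>\<bar> \<longrightarrow> F \<nu> = 0) \<Longrightarrow>
      ennreal ((L2_norm lborel F)\<^sup>2) \<le> ennreal C * sample_energy \<Lambda> F"
  shows "\<exists>R\<ge>0. \<forall>a b. card {j::int. real_of_int j / L \<in> {a..<b}} \<le> card {k. \<Lambda> k \<in> {a - R..<b + R}}"
proof -
  have \<delta>: "\<delta> > 0" using sep by (simp add: separated_def)
  let ?g = "inv_fourier (cos_window \<Omega>)"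
  obtain K where K: "K > 0" "\<And>x. cmod (?g x) \<le> K / (1 + x\<^sup>2)"
    using inv_fourier_cos_window_decay[of \<Omega>] L by auto
  have sepL: "separated (1 / L) (\<lambda>j. real_of_int j / L)"
    using L by (simp add: separated_def add_divide_distrib)
  define w where "w k j = 1 / (1 + (\<Lambda> k - real_of_int j / L)\<^sup>2)" for k j
  have w: "0 < w k j" for k j by (simp add: w_def add_pos_nonneg)
  \<comment> \<open>At radius \<open>- (1 / L)\<close> the cutoff in
    \<open>separated_cauchy_sum_le\<close> is 0 and excludes nothing, so \<open>X\<close> bounds the
    full sum of the weights over \<open>j\<close>.\<close>
  define X where "X = ennreal (2 * (1 + (1 / L)\<^sup>2) / (1 / L)) * cauchy_tail (- (1 / L))"
  have "X < \<infinity>" unfolding X_def using cauchy_tail_finite by (simp add: ennreal_mult_less_top)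
  then obtain K0 where K0: "X = ennreal K0" "K0 \<ge> 0" by (cases X) auto
  have sum_w: "(\<Sum>j\<in>J. w k j) \<le> K0" if J: "finite J" for J k
  proof -
    have "ennreal (\<Sum>j\<in>J. w k j) = (\<Sum>j\<in>J. ennreal (w k j))" using w by (intro sum_ennreal[symmetric] less_imp_le)
    also have "\<dots> = (\<integral>\<^sup>+j. ennreal (w k j) * indicator J j \<partial>count_space UNIV)"
      using J by (subst nn_integral_count_space'[where A=J]) (auto simp: indicator_def)
    also have "\<dots> \<le> (\<integral>\<^sup>+j. ennreal (1 / (1 + (real_of_int j / L - \<Lambda> k)\<^sup>2)) * indicator {j. - (1 / L) + 1 / L \<le> \<bar>real_of_int j / L - \<Lambda> k\<bar>} j \<partial>count_space UNIV)"
      by (intro nn_integral_mono) (auto simp: w_def indicator_def power2_commute)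
    also have "\<dots> \<le> X" unfolding X_def by (rule separated_cauchy_sum_le[OF sepL])
    finally show ?thesis using K0 by (simp add: ennreal_le_iff)
  qed
  define D where "D = 2 * (1 + \<delta>\<^sup>2) / \<delta>"
  have D: "D > 0" using \<delta> by (simp add: D_def add_pos_nonneg)
  define c where "c = (cos (pi * L / (2 * \<Omega>)))\<^sup>2 * L"
  have c: "c > 0"
  proof -
    have "0 < cos (pi * L / (2 * \<Omega>))" using L by (intro cos_gt_zero) (auto simp: field_simps)
    then show ?thesis using L by (simp add: c_def)
  qed
  \<comment> \<open>Chosen so that the sampling inequality would give \<open>c \<le> c / 2\<close>;
    \<open>K0 + 1\<close> keeps the denominator positive even if \<open>K0 = 0\<close>.\<close>
  define \<epsilon> where "\<epsilon> = c / (2 * (C * K\<^sup>2 * (K0 + 1) * D))"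
  have denom: "C * K\<^sup>2 * (K0 + 1) * D > 0" using C K D K0 by simp
  then have \<epsilon>: "\<epsilon> > 0" using c by (simp add: \<epsilon>_def)
  obtain r where r: "r \<ge> 0" "cauchy_tail r \<le> ennreal \<epsilon>" using cauchy_tail_small[OF \<epsilon>] by blast
  show ?thesis
  proof (intro exI[of _ "r + \<delta>"] conjI allI)
    show "0 \<le> r + \<delta>" using r \<delta> by simp
    fix a b
    define J where "J = {j::int. real_of_int j / L \<in> {a..<b}}"
    define Q where "Q = {k. \<Lambda> k \<in> {a - (r + \<delta>)..<b + (r + \<delta>)}}"
    have J: "finite J" unfolding J_def by (rule finite_scaled_integers[OF L(1)])
    have Q: "finite Q" unfolding Q_def by (rule separated_finite[OF sep])
    show "card {j::int. real_of_int j / L \<in> {a..<b}} \<le> card {k. \<Lambda> k \<in> {a - (r + \<delta>)..<b + (r + \<delta>)}}"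
      unfolding J_def[symmetric] Q_def[symmetric]
    proof (rule ccontr)
      assume "\<not> card J \<le> card Q"
      then obtain \<alpha> :: "int \<Rightarrow> complex" where \<alpha>: "\<exists>j\<in>J. \<alpha> j \<noteq> 0" "\<And>k. k \<in> Q \<Longrightarrow> (\<Sum>j\<in>J. ?g (\<Lambda> k - real_of_int j / L) * \<alpha> j) = 0"
        using homogeneous_system_solution[OF Q J, of "\<lambda>k j. ?g (\<Lambda> k - real_of_int j / L)"] by auto
      define F where "F = (\<lambda>\<nu>. cos_window \<Omega> \<nu> * (\<Sum>j\<in>J. \<alpha> j * cis (- (2 * pi * real_of_int j * \<nu> / L))))"
      note F = cos_window_trig_polynomial[OF L J, of \<alpha>, folded F_def]
      define S where "S = (\<Sum>j\<in>J. (cmod (\<alpha> j))\<^sup>2)"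
      have S: "S > 0"
      proof -
        obtain j where j: "j \<in> J" "\<alpha> j \<noteq> 0" using \<alpha>(1) by blast
        show ?thesis unfolding S_def by (rule sum_pos2[OF J j(1)]) (use j in auto)
      qed
      have point: "ennreal ((cmod (pw F (\<Lambda> k)))\<^sup>2) \<le> ennreal (K\<^sup>2 * K0) *
        (\<Sum>j\<in>J. ennreal ((cmod (\<alpha> j))\<^sup>2) * (ennreal (w k j) * indicator {k. r + \<delta> \<le> \<bar>\<Lambda> k - real_of_int j / L\<bar>} k))" for k
      proof (cases "k \<in> Q")
        case True
        then have "pw F (\<Lambda> k) = 0" using \<alpha>(2)[OF True] by (simp add: F(3) mult.commute)
        then show ?thesis by simp
      next
        case False
        have far: "r + \<delta> \<le> \<bar>\<Lambda> k - real_of_int j / L\<bar>" if "j \<in> J" for j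
          using False that by (auto simp: Q_def J_def)
        have "cmod (pw F (\<Lambda> k)) \<le> (\<Sum>j\<in>J. cmod (\<alpha> j) * (K * w k j))"
          unfolding F(3)
        proof (rule order_trans[OF norm_sum sum_mono])
          fix j
          show "cmod (\<alpha> j * ?g (\<Lambda> k - real_of_int j / L)) \<le> cmod (\<alpha> j) * (K * w k j)"
            using mult_left_mono[OF K(2)[of "\<Lambda> k - real_of_int j / L"], of "cmod (\<alpha> j)"] by (simp add: norm_mult w_def)
        qed
        \<comment> \<open>Splitting the weight evenly for Cauchy-Schwarz is Schur's test: one factor
          is bounded by \<open>K0\<close> uniformly in \<open>k\<close>, the other keeps the decay
          that is summed over \<open>k\<close> afterwards.\<close>
        also have "\<dots> = K * (\<Sum>j\<in>J. (cmod (\<alpha> j) * sqrt (w k j)) * sqrt (w k j))"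
          using w by (simp add: sum_distrib_left mult_ac less_imp_le flip: real_sqrt_mult)
        finally have "(cmod (pw F (\<Lambda> k)))\<^sup>2 \<le> (K * (\<Sum>j\<in>J. (cmod (\<alpha> j) * sqrt (w k j)) * sqrt (w k j)))\<^sup>2"
          by (rule power_mono) simp
        also have "\<dots> \<le> K\<^sup>2 * ((\<Sum>j\<in>J. (cmod (\<alpha> j) * sqrt (w k j))\<^sup>2) * (\<Sum>j\<in>J. (sqrt (w k j))\<^sup>2))"
          unfolding power_mult_distrib[of K] by (intro mult_left_mono Cauchy_Schwarz_ineq_sum) simp
        also have "\<dots> = K\<^sup>2 * ((\<Sum>j\<in>J. (cmod (\<alpha> j))\<^sup>2 * w k j) * (\<Sum>j\<in>J. w k j))"
          using w by (simp add: power_mult_distrib less_imp_le)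
        also have "\<dots> \<le> K\<^sup>2 * ((\<Sum>j\<in>J. (cmod (\<alpha> j))\<^sup>2 * w k j) * K0)"
          using w by (intro mult_left_mono sum_w J sum_nonneg) (auto simp: less_imp_le)
        finally have "ennreal ((cmod (pw F (\<Lambda> k)))\<^sup>2) \<le> ennreal (K\<^sup>2 * K0 * (\<Sum>j\<in>J. (cmod (\<alpha> j))\<^sup>2 * w k j))"
          by (intro ennreal_leI) (simp add: mult_ac)
        also have "\<dots> = ennreal (K\<^sup>2 * K0) * (\<Sum>j\<in>J. ennreal ((cmod (\<alpha> j))\<^sup>2 * w k j))"
          using w K0 by (subst ennreal_mult) (auto intro!: sum_nonneg simp: less_imp_le)
        also have "(\<Sum>j\<in>J. ennreal ((cmod (\<alpha> j))\<^sup>2 * w k j)) = 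
          (\<Sum>j\<in>J. ennreal ((cmod (\<alpha> j))\<^sup>2) * (ennreal (w k j) * indicator {k. r + \<delta> \<le> \<bar>\<Lambda> k - real_of_int j / L\<bar>} k))"
          using far w by (intro sum.cong refl) (simp add: ennreal_mult less_imp_le)
        finally show ?thesis .
      qed
      have "sample_energy \<Lambda> F
        \<le> (\<integral>\<^sup>+k. ennreal (K\<^sup>2 * K0) * (\<Sum>j\<in>J. ennreal ((cmod (\<alpha> j))\<^sup>2) * (ennreal (w k j) * indicator {k. r + \<delta> \<le> \<bar>\<Lambda> k - real_of_int j / L\<bar>} k)) \<partial>count_space UNIV)"
        by (intro nn_integral_mono point)
      also have "\<dots> = ennreal (K\<^sup>2 * K0) * (\<Sum>j\<in>J. ennreal ((cmod (\<alpha> j))\<^sup>2) *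
          (\<integral>\<^sup>+k. ennreal (w k j) * indicator {k. r + \<delta> \<le> \<bar>\<Lambda> k - real_of_int j / L\<bar>} k \<partial>count_space UNIV))"
        by (simp add: nn_integral_cmult nn_integral_sum)
      also have "\<dots> \<le> ennreal (K\<^sup>2 * K0) * (\<Sum>j\<in>J. ennreal ((cmod (\<alpha> j))\<^sup>2) * ennreal (D * \<epsilon>))"
      proof (intro mult_left_mono sum_mono)
        fix j
        have "(\<integral>\<^sup>+k. ennreal (w k j) * indicator {k. r + \<delta> \<le> \<bar>\<Lambda> k - real_of_int j / L\<bar>} k \<partial>count_space UNIV) \<le> ennreal D * cauchy_tail r"
          unfolding w_def D_def by (rule separated_cauchy_sum_le[OF sep])
        also have "\<dots> \<le> ennreal D * ennreal \<epsilon>" by (intro mult_left_mono r) simp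
        also have "\<dots> = ennreal (D * \<epsilon>)" using D \<epsilon> by (intro ennreal_mult[symmetric]) auto
        finally show "(\<integral>\<^sup>+k. ennreal (w k j) * indicator {k. r + \<delta> \<le> \<bar>\<Lambda> k - real_of_int j / L\<bar>} k \<partial>count_space UNIV) \<le> ennreal (D * \<epsilon>)" .
      qed auto
      also have "\<dots> = ennreal (K\<^sup>2 * K0 * (S * (D * \<epsilon>)))"
        using K0 D \<epsilon> S by (simp add: sum_distrib_right[symmetric] S_def ennreal_mult sum_nonneg)
      finally have samples: "sample_energy \<Lambda> F \<le> ennreal (K\<^sup>2 * K0 * (S * (D * \<epsilon>)))" .
      have "ennreal (c * S) \<le> ennreal ((L2_norm lborel F)\<^sup>2)"
        using F(4) by (intro ennreal_leI) (simp add: c_def S_def)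
      also have "\<dots> \<le> ennreal C * sample_energy \<Lambda> F"
        by (rule sampling[OF F(1)]) (use F(2) in \<open>simp add: F_def\<close>)
      also have "\<dots> \<le> ennreal C * ennreal (K\<^sup>2 * K0 * (S * (D * \<epsilon>)))" by (intro mult_left_mono samples) simp
      also have "\<dots> = ennreal (C * (K\<^sup>2 * K0 * (S * (D * \<epsilon>))))"
        using C K0 D \<epsilon> S by (intro ennreal_mult[symmetric]) auto
      finally have "c * S \<le> C * (K\<^sup>2 * K0 * (S * (D * \<epsilon>)))"
        using C K0 D \<epsilon> S by (subst (asm) ennreal_le_iff) auto
      also have "\<dots> = (C * K\<^sup>2 * K0 * D * \<epsilon>) * S" by (simp only: mult_ac)
      finally have "c \<le> C * K\<^sup>2 * K0 * D * \<epsilon>" using S by simp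
      also have "\<dots> \<le> C * K\<^sup>2 * (K0 + 1) * D * \<epsilon>"
        using C K D \<epsilon> by (intro mult_right_mono mult_left_mono) auto
      also have "\<dots> = c / 2" unfolding \<epsilon>_def using denom by (simp add: field_simps)
      finally show False using c by simp
    qed
  qed
qed

text \<open>The loss \<open>R\<close> at either end of the interval is fixed, so it disappears when
  the count is divided by the window length; \<open>L\<close> may then approach
  \<open>\<Omega>\<close>.\<close>

theorem pw_sampling_imp_density:
  assumes \<Omega>: "\<Omega> > 0" and sep: "separated \<delta> \<Lambda>" and C: "C > 0"
    and sampling: "\<And>F. bandlimited \<Omega> F \<Longrightarrow> (\<forall>\<nu>. \<Omega> / 2 < \<bar>\<nu>\<bar> \<longrightarrow> F \<nu> = 0) \<Longrightarrow>
      ennreal ((L2_norm lborel F)\<^sup>2) \<le> ennreal C * sample_energy \<Lambda> F"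
  shows "lower_beurling_density \<Lambda> \<ge> ereal \<Omega>"
proof -
  have ev: "eventually (\<lambda>h. ereal q < ereal (real (min_points \<Lambda> h) / h)) at_top" if q: "q < \<Omega>" for q :: real
  proof -
    \<comment> \<open>The maximum with 0 keeps \<open>L\<close> positive when \<open>q\<close> is
      negative.\<close>
    obtain L where L: "max q 0 < L" "L < \<Omega>" using dense[of "max q 0" \<Omega>] q \<Omega> by auto
    obtain R where R: "R \<ge> 0" "\<And>a b. card {j::int. real_of_int j / L \<in> {a..<b}} \<le> card {k. \<Lambda> k \<in> {a - R..<b + R}}"
      using pw_sampling_imp_card_le[OF _ L(2) sep C sampling] L(1) by auto
    have min: "L * (h - 2 * R) - 1 \<le> real (min_points \<Lambda> h)" for h
    proof -
      have "min_points \<Lambda> h \<in> range (\<lambda>x. card (range \<Lambda> \<inter> {x - h / 2..<x + h / 2}))"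
        unfolding min_points_def by (rule Inf_nat_def1) auto
      then obtain x where x: "min_points \<Lambda> h = card (range \<Lambda> \<inter> {x - h / 2..<x + h / 2})" by blast
      \<comment> \<open>The nodes \<open>j / L\<close> are counted in the window shortened by
        \<open>R\<close> at both ends, so that the enlarged interval of the comparison is the window
        itself.\<close>
      have "L * (h - 2 * R) - 1 = L * ((x + h / 2 - R) - (x - h / 2 + R)) - 1" by simp
      also have "\<dots> \<le> real (card {j::int. real_of_int j / L \<in> {x - h / 2 + R..<x + h / 2 - R}})"
        by (rule finite_scaled_integers) (use L in auto)
      also have "\<dots> \<le> real (card {k. \<Lambda> k \<in> {x - h / 2 + R - R..<x + h / 2 - R + R}})"
        by (intro of_nat_mono R)
      also have "\<dots> = real (min_points \<Lambda> h)" unfolding x card_range_Int[OF separated_inj[OF sep]] by simp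
      finally show ?thesis .
    qed
    \<comment> \<open>The threshold is where \<open>L * (h - 2 * R) - 1\<close> overtakes
      \<open>q * h\<close>.\<close>
    have "eventually (\<lambda>h. max 0 ((2 * R * L + 1) / (L - q)) < h) at_top" by (rule eventually_gt_at_top)
    then show ?thesis
    proof eventually_elim
      case (elim h)
      then have h: "h > 0" "(2 * R * L + 1) / (L - q) < h" by auto
      then have "2 * R * L + 1 < h * (L - q)" using L by (simp add: pos_divide_less_eq)
      then have "q * h < real (min_points \<Lambda> h)" using min[of h] by (simp add: algebra_simps)
      then show ?case using h by (simp add: pos_less_divide_eq)
    qed
  qed
  show ?thesis
    unfolding lower_beurling_density_def le_Liminf_iff
  proof (intro allI impI)
    fix y assume y: "y < ereal \<Omega>"
    show "eventually (\<lambda>h. y < ereal (real (min_points \<Lambda> h) / h)) at_top"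
    proof (cases y)
      case (real q)
      then show ?thesis using ev[of q] y by simp
    qed (use y in auto)
  qed
qed

theorem theorem4p6:
  fixes T \<Omega> :: real and \<Lambda> :: "int \<Rightarrow> real"
  assumes "T > 0" and "\<Omega> > 0"
    and "\<forall>k. \<Lambda> (k + 1) > \<Lambda> k"
    and "uniformly_discrete \<Lambda>"
  shows "(set_of_sampling \<Lambda> (OPW ({0..T} \<times> {- \<Omega> / 2..\<Omega> / 2})) \<longrightarrow>
            lower_beurling_density \<Lambda> \<ge> ereal \<Omega>) \<and>
         (lower_beurling_density \<Lambda> > ereal \<Omega> \<and> (\<forall>k. \<Lambda> (k + 1) - \<Lambda> k \<ge> T) \<longrightarrow>
            set_of_sampling \<Lambda> (OPW ({0..T} \<times> {- \<Omega> / 2..\<Omega> / 2})))"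
proof -
  \<comment> \<open>This \<open>\<delta>\<close> is unrelated to \<open>T\<close> and serves the
    necessary condition; in the sufficient one the gap hypothesis makes \<open>T\<close> itself a
    separation constant.\<close>
  obtain \<delta> where sep: "separated \<delta> \<Lambda>"
    using assms(4) by (auto simp: uniformly_discrete_def separated_def)
  have "lower_beurling_density \<Lambda> \<ge> ereal \<Omega>" if sampling: "set_of_sampling \<Lambda> (OPW ({0..T} \<times> {- \<Omega> / 2..\<Omega> / 2}))"
  proof -
    obtain C where "C > 0" "\<And>F. bandlimited \<Omega> F \<Longrightarrow> (\<forall>\<nu>. \<Omega> / 2 < \<bar>\<nu>\<bar> \<longrightarrow> F \<nu> = 0) \<Longrightarrow>
      ennreal ((L2_norm lborel F)\<^sup>2) \<le> ennreal C * sample_energy \<Lambda> F"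
      using operator_sampling_imp_pw_sampling[OF assms(1,2) sep sampling] by blast
    then show ?thesis by (rule pw_sampling_imp_density[OF assms(2) sep])
  qed
  then show ?thesis using sampling_sufficient[OF assms(1,2)] by blast
qed

end
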